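(* Let $p\ge 5$ be a prime, let $a\ge 0$ be an integer, let $F=\langle x,y\rangle$ be the free group of rank $2$, and let $H=\langle x^{p^a},y\rangle^F$. Let $n\ge 2$ and let $W$ be a normal subgroup of $F$ such that $U_{n+1}\le W\le P_n(H)$. Then $F/W$ is a Beauville group if and only if $W\cap V_n$ is either equal to $V_n$ or to $U_{n+1}$.
   Context: $\langle X\rangle^F$ denotes the normal closure of $X$ in $F$; $y^g=g^{-1}yg$. For a group $G$, $\gamma_i(G)$ is the $i$-th term of the lower central series ($\gamma_1(G)=G$), $G^{m}$ is the subgroup generated by all $m$-th powers of elements of $G$, and the lower $p$-central series is $P_1(G)=G$, $P_n(G)=[P_{n-1}(G),G]\,P_{n-1}(G)^p$ for $n>1$. For $n\ge 2$, \[ U_n=H^{p^{n-1}}\gamma_2(H)^{p^{n-2}}P_{n+1}(H). \] For $n\ge 2$, \[ V_n=\langle x^{p^{a+n-1}},\ (y^{x^{p^a-1}}\cdots y^{x}y)^{p^{n-1}}\rangle\,U_{n+1}. \] A spherical triple of generators of a group $G$ is a tuple $(r,s,t)$ with $G=\langle r,s,t\rangle$ and $rst=1$. A finite group $G$ is a Beauville group if it admits two spherical triples of generators $T_1,T_2$ such that $\langle t_1\rangle^g\cap\langle t_2\rangle=1$ for all components $t_1$ of $T_1$, all components $t_2$ of $T_2$, and all $g\in G$. *)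

theory Defs
  imports
    "HOL-Algebra.Generated_Groups"
    "HOL-Algebra.Elementary_Groups"
    "HOL-Computational_Algebra.Primes"
begin

section \<open>Free groups\<close>

text \<open>
  A letter \<open>(g, True)\<close> stands for the generator \<open>g\<close>, and \<open>(g, False)\<close> for its inverse. The free
  group on the type \<open>'g\<close> consists of the reduced words, multiplied by concatenation followed by
  free reduction. The lemmas \<open>free_group_is_group\<close>, \<open>free_group_generated\<close> and
  \<open>free_group_universal\<close> below show that this is indeed the free group with basis
  \<open>range fgen\<close>.
\<close>

type_synonym 'g letter = "'g \<times> bool"

definition inv_letter :: "'g letter \<Rightarrow> 'g letter" where
  "inv_letter l = (fst l, \<not> snd l)"

definition reduced :: "'g letter list \<Rightarrow> bool" where
  "reduced w \<longleftrightarrow> successively (\<lambda>l m. m \<noteq> inv_letter l) w"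

text \<open>Left multiplication of a reduced word by a letter:\<close>

fun lmult :: "'g letter \<Rightarrow> 'g letter list \<Rightarrow> 'g letter list" where
  "lmult l [] = [l]"
| "lmult l (m # w) = (if m = inv_letter l then w else l # m # w)"

definition free_group :: "'g letter list monoid" where
  "free_group = \<lparr>carrier = {w. reduced w}, monoid.mult = (\<lambda>u v. foldr lmult u v), one = []\<rparr>"

definition fgen :: "'g \<Rightarrow> 'g letter list" where
  "fgen g = [(g, True)]"

lemma inv_letter_inv [simp]: "inv_letter (inv_letter l) = l"
  by (simp add: inv_letter_def)

lemma inv_letter_eq_iff [simp]: "inv_letter l = inv_letter m \<longleftrightarrow> l = m"
  by (metis inv_letter_inv)

lemma inv_letter_neq [simp]: "inv_letter l \<noteq> l" "l \<noteq> inv_letter l"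
  by (metis inv_letter_def snd_conv)+

lemma reduced_Nil [simp]: "reduced []"
  by (simp add: reduced_def)

lemma reduced_Cons: "reduced (l # w) \<longleftrightarrow> reduced w \<and> (w = [] \<or> hd w \<noteq> inv_letter l)"
  by (auto simp: reduced_def successively_Cons)

lemma reduced_lmult: "reduced w \<Longrightarrow> reduced (lmult l w)"
  by (cases w) (auto simp: reduced_Cons)

lemma lmult_inv: "reduced w \<Longrightarrow> lmult (inv_letter l) (lmult l w) = w"
  by (cases w rule: remdups_adj.cases) (auto simp: reduced_Cons)

lemma lmult_inv': "reduced w \<Longrightarrow> lmult l (lmult (inv_letter l) w) = w"
  using lmult_inv[of w "inv_letter l"] by simp

lemma reduced_foldr: "reduced v \<Longrightarrow> reduced (foldr lmult u v)"
  by (induction u) (auto intro: reduced_lmult)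

lemma foldr_lmult_lmult:
  assumes "reduced w"
  shows "foldr lmult (lmult l v) w = lmult l (foldr lmult v w)"
  using assms by (cases v) (auto simp: lmult_inv' reduced_foldr)

lemma foldr_lmult_assoc:
  assumes "reduced w"
  shows "foldr lmult (foldr lmult u v) w = foldr lmult u (foldr lmult v w)"
  using assms by (induction u) (auto simp: foldr_lmult_lmult)

lemma foldr_lmult_Nil: "reduced u \<Longrightarrow> foldr lmult u [] = u"
proof (induction u)
  case (Cons l u)
  then show ?case
    by (cases u) (auto simp: reduced_Cons)
qed simp

lemma foldr_lmult_inverse:
  "reduced w \<Longrightarrow> foldr lmult (rev (map inv_letter u)) (foldr lmult u w) = w"
  by (induction u) (auto simp: lmult_inv reduced_foldr)

theorem free_group_is_group: "group (free_group :: 'g letter list monoid)"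
proof (rule groupI)
  fix u :: "'g letter list"
  assume u: "u \<in> carrier free_group"
  let ?v = "foldr lmult (rev (map inv_letter u)) []"
  have "foldr lmult ?v u = []"
    using u foldr_lmult_inverse[of "[]" u]
    by (simp add: free_group_def foldr_lmult_assoc foldr_lmult_Nil)
  moreover have "reduced ?v"
    by (rule reduced_foldr) simp
  ultimately show "\<exists>v\<in>carrier free_group. v \<otimes>\<^bsub>free_group\<^esub> u = \<one>\<^bsub>free_group\<^esub>"
    by (intro bexI[of _ ?v]) (simp_all add: free_group_def)
qed (auto simp: free_group_def reduced_foldr foldr_lmult_assoc)

lemma fgen_closed: "fgen g \<in> carrier free_group"
  by (simp add: free_group_def fgen_def reduced_Cons)

lemma inv_fgen: "inv\<^bsub>free_group\<^esub> (fgen g) = [(g, False)]"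
  by (rule group.inv_equality[OF free_group_is_group])
    (simp_all add: free_group_def fgen_def reduced_Cons inv_letter_def)

theorem free_group_generated:
  "generate free_group (range fgen) = carrier (free_group :: 'g letter list monoid)"
proof
  show "generate free_group (range fgen) \<subseteq> carrier (free_group :: 'g letter list monoid)"
    by (rule group.generate_incl[OF free_group_is_group]) (auto simp: fgen_closed)
  have letter: "[l] \<in> generate free_group (range fgen)" for l :: "'g letter"
  proof (cases l)
    case (Pair g b)
    show ?thesis
    proof (cases b)
      case True
      then show ?thesis
        using Pair generate.incl[of "fgen g" "range fgen"] by (simp add: fgen_def)
    next
      case False
      then show ?thesis
        using Pair generate.inv[of "fgen g" "range fgen" free_group] by (simp add: inv_fgen)
    qed
  qed
  have "reduced w \<Longrightarrow> w \<in> generate free_group (range fgen)" for w :: "'g letter list"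
  proof (induction w)
    case Nil
    show ?case
      using generate.one[of free_group "range fgen"] by (simp add: free_group_def)
  next
    case (Cons l w)
    then have "[l] \<otimes>\<^bsub>free_group\<^esub> w \<in> generate free_group (range fgen)"
      by (intro generate.eng letter) (auto simp: reduced_Cons)
    moreover have "[l] \<otimes>\<^bsub>free_group\<^esub> w = l # w"
      using Cons.prems by (cases w) (auto simp: free_group_def reduced_Cons)
    ultimately show ?case by simp
  qed
  then show "carrier (free_group :: 'g letter list monoid) \<subseteq> generate free_group (range fgen)"
    by (auto simp: free_group_def)
qed

theorem free_group_universal:
  fixes G (structure) and f :: "'g \<Rightarrow> 'a"
  assumes "group G" and f: "range f \<subseteq> carrier G"
  shows "\<exists>h \<in> hom free_group G. \<forall>g. h (fgen g) = f g"
proof -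
  interpret group G by fact
  define ev where "ev l = (if snd l then f (fst l) else inv (f (fst l)))" for l :: "'g letter"
  define h where "h w = foldr (\<lambda>l r. ev l \<otimes> r) w \<one>" for w
  have fc: "f g \<in> carrier G" for g
    using f by auto
  have ev: "ev l \<in> carrier G" for l
    by (simp add: ev_def fc)
  have ev_inv: "ev l \<otimes> ev (inv_letter l) = \<one>" for l
    by (simp add: ev_def inv_letter_def fc)
  have h: "h w \<in> carrier G" for w
    by (induction w) (simp_all add: h_def ev)
  have lm: "h (lmult l w) = ev l \<otimes> h w" for l w
  proof (cases w)
    case (Cons m v)
    have "ev l \<otimes> (ev (inv_letter l) \<otimes> h v) = h v"
      using m_assoc[of "ev l" "ev (inv_letter l)" "h v"] by (simp add: ev h ev_inv)
    then show ?thesis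
      using Cons by (auto simp: h_def)
  qed (simp add: h_def)
  have "h (foldr lmult u v) = h u \<otimes> h v" for u v
  proof (induction u)
    case (Cons l u)
    then have "h (foldr lmult (l # u) v) = ev l \<otimes> (h u \<otimes> h v)"
      by (simp add: lm)
    also have "\<dots> = (ev l \<otimes> h u) \<otimes> h v"
      by (simp add: m_assoc ev h)
    finally show ?case
      by (simp add: h_def)
  qed (use h in \<open>simp add: h_def\<close>)
  then have "h \<in> hom free_group G"
    by (auto simp: hom_def free_group_def h)
  moreover have "h (fgen g) = f g" for g
    by (simp add: h_def fgen_def ev_def fc)
  ultimately show ?thesis by blast
qed

datatype gen2 = GX | GY

definition F2 :: "gen2 letter list monoid" where
  "F2 = free_group"

definition x2 :: "gen2 letter list" where
  "x2 = fgen GX"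

definition y2 :: "gen2 letter list" where
  "y2 = fgen GY"


section \<open>Subgroup constructions\<close>

text \<open>
  The subgroups attached to a group \<open>A\<close> below are formed for subgroups \<open>A\<close> of an ambient
  group \<open>G\<close>; for \<open>G\<close> itself, take \<open>A = carrier G\<close>.
\<close>

definition conjugate :: "('a, 'b) monoid_scheme \<Rightarrow> 'a \<Rightarrow> 'a \<Rightarrow> 'a" where
  "conjugate G y g = inv\<^bsub>G\<^esub> g \<otimes>\<^bsub>G\<^esub> y \<otimes>\<^bsub>G\<^esub> g"

definition normal_closure :: "('a, 'b) monoid_scheme \<Rightarrow> 'a set \<Rightarrow> 'a set" where
  "normal_closure G S = \<Inter>{N. N \<lhd> G \<and> S \<subseteq> N}"

definition power_subgroup :: "('a, 'b) monoid_scheme \<Rightarrow> 'a set \<Rightarrow> nat \<Rightarrow> 'a set" where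
  "power_subgroup G A m = generate G ((\<lambda>z. z [^]\<^bsub>G\<^esub> m) ` A)"

definition comm_subgroup :: "('a, 'b) monoid_scheme \<Rightarrow> 'a set \<Rightarrow> 'a set \<Rightarrow> 'a set" where
  "comm_subgroup G A B = generate G
    {inv\<^bsub>G\<^esub> u \<otimes>\<^bsub>G\<^esub> inv\<^bsub>G\<^esub> v \<otimes>\<^bsub>G\<^esub> u \<otimes>\<^bsub>G\<^esub> v | u v. u \<in> A \<and> v \<in> B}"

text \<open>Both series are indexed from 1; the value at 0 is immaterial.\<close>

fun lower_central :: "('a, 'b) monoid_scheme \<Rightarrow> 'a set \<Rightarrow> nat \<Rightarrow> 'a set" where
  "lower_central G A 0 = A"
| "lower_central G A (Suc 0) = A"
| "lower_central G A (Suc (Suc n)) = comm_subgroup G (lower_central G A (Suc n)) A"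

fun lower_p_central :: "('a, 'b) monoid_scheme \<Rightarrow> nat \<Rightarrow> 'a set \<Rightarrow> nat \<Rightarrow> 'a set" where
  "lower_p_central G p A 0 = A"
| "lower_p_central G p A (Suc 0) = A"
| "lower_p_central G p A (Suc (Suc n)) =
     comm_subgroup G (lower_p_central G p A (Suc n)) A
       <#>\<^bsub>G\<^esub> power_subgroup G (lower_p_central G p A (Suc n)) p"


section \<open>The subgroups \<open>H\<close>, \<open>U\<^sub>n\<close> and \<open>V\<^sub>n\<close> of the free group\<close>

definition H_sub :: "nat \<Rightarrow> nat \<Rightarrow> gen2 letter list set" where
  "H_sub p a = normal_closure F2 {x2 [^]\<^bsub>F2\<^esub> (p ^ a), y2}"

text \<open>\<open>U_sub\<close> and \<open>V_sub\<close> are only meant for \<open>n \<ge> 2\<close>, where the subtractions do not truncate.\<close>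

definition U_sub :: "nat \<Rightarrow> nat \<Rightarrow> nat \<Rightarrow> gen2 letter list set" where
  "U_sub p a n =
     power_subgroup F2 (H_sub p a) (p ^ (n - 1))
       <#>\<^bsub>F2\<^esub> power_subgroup F2 (lower_central F2 (H_sub p a) 2) (p ^ (n - 2))
       <#>\<^bsub>F2\<^esub> lower_p_central F2 p (H_sub p a) (n + 1)"

text \<open>\<open>y_conj_prod k\<close> is the product of the \<open>k\<close> conjugates of \<open>y\<close> by \<open>x\<^sup>k\<^sup>-\<^sup>1, \<dots>, x, 1\<close>, in this order.\<close>

fun y_conj_prod :: "nat \<Rightarrow> gen2 letter list" where
  "y_conj_prod 0 = \<one>\<^bsub>F2\<^esub>"
| "y_conj_prod (Suc k) = conjugate F2 y2 (x2 [^]\<^bsub>F2\<^esub> k) \<otimes>\<^bsub>F2\<^esub> y_conj_prod k"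

definition V_sub :: "nat \<Rightarrow> nat \<Rightarrow> nat \<Rightarrow> gen2 letter list set" where
  "V_sub p a n =
     generate F2 {x2 [^]\<^bsub>F2\<^esub> (p ^ (a + n - 1)), y_conj_prod (p ^ a) [^]\<^bsub>F2\<^esub> (p ^ (n - 1))}
       <#>\<^bsub>F2\<^esub> U_sub p a (n + 1)"


section \<open>Beauville groups\<close>

definition spherical_triple :: "('a, 'b) monoid_scheme \<Rightarrow> 'a \<times> 'a \<times> 'a \<Rightarrow> bool" where
  "spherical_triple G = (\<lambda>(r, s, t).
     r \<in> carrier G \<and> s \<in> carrier G \<and> t \<in> carrier G \<and>
     generate G {r, s, t} = carrier G \<and> r \<otimes>\<^bsub>G\<^esub> s \<otimes>\<^bsub>G\<^esub> t = \<one>\<^bsub>G\<^esub>)"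

fun components :: "'a \<times> 'a \<times> 'a \<Rightarrow> 'a set" where
  "components (r, s, t) = {r, s, t}"

definition beauville_group :: "('a, 'b) monoid_scheme \<Rightarrow> bool" where
  "beauville_group G \<longleftrightarrow>
     group G \<and> finite (carrier G) \<and>
     (\<exists>T1 T2. spherical_triple G T1 \<and> spherical_triple G T2 \<and>
        (\<forall>t1 \<in> components T1. \<forall>t2 \<in> components T2. \<forall>g \<in> carrier G.
           (\<lambda>z. conjugate G z g) ` generate G {t1} \<inter> generate G {t2} = {\<one>\<^bsub>G\<^esub>}))"

end

theory Submission
  imports Defs "HOL-Algebra.Zassenhaus"
begin

text \<open>
  Write \<open>H\<close> for the normal closure of \<open>X = x\<^sup>q\<close> and \<open>y\<close>, where \<open>q = p\<^sup>a\<close>, and \<open>Y\<close> for the product of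
  the conjugates of \<open>y\<close> by \<open>x\<^sup>q\<^sup>-\<^sup>1, \<dots>, x, 1\<close>. Everything rests on one fact: modulo \<open>U\<^sub>m\<^sub>+\<^sub>2\<close>, raising to the
  power \<open>p\<^sup>m\<close> is a homomorphism \<open>\<pi>\<close> on \<open>H\<close> (\<open>pow_p_pow_mult\<close>). It kills \<open>\<gamma>\<^sub>2(H)\<close>, its values have order
  dividing \<open>p\<close>, and they commute with \<open>H\<close>. For \<open>m = 1\<close> this is the collection formula in class three,
  whose binomial coefficients are divisible by \<open>p\<close> because \<open>p \<ge> 5\<close>; later steps only meet pairs of
  elements whose commutator is central of order \<open>p\<close>, since \<open>[P\<^sub>k, P\<^sub>2] \<le> P\<^sub>k\<^sub>+\<^sub>2\<close>.

  It follows that \<open>\<pi>(X)\<close> and \<open>\<pi>(Y)\<close> are central in \<open>F / U\<^sub>m\<^sub>+\<^sub>2\<close>, and that every \<open>g\<close> whose exponent sum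
  \<open>i\<close> in \<open>x\<close> is prime to \<open>q\<close>, with exponent sum \<open>j\<close> in \<open>y\<close>, satisfies \<open>g ^ (q p\<^sup>m) = \<pi>(X)\<^sup>i \<pi>(Y)\<^sup>j\<close>
  (\<open>hom_pow_eq_XY\<close>): up to a power, \<open>g\<^sup>q\<close> is \<open>x\<^sup>q\<close> times the norm of an element of \<open>H\<close> with respect to \<open>x\<close>, and
  \<open>\<pi>\<close> of such a norm depends only on the exponent sums (\<open>pi_norm\<close>). So the subgroup of order \<open>p\<close> in the
  cyclic group of \<open>g\<close> is governed by the point \<open>(i : j)\<close> of a projective line over the field with \<open>p\<close>
  elements. The group \<open>V\<^sub>n / U\<^sub>n\<^sub>+\<^sub>1\<close> is this plane for \<open>m = n - 1\<close>. Two additive functions on \<open>H\<close>,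
  the exponent sum in \<open>x\<close> divided by \<open>q\<close> and a count of letters \<open>y\<close> at positions where the \<open>x\<close>-exponent is
  divisible by \<open>q\<close>, show that \<open>\<pi>(X)\<close> and \<open>\<pi>(Y)\<close> are independent (\<open>independence\<close>).

  If \<open>W\<close> contains all of \<open>V\<^sub>n\<close>, or meets it only in \<open>U\<^sub>n\<^sub>+\<^sub>1\<close>, elements with distinct points
  \<open>(i : j)\<close> generate cyclic subgroups of \<open>F / W\<close> whose conjugates intersect trivially. The triples
  starting with \<open>x, y\<close> and with \<open>x y\<^sup>2, x y\<^sup>4\<close> have six distinct points as \<open>p \<ge> 5\<close>, so they form a
  Beauville structure (\<open>sufficiency\<close>); only the component \<open>y\<close>, which has exponent sum \<open>0\<close> in \<open>x\<close>, needs a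
  separate argument with norms (\<open>y_trivial_intersection\<close>). Otherwise \<open>W\<close> cuts \<open>V\<^sub>n / U\<^sub>n\<^sub>+\<^sub>1\<close> in a line,
  and \<open>V\<^sub>n\<close> has image of order \<open>p\<close> in \<open>F / W\<close>. Each generating triple has a component off this line and with
  exponent sum in \<open>x\<close> prime to \<open>p\<close>, and the cyclic group of that component contains the image of \<open>V\<^sub>n\<close>; so the two
  triples always share it (\<open>necessity\<close>).
\<close>

section \<open>Powers of a product in class three\<close>

context group
begin

lemma pow_swap:
  assumes "x \<in> carrier G" "y \<in> carrier G" "z \<in> carrier G"
    and xy: "x \<otimes> y = y \<otimes> x \<otimes> z" and zx: "z \<otimes> x = x \<otimes> z"
  shows "x [^] (n::nat) \<otimes> y = y \<otimes> x [^] n \<otimes> z [^] n"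
proof (induction n)
  case (Suc n)
  have zn: "z [^] n \<otimes> x = x \<otimes> z [^] n"
    by (rule group_commutes_pow) (use assms in auto)
  have "x [^] Suc n \<otimes> y = x [^] n \<otimes> (x \<otimes> y)"
    using assms by (simp add: m_assoc)
  also have "\<dots> = (x [^] n \<otimes> y) \<otimes> x \<otimes> z"
    using assms by (simp add: m_assoc xy)
  also have "\<dots> = y \<otimes> x [^] n \<otimes> (z [^] n \<otimes> x) \<otimes> z"
    using assms by (simp add: m_assoc Suc)
  also have "\<dots> = y \<otimes> x [^] Suc n \<otimes> z [^] Suc n"
    unfolding zn using assms by (simp add: m_assoc)
  finally show ?case .
qed (use assms in simp)

text \<open>The collection formula for \<open>c = [k, h]\<close>, \<open>d = [c, h]\<close>, \<open>e = [c, k]\<close>: moving the last \<open>h\<close> to the left past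
  \<open>k\<^sup>n\<close> and \<open>c\<^sup>r\<close> with \<open>r = n choose 2\<close> creates \<open>c\<^sup>n e\<^sup>r\<close> and \<open>d\<^sup>r\<close>, and then moving \<open>k\<close> past the powers of \<open>c\<close> creates
  \<open>e\<^sup>n\<close> and \<open>e\<^sup>r\<close>; Pascal's rule adds up the exponents.\<close>

lemma pow_mult_class_3:
  assumes cl: "h \<in> carrier G" "k \<in> carrier G" "c \<in> carrier G" "d \<in> carrier G" "e \<in> carrier G"
    and kh: "k \<otimes> h = h \<otimes> k \<otimes> c" and ch: "c \<otimes> h = h \<otimes> c \<otimes> d" and ck: "c \<otimes> k = k \<otimes> c \<otimes> e"
    and d: "d \<otimes> h = h \<otimes> d" "d \<otimes> k = k \<otimes> d" "d \<otimes> c = c \<otimes> d"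
    and e: "e \<otimes> h = h \<otimes> e" "e \<otimes> k = k \<otimes> e" "e \<otimes> c = c \<otimes> e" "d \<otimes> e = e \<otimes> d"
  shows "(h \<otimes> k) [^] (n::nat) = h [^] n \<otimes> k [^] n \<otimes> c [^] (n choose 2)
    \<otimes> d [^] (n choose 3) \<otimes> e [^] ((n choose 2) + 2 * (n choose 3))"
proof -
  have cm: "z [^] (m::nat) \<otimes> w [^] (l::nat) = w [^] l \<otimes> z [^] m"
    if "z \<otimes> w = w \<otimes> z" "z \<in> carrier G" "w \<in> carrier G" for z w m l
  proof -
    have "z [^] m \<otimes> w = w \<otimes> z [^] m"
      by (rule group_commutes_pow) (use that in auto)
    then show ?thesis
      using group_commutes_pow[of w "z [^] m" l] that by simp
  qed
  have chn: "c [^] n \<otimes> h = h \<otimes> c [^] n \<otimes> d [^] n" for n :: nat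
    by (rule pow_swap) (use cl ch d in auto)
  have ckn: "c [^] n \<otimes> k = k \<otimes> c [^] n \<otimes> e [^] n" for n :: nat
    by (rule pow_swap) (use cl ck e in auto)
  have dh: "d [^] n \<otimes> h = h \<otimes> d [^] n" and dk: "d [^] n \<otimes> k = k \<otimes> d [^] n"
    and eh: "e [^] n \<otimes> h = h \<otimes> e [^] n" and ek: "e [^] n \<otimes> k = k \<otimes> e [^] n" for n :: nat
    using cm[of d h n 1] cm[of d k n 1] cm[of e h n 1] cm[of e k n 1] d e cl by auto
  have ec: "e [^] n \<otimes> c [^] m = c [^] m \<otimes> e [^] n"
    and dc: "d [^] n \<otimes> c [^] m = c [^] m \<otimes> d [^] n"
    and ed: "e [^] n \<otimes> d [^] m = d [^] m \<otimes> e [^] n" for n m :: nat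
    using cm[of e c n m] cm[of d c n m] cm[of e d n m] d e cl by auto
  have ec1: "e [^] n \<otimes> c = c \<otimes> e [^] n" for n :: nat
    using ec[of n 1] cl by simp
  have knh: "k [^] n \<otimes> h = h \<otimes> k [^] n \<otimes> c [^] n \<otimes> e [^] (n choose 2)" for n :: nat
  proof (induction n)
    case (Suc n)
    have "k [^] Suc n \<otimes> h = k [^] n \<otimes> h \<otimes> k \<otimes> c"
      using cl by (simp add: m_assoc kh)
    also have "\<dots> = h \<otimes> k [^] n \<otimes> c [^] n \<otimes> (e [^] (n choose 2) \<otimes> k) \<otimes> c"
      using cl by (simp add: m_assoc Suc)
    also have "\<dots> = h \<otimes> k [^] n \<otimes> (c [^] n \<otimes> k) \<otimes> (e [^] (n choose 2) \<otimes> c)"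
      unfolding ek using cl by (simp add: m_assoc)
    also have "\<dots> = h \<otimes> k [^] n \<otimes> k \<otimes> c [^] n \<otimes> (e [^] n \<otimes> c) \<otimes> e [^] (n choose 2)"
      unfolding ckn ec1[of "n choose 2"] using cl by (simp add: m_assoc)
    also have "\<dots> = h \<otimes> k [^] Suc n \<otimes> c [^] Suc n \<otimes> (e [^] n \<otimes> e [^] (n choose 2))"
      unfolding ec1 using cl by (simp add: m_assoc)
    also have "e [^] n \<otimes> e [^] (n choose 2) = e [^] (Suc n choose 2)"
      using cl by (simp add: nat_pow_mult numeral_2_eq_2)
    finally show ?case .
  qed (use cl in \<open>simp add: numeral_2_eq_2\<close>)
  have left: "u \<otimes> (v \<otimes> z) = w \<otimes> z"
    if "u \<otimes> v = w" "u \<in> carrier G" "v \<in> carrier G" "z \<in> carrier G" for u v w z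
    using that m_assoc by metis
  note collect = eh ek dh dk ec dc ed chn ckn knh
  show ?thesis
  proof (induction n)
    case (Suc n)
    define r s t where rst: "r = n choose 2" "s = n choose 3" "t = (n choose 2) + 2 * (n choose 3)"
    have "(h \<otimes> k) [^] Suc n = h [^] n \<otimes> (k [^] n \<otimes> (c [^] r \<otimes> (d [^] s \<otimes> (e [^] t \<otimes> (h \<otimes> k)))))"
      using cl by (simp add: m_assoc Suc rst)
    also have "\<dots> = h [^] Suc n \<otimes> k [^] Suc n \<otimes> (c [^] n \<otimes> c [^] r) \<otimes> (d [^] r \<otimes> d [^] s) \<otimes>
        (e [^] n \<otimes> (e [^] r \<otimes> (e [^] r \<otimes> e [^] t)))"
      using cl by (simp add: m_assoc collect collect[THEN left] rst)
    also have "\<dots> = h [^] Suc n \<otimes> k [^] Suc n \<otimes> c [^] (n + r) \<otimes> d [^] (r + s) \<otimes> e [^] (n + (r + (r + t)))"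
      using cl by (simp add: nat_pow_mult)
    also have "n + r = Suc n choose 2"
      by (simp add: rst numeral_2_eq_2)
    also have "r + s = Suc n choose 3"
      by (simp add: rst numeral_2_eq_2 numeral_3_eq_3)
    also have "n + (r + (r + t)) = (Suc n choose 2) + 2 * (Suc n choose 3)"
      by (simp_all add: rst numeral_2_eq_2 numeral_3_eq_3)
    finally show ?case by simp
  qed (use cl in \<open>simp add: numeral_2_eq_2 numeral_3_eq_3\<close>)
qed

end

lemma prime_dvd_choose_2_3:
  fixes p :: nat
  assumes "Factorial_Ring.prime p" "p \<ge> 5"
  shows "p dvd (p choose 2)" "p dvd (p choose 3)"
  using assms by (auto intro!: dvd_choose_prime)

lemma (in group) pow_prime_mult_class_3:
  fixes p :: nat
  assumes p: "Factorial_Ring.prime p" "p \<ge> 5"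
    and cl: "h \<in> carrier G" "k \<in> carrier G" "c \<in> carrier G" "d \<in> carrier G" "e \<in> carrier G"
    and kh: "k \<otimes> h = h \<otimes> k \<otimes> c" and ch: "c \<otimes> h = h \<otimes> c \<otimes> d" and ck: "c \<otimes> k = k \<otimes> c \<otimes> e"
    and d: "d \<otimes> h = h \<otimes> d" "d \<otimes> k = k \<otimes> d" "d \<otimes> c = c \<otimes> d"
    and e: "e \<otimes> h = h \<otimes> e" "e \<otimes> k = k \<otimes> e" "e \<otimes> c = c \<otimes> e" "d \<otimes> e = e \<otimes> d"
    and ord: "c [^] p = \<one>" "d [^] p = \<one>" "e [^] p = \<one>"
  shows "(h \<otimes> k) [^] p = h [^] p \<otimes> k [^] p"
proof -
  have pow1: "z [^] m = \<one>" if "p dvd m" "z [^] p = \<one>" "z \<in> carrier G" for z m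
    using that by (metis dvd_def nat_pow_one nat_pow_pow)
  have "p dvd (p choose 2)" "p dvd (p choose 3)"
    by (rule prime_dvd_choose_2_3[OF p])+
  then have "c [^] (p choose 2) = \<one>" "d [^] (p choose 3) = \<one>"
    "e [^] ((p choose 2) + 2 * (p choose 3)) = \<one>"
    using ord cl by (auto intro!: pow1)
  then show ?thesis
    using pow_mult_class_3[OF cl kh ch ck d e, of p] cl by simp
qed

declare mult_FactGroup [simp del] one_FactGroup [simp del]

section \<open>Normal subgroups and commutators\<close>

definition commutator :: "('a, 'b) monoid_scheme \<Rightarrow> 'a \<Rightarrow> 'a \<Rightarrow> 'a" where
  "commutator G u v = inv\<^bsub>G\<^esub> u \<otimes>\<^bsub>G\<^esub> inv\<^bsub>G\<^esub> v \<otimes>\<^bsub>G\<^esub> u \<otimes>\<^bsub>G\<^esub> v"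

lemma (in normal) quotient_hom: "group_hom G (G Mod H) ((#>) H)"
  using r_coset_hom_Mod factorgroup_is_group
  by (auto intro: group_hom.intro group_hom_axioms.intro)

lemma (in normal) coset_eq_one_iff:
  assumes "a \<in> carrier G"
  shows "H #> a = \<one>\<^bsub>G Mod H\<^esub> \<longleftrightarrow> a \<in> H"
  using assms rcos_self[OF assms] subgroup_axioms coset_join2[OF assms] one_FactGroup[of G H] by auto

lemma set_multI: "a \<in> M \<Longrightarrow> b \<in> N \<Longrightarrow> a \<otimes>\<^bsub>G\<^esub> b \<in> M <#>\<^bsub>G\<^esub> N"
  by (auto simp: set_mult_def)

lemma set_multE:
  assumes "z \<in> M <#>\<^bsub>G\<^esub> N"
  obtains a b where "z = a \<otimes>\<^bsub>G\<^esub> b" "a \<in> M" "b \<in> N"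
  using assms by (auto simp: set_mult_def)

context group
begin

lemma inv_mult_cancel:
  assumes "a \<in> carrier G" "b \<in> carrier G"
  shows "inv a \<otimes> (a \<otimes> b) = b" "a \<otimes> (inv a \<otimes> b) = b"
  using assms by (simp_all flip: m_assoc)

lemma coset_eqD:
  assumes "subgroup N G" "a \<in> carrier G" "b \<in> carrier G" "N #> a = N #> b"
  obtains z where "z \<in> N" "a = z \<otimes> b"
proof -
  have "a \<in> N #> b"
    using rcos_self[OF assms(2,1)] assms(4) by simp
  then show ?thesis
    using that by (auto simp: r_coset_def)
qed

lemma commutator_closed [simp]:
  "u \<in> carrier G \<Longrightarrow> v \<in> carrier G \<Longrightarrow> commutator G u v \<in> carrier G"
  by (simp add: commutator_def)

lemma mult_eq_mult_commutator:
  assumes "u \<in> carrier G" "v \<in> carrier G"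
  shows "u \<otimes> v = v \<otimes> u \<otimes> commutator G u v"
  using assms by (simp add: commutator_def m_assoc inv_mult_cancel)

lemma commutator_eq_one_iff:
  assumes "u \<in> carrier G" "v \<in> carrier G"
  shows "commutator G u v = \<one> \<longleftrightarrow> u \<otimes> v = v \<otimes> u"
  using mult_eq_mult_commutator[OF assms] assms by auto

lemma conj_mult:
  assumes "g \<in> carrier G" "u \<in> carrier G" "v \<in> carrier G"
  shows "g \<otimes> (u \<otimes> v) \<otimes> inv g = (g \<otimes> u \<otimes> inv g) \<otimes> (g \<otimes> v \<otimes> inv g)"
  using assms by (simp add: m_assoc inv_mult_cancel)

lemma normal_setmult:
  assumes "M \<lhd> G" "N \<lhd> G"
  shows "M <#> N \<lhd> G"
proof -
  interpret M: normal M G by fact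
  interpret N: normal N G by fact
  have "subgroup (M <#> N) G"
    by (rule mult_norm_subgroup[OF assms(1) N.subgroup_axioms])
  then show ?thesis
    unfolding normal_inv_iff
  proof (intro conjI ballI)
    fix g z assume g: "g \<in> carrier G" and MN: "z \<in> M <#> N"
    from MN obtain m n where z: "z = m \<otimes> n" "m \<in> M" "n \<in> N"
      by (rule set_multE)
    have eq: "g \<otimes> z \<otimes> inv g = (g \<otimes> m \<otimes> inv g) \<otimes> (g \<otimes> n \<otimes> inv g)"
      using z g by (simp add: conj_mult)
    show "g \<otimes> z \<otimes> inv g \<in> M <#> N"
      unfolding eq using z g by (intro set_multI M.inv_op_closed2 N.inv_op_closed2) auto
  qed
qed

lemma setmult_least:
  assumes "subgroup K G" "M \<subseteq> K" "N \<subseteq> K"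
  shows "M <#> N \<subseteq> K"
  using assms by (auto elim!: set_multE simp: subgroup.m_closed subsetD)

lemma subset_setmult_left: "M \<subseteq> carrier G \<Longrightarrow> subgroup N G \<Longrightarrow> M \<subseteq> M <#> N"
  using set_multI[of _ M "\<one>" N G] by (fastforce simp: subgroup.one_closed subsetD)

lemma subset_setmult_right: "N \<subseteq> carrier G \<Longrightarrow> subgroup M G \<Longrightarrow> N \<subseteq> M <#> N"
  using set_multI[of "\<one>" M _ N G] by (fastforce simp: subgroup.one_closed subsetD)

lemma conj_hom: "g \<in> carrier G \<Longrightarrow> group_hom G G (\<lambda>u. g \<otimes> u \<otimes> inv g)"
  by (auto intro!: group_hom.intro group_hom_axioms.intro homI conj_mult)

text \<open>The subgroups below are defined by generators, and conjugation permutes these generators.\<close>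

lemma power_subgroup_normal:
  assumes "M \<lhd> G"
  shows "power_subgroup G M n \<lhd> G"
  unfolding power_subgroup_def
proof (rule normal_generateI)
  interpret M: normal M G by fact
  show "(\<lambda>z. z [^] n) ` M \<subseteq> carrier G"
    by auto
  fix h g assume "h \<in> (\<lambda>z. z [^] n) ` M" and g: "g \<in> carrier G"
  then obtain z where z: "h = z [^] n" "z \<in> M"
    by auto
  interpret c: group_hom G G "\<lambda>u. g \<otimes> u \<otimes> inv g"
    by (rule conj_hom[OF g])
  have "g \<otimes> h \<otimes> inv g = (g \<otimes> z \<otimes> inv g) [^] n"
    using z c.hom_nat_pow by simp
  then show "g \<otimes> h \<otimes> inv g \<in> (\<lambda>z. z [^] n) ` M"
    using M.inv_op_closed2 z g by auto
qed

lemma comm_subgroup_normal: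
  assumes "M \<lhd> G" "N \<lhd> G"
  shows "comm_subgroup G M N \<lhd> G"
  unfolding comm_subgroup_def
proof (rule normal_generateI)
  interpret M: normal M G by fact
  interpret N: normal N G by fact
  show "{inv u \<otimes> inv v \<otimes> u \<otimes> v |u v. u \<in> M \<and> v \<in> N} \<subseteq> carrier G"
    by auto
  fix h g assume "h \<in> {inv u \<otimes> inv v \<otimes> u \<otimes> v |u v. u \<in> M \<and> v \<in> N}" and g: "g \<in> carrier G"
  then obtain u v where z: "h = inv u \<otimes> inv v \<otimes> u \<otimes> v" "u \<in> M" "v \<in> N"
    by auto
  interpret c: group_hom G G "\<lambda>u. g \<otimes> u \<otimes> inv g"
    by (rule conj_hom[OF g])
  define c where "c = (\<lambda>u. g \<otimes> u \<otimes> inv g)"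
  have "c h = inv (c u) \<otimes> inv (c v) \<otimes> c u \<otimes> c v"
    using z unfolding c_def
    by (simp only: M.mem_carrier N.mem_carrier c.hom_mult c.hom_inv m_closed inv_closed)
  moreover have "c u \<in> M" "c v \<in> N"
    using M.inv_op_closed2 N.inv_op_closed2 z g by (auto simp: c_def)
  ultimately show "g \<otimes> h \<otimes> inv g \<in> {inv u \<otimes> inv v \<otimes> u \<otimes> v |u v. u \<in> M \<and> v \<in> N}"
    unfolding c_def by blast
qed

lemma commutator_in_comm_subgroup:
  "u \<in> M \<Longrightarrow> v \<in> N \<Longrightarrow> commutator G u v \<in> comm_subgroup G M N"
  unfolding commutator_def comm_subgroup_def by (intro generate.incl) blast

lemma pow_in_power_subgroup: "u \<in> M \<Longrightarrow> u [^] n \<in> power_subgroup G M n"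
  unfolding power_subgroup_def by (intro generate.incl) blast

lemma comm_subgroup_least:
  assumes "subgroup K G" "\<And>u v. u \<in> M \<Longrightarrow> v \<in> N \<Longrightarrow> commutator G u v \<in> K"
  shows "comm_subgroup G M N \<subseteq> K"
  using assms unfolding comm_subgroup_def commutator_def
  by (intro generate_subgroup_incl) auto

lemma power_subgroup_least:
  assumes "subgroup K G" "\<And>u. u \<in> M \<Longrightarrow> u [^] n \<in> K"
  shows "power_subgroup G M n \<subseteq> K"
  using assms unfolding power_subgroup_def by (intro generate_subgroup_incl) auto

lemma inv_commute:
  assumes "a \<in> carrier G" "v \<in> carrier G" "a \<otimes> v = v \<otimes> a"
  shows "inv a \<otimes> v = v \<otimes> inv a"
proof -
  have "inv a \<otimes> (v \<otimes> a) \<otimes> inv a = inv a \<otimes> (a \<otimes> v) \<otimes> inv a"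
    using assms by simp
  then show ?thesis
    using assms(1,2) by (simp add: m_assoc inv_mult_cancel)
qed

lemma mult_commute:
  assumes "a \<in> carrier G" "b \<in> carrier G" "v \<in> carrier G" "a \<otimes> v = v \<otimes> a" "b \<otimes> v = v \<otimes> b"
  shows "a \<otimes> b \<otimes> v = v \<otimes> (a \<otimes> b)"
  using assms m_assoc by metis

lemma pow_subgroup_mem:
  assumes "subgroup K G" "u \<in> K"
  shows "u [^] (n::nat) \<in> K"
proof (induction n)
  case (Suc n)
  then show ?case
    using assms by (simp add: subgroup.m_closed)
qed (use assms in \<open>simp add: subgroup.one_closed\<close>)

lemma normal_conj:
  assumes "N \<lhd> G" "u \<in> N" "g \<in> carrier G"
  shows "inv g \<otimes> u \<otimes> g \<in> N"
  using normal.inv_op_closed1[OF assms(1) assms(3,2)] .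

lemma normal_commutator_left:
  assumes N: "N \<lhd> G" and u: "u \<in> N" and g: "g \<in> carrier G"
  shows "commutator G u g \<in> N"
proof -
  have "u \<in> carrier G"
    using normal_imp_subgroup[OF N] u by (rule subgroup.mem_carrier)
  then have "commutator G u g = inv u \<otimes> (inv g \<otimes> u \<otimes> g)"
    using g by (simp add: commutator_def m_assoc)
  then show ?thesis
    using normal_conj[OF N u g] normal_imp_subgroup[OF N] u
    by (simp add: subgroup.m_closed subgroup.m_inv_closed)
qed

lemma conj_eq_mult_commutator:
  "h \<in> carrier G \<Longrightarrow> a \<in> carrier G \<Longrightarrow> inv a \<otimes> h \<otimes> a = h \<otimes> commutator G h a"
  by (simp add: commutator_def m_assoc inv_mult_cancel)

lemma subgroup_preserving_conj:
  assumes N: "subgroup N G" and conj: "\<And>h g. h \<in> N \<Longrightarrow> g \<in> carrier G \<Longrightarrow> conjugate G h g \<in> N"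
  shows "N \<lhd> G"
  unfolding normal_inv_iff
proof (intro conjI ballI N)
  fix g h assume "g \<in> carrier G" "h \<in> N"
  then show "g \<otimes> h \<otimes> inv g \<in> N"
    using conj[of h "inv g"] by (simp add: conjugate_def)
qed

end

context group_hom
begin

lemma hom_commutator:
  "u \<in> carrier G \<Longrightarrow> v \<in> carrier G \<Longrightarrow> h (commutator G u v) = commutator H (h u) (h v)"
  by (simp add: commutator_def)

lemma hom_mult_eq_mult_commutator:
  assumes "u \<in> carrier G" "v \<in> carrier G"
  shows "h u \<otimes>\<^bsub>H\<^esub> h v = h v \<otimes>\<^bsub>H\<^esub> h u \<otimes>\<^bsub>H\<^esub> h (commutator G u v)"
  using assms H.mult_eq_mult_commutator[of "h u" "h v"] by (simp add: hom_commutator)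

lemma hom_commute_iff:
  assumes "u \<in> carrier G" "v \<in> carrier G"
  shows "h u \<otimes>\<^bsub>H\<^esub> h v = h v \<otimes>\<^bsub>H\<^esub> h u \<longleftrightarrow> h (commutator G u v) = \<one>\<^bsub>H\<^esub>"
  using assms by (simp add: hom_commutator H.commutator_eq_one_iff)

end

section \<open>The lower p-central series of a normal subgroup\<close>

declare lower_p_central.simps(3) [simp del]

locale p_central_series = group G for G :: "('a, 'b) monoid_scheme" (structure) +
  fixes p :: nat and A :: "'a set"
  assumes A_normal: "A \<lhd> G" and p_prime: "Factorial_Ring.prime p" and p_ge_5: "p \<ge> 5"
begin

abbreviation P :: "nat \<Rightarrow> 'a set" where
  "P \<equiv> lower_p_central G p A"

abbreviation D :: "'a set" where
  "D \<equiv> comm_subgroup G A A"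

text \<open>In the indexing of \<open>U_sub\<close> this is the subgroup with index \<open>m + 2\<close>; the shift avoids truncated subtraction, and \<open>p\<^sup>m\<close> is the power
  whose additivity modulo \<open>U m\<close> matters.\<close>

definition U :: "nat \<Rightarrow> 'a set" where
  "U m = power_subgroup G A (p ^ (m + 1)) <#> power_subgroup G D (p ^ m) <#> P (m + 3)"

lemma P_Suc: "k \<ge> 1 \<Longrightarrow> P (Suc k) = comm_subgroup G (P k) A <#> power_subgroup G (P k) p"
  by (cases k) (auto simp: lower_p_central.simps)

lemma P_normal: "P k \<lhd> G"
proof (induction k)
  case (Suc k)
  show ?case
  proof (cases "k = 0")
    case False
    then show ?thesis
      using Suc A_normal by (simp add: P_Suc normal_setmult comm_subgroup_normal power_subgroup_normal)
  qed (use A_normal in simp)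
qed (use A_normal in simp)

lemma D_normal: "D \<lhd> G"
  by (simp add: A_normal comm_subgroup_normal)

lemma U_normal: "U m \<lhd> G"
  unfolding U_def by (intro normal_setmult power_subgroup_normal A_normal D_normal P_normal)

lemma P_subgroup: "subgroup (P k) G" and A_subgroup: "subgroup A G" and D_subgroup: "subgroup D G"
  and U_subgroup: "subgroup (U m) G"
  using P_normal A_normal D_normal U_normal by (simp_all add: normal_imp_subgroup)

lemma A_closed [simp]: "u \<in> A \<Longrightarrow> u \<in> carrier G"
  and P_closed [simp]: "u \<in> P k \<Longrightarrow> u \<in> carrier G"
  and D_closed [simp]: "u \<in> D \<Longrightarrow> u \<in> carrier G"
  and U_closed [simp]: "u \<in> U m \<Longrightarrow> u \<in> carrier G"
  by (rule subgroup.mem_carrier, (rule P_subgroup A_subgroup D_subgroup U_subgroup), assumption)+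

lemma P_Suc_subset: "k \<ge> 1 \<Longrightarrow> P (Suc k) \<subseteq> P k"
  unfolding P_Suc by (intro setmult_least comm_subgroup_least power_subgroup_least P_subgroup)
    (auto intro: normal_commutator_left[OF P_normal] pow_subgroup_mem[OF P_subgroup])

lemma P_antimono:
  assumes "1 \<le> k" "k \<le> l"
  shows "P l \<subseteq> P k"
  using assms(2)
proof (induction rule: dec_induct)
  case (step i)
  then show ?case
    using P_Suc_subset[of i] assms(1) by auto
qed simp

lemma P_subset_A: "P k \<subseteq> A"
  using P_antimono[of 1 k] by (cases k) auto

lemma commutator_in_P: "k \<ge> 1 \<Longrightarrow> u \<in> P k \<Longrightarrow> v \<in> A \<Longrightarrow> commutator G u v \<in> P (Suc k)"
  unfolding P_Suc using subset_setmult_left[of "comm_subgroup G (P k) A" "power_subgroup G (P k) p"]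
  by (meson P_normal A_normal comm_subgroup_normal power_subgroup_normal normal_imp_subgroup
      subgroup.subset subsetD commutator_in_comm_subgroup)

lemma pow_in_P: "k \<ge> 1 \<Longrightarrow> u \<in> P k \<Longrightarrow> u [^] p \<in> P (Suc k)"
  unfolding P_Suc using subset_setmult_right[of "power_subgroup G (P k) p" "comm_subgroup G (P k) A"]
  by (meson P_normal A_normal comm_subgroup_normal power_subgroup_normal normal_imp_subgroup
      subgroup.subset subsetD pow_in_power_subgroup)

lemma pow_pow_in_P:
  assumes "k \<ge> 1" "u \<in> P k"
  shows "u [^] (p ^ n) \<in> P (k + n)"
proof (induction n)
  case (Suc n)
  have "u [^] (p ^ Suc n) = (u [^] (p ^ n)) [^] p"
    using assms by (simp add: nat_pow_pow mult.commute)
  then show ?case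
    using pow_in_P[OF _ Suc] assms by simp
qed (use assms in simp)

lemma A_pow_in_P: "h \<in> A \<Longrightarrow> h [^] (p ^ m) \<in> P (m + 1)"
  using pow_pow_in_P[of 1 h m] by (simp add: add.commute)

lemma D_subset_P_2: "D \<subseteq> P 2"
proof -
  have "comm_subgroup G (P 1) A \<subseteq> P 2"
    by (intro comm_subgroup_least P_subgroup) (use commutator_in_P[of 1] in \<open>simp add: numeral_2_eq_2\<close>)
  then show ?thesis
    by simp
qed

text \<open>Modulo \<open>P (k + 2)\<close>, the commutator of \<open>u \<in> P k\<close> with an element of \<open>A\<close> is central
  and has order dividing \<open>p\<close>; so \<open>u\<close> commutes with commutators and with \<open>p\<close>-th powers in \<open>A\<close>.\<close>

lemma commutator_P_P_2:
  assumes k: "k \<ge> 1" and u: "u \<in> P k" and v: "v \<in> P 2"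
  shows "commutator G u v \<in> P (k + 2)"
proof -
  define N where "N = P (k + 2)"
  interpret N: normal N G
    unfolding N_def by (rule P_normal)
  let ?Q = "G Mod N"
  define f where "f = (#>) N"
  interpret f: group_hom G ?Q f
    unfolding f_def by (rule N.quotient_hom)
  have one: "f a = \<one>\<^bsub>?Q\<^esub>" if "a \<in> N" for a
    using that unfolding f_def by (subst N.coset_eq_one_iff) auto
  note uc = P_closed[OF u]
  have c: "f (commutator G u b) \<otimes>\<^bsub>?Q\<^esub> f g = f g \<otimes>\<^bsub>?Q\<^esub> f (commutator G u b)"
    if "b \<in> A" "g \<in> A" for b g
  proof -
    have "commutator G (commutator G u b) g \<in> N"
      unfolding N_def using commutator_in_P[OF _ commutator_in_P[OF k u that(1)] that(2)] by simp
    then show ?thesis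
      using that uc by (subst f.hom_commute_iff) (simp_all add: one)
  qed
  have ub: "f u \<otimes>\<^bsub>?Q\<^esub> f b = f b \<otimes>\<^bsub>?Q\<^esub> f u \<otimes>\<^bsub>?Q\<^esub> f (commutator G u b)" if "b \<in> A" for b
    using f.hom_mult_eq_mult_commutator[OF uc] that by simp
  have uA: "u \<in> A"
    using P_subset_A u by auto
  define K where "K = {v \<in> A. f v \<otimes>\<^bsub>?Q\<^esub> f u = f u \<otimes>\<^bsub>?Q\<^esub> f v}"
  have K: "subgroup K G"
  proof (rule subgroupI)
    show "K \<subseteq> carrier G"
      by (auto simp: K_def)
    have "\<one> \<in> K"
      using uc by (simp add: K_def subgroup.one_closed[OF A_subgroup])
    then show "K \<noteq> {}"
      by blast
    show "inv a \<in> K" if "a \<in> K" for a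
      using that uc f.H.inv_commute[of "f a" "f u"]
      by (simp add: K_def subgroup.m_inv_closed[OF A_subgroup])
    show "a \<otimes> b \<in> K" if "a \<in> K" "b \<in> K" for a b
      using that uc f.H.mult_commute[of "f a" "f b" "f u"]
      by (simp add: K_def subgroup.m_closed[OF A_subgroup])
  qed
  have comm: "commutator G a b \<in> K" if ab: "a \<in> A" "b \<in> A" for a b
  proof -
    define w where "w = commutator G a b"
    define c d where "c = f (commutator G u a)" and "d = f (commutator G u b)"
    have wA: "w \<in> A"
      unfolding w_def by (rule normal_commutator_left[OF A_normal]) (use ab in auto)
    have cl: "f a \<in> carrier ?Q" "f b \<in> carrier ?Q" "f w \<in> carrier ?Q" "c \<in> carrier ?Q" "d \<in> carrier ?Q"
      "f u \<in> carrier ?Q"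
      using ab wA uc unfolding c_def d_def by auto
    have comms: "c \<otimes>\<^bsub>?Q\<^esub> f b = f b \<otimes>\<^bsub>?Q\<^esub> c" "d \<otimes>\<^bsub>?Q\<^esub> f a = f a \<otimes>\<^bsub>?Q\<^esub> d" "c \<otimes>\<^bsub>?Q\<^esub> f w = f w \<otimes>\<^bsub>?Q\<^esub> c"
      "d \<otimes>\<^bsub>?Q\<^esub> f w = f w \<otimes>\<^bsub>?Q\<^esub> d"
      unfolding c_def d_def using c ab wA by auto
    have "c \<otimes>\<^bsub>?Q\<^esub> d = d \<otimes>\<^bsub>?Q\<^esub> c"
      unfolding d_def c_def using c[of a "commutator G u b"] ab uA
      by (simp add: normal_commutator_left[OF A_normal])
    note comms = comms this
    note ua = ub[OF ab(1), folded c_def] and ub = ub[OF ab(2), folded d_def]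
    have ab': "f a \<otimes>\<^bsub>?Q\<^esub> f b = f b \<otimes>\<^bsub>?Q\<^esub> f a \<otimes>\<^bsub>?Q\<^esub> f w"
      unfolding w_def by (rule f.hom_mult_eq_mult_commutator) (use ab in auto)
    have "f b \<otimes>\<^bsub>?Q\<^esub> f a \<otimes>\<^bsub>?Q\<^esub> (f w \<otimes>\<^bsub>?Q\<^esub> f u \<otimes>\<^bsub>?Q\<^esub> (c \<otimes>\<^bsub>?Q\<^esub> d))
      = f a \<otimes>\<^bsub>?Q\<^esub> f b \<otimes>\<^bsub>?Q\<^esub> f u \<otimes>\<^bsub>?Q\<^esub> (d \<otimes>\<^bsub>?Q\<^esub> c)"
      using cl by (simp add: f.H.m_assoc ab' comms(5))
    also have "\<dots> = f a \<otimes>\<^bsub>?Q\<^esub> (f u \<otimes>\<^bsub>?Q\<^esub> f b) \<otimes>\<^bsub>?Q\<^esub> c"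
      using cl by (simp add: f.H.m_assoc ub)
    also have "\<dots> = (f a \<otimes>\<^bsub>?Q\<^esub> f u \<otimes>\<^bsub>?Q\<^esub> c) \<otimes>\<^bsub>?Q\<^esub> f b"
      using cl by (simp add: f.H.m_assoc comms)
    also have "\<dots> = f u \<otimes>\<^bsub>?Q\<^esub> (f a \<otimes>\<^bsub>?Q\<^esub> f b)"
      using cl by (simp add: f.H.m_assoc flip: ua)
    also have "\<dots> = (f u \<otimes>\<^bsub>?Q\<^esub> f b) \<otimes>\<^bsub>?Q\<^esub> f a \<otimes>\<^bsub>?Q\<^esub> f w"
      using cl by (simp add: f.H.m_assoc ab')
    also have "\<dots> = f b \<otimes>\<^bsub>?Q\<^esub> f u \<otimes>\<^bsub>?Q\<^esub> (d \<otimes>\<^bsub>?Q\<^esub> f a) \<otimes>\<^bsub>?Q\<^esub> f w"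
      using cl by (simp add: f.H.m_assoc ub)
    also have "\<dots> = f b \<otimes>\<^bsub>?Q\<^esub> (f u \<otimes>\<^bsub>?Q\<^esub> f a) \<otimes>\<^bsub>?Q\<^esub> (d \<otimes>\<^bsub>?Q\<^esub> f w)"
      using cl by (simp add: f.H.m_assoc comms(2))
    also have "\<dots> = f b \<otimes>\<^bsub>?Q\<^esub> f a \<otimes>\<^bsub>?Q\<^esub> f u \<otimes>\<^bsub>?Q\<^esub> (c \<otimes>\<^bsub>?Q\<^esub> f w) \<otimes>\<^bsub>?Q\<^esub> d"
      unfolding comms(4) using cl by (simp add: f.H.m_assoc ua)
    also have "\<dots> = f b \<otimes>\<^bsub>?Q\<^esub> f a \<otimes>\<^bsub>?Q\<^esub> (f u \<otimes>\<^bsub>?Q\<^esub> f w \<otimes>\<^bsub>?Q\<^esub> (c \<otimes>\<^bsub>?Q\<^esub> d))"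
      unfolding comms(3) using cl by (simp add: f.H.m_assoc)
    finally have "f w \<otimes>\<^bsub>?Q\<^esub> f u = f u \<otimes>\<^bsub>?Q\<^esub> f w"
      using cl by simp
    then show ?thesis
      using wA by (simp add: K_def w_def)
  qed
  have pow: "b [^] p \<in> K" if b: "b \<in> A" for b
  proof -
    have "f b [^]\<^bsub>?Q\<^esub> p \<otimes>\<^bsub>?Q\<^esub> f u = f u \<otimes>\<^bsub>?Q\<^esub> f b [^]\<^bsub>?Q\<^esub> p \<otimes>\<^bsub>?Q\<^esub> f (commutator G b u) [^]\<^bsub>?Q\<^esub> p"
    proof (rule f.H.pow_swap)
      show "f b \<otimes>\<^bsub>?Q\<^esub> f u = f u \<otimes>\<^bsub>?Q\<^esub> f b \<otimes>\<^bsub>?Q\<^esub> f (commutator G b u)"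
        by (rule f.hom_mult_eq_mult_commutator) (use b uc in auto)
      have "commutator G b u = inv (commutator G u b)"
        using b uc by (simp add: commutator_def m_assoc inv_mult_group)
      then show "f (commutator G b u) \<otimes>\<^bsub>?Q\<^esub> f b = f b \<otimes>\<^bsub>?Q\<^esub> f (commutator G b u)"
        using c[OF b b] f.H.inv_commute b uc by simp
    qed (use b uc in auto)
    moreover have "f (commutator G b u) [^]\<^bsub>?Q\<^esub> p = \<one>\<^bsub>?Q\<^esub>"
    proof -
      have "commutator G b u = inv (commutator G u b)"
        using b uc by (simp add: commutator_def m_assoc inv_mult_group)
      then have "commutator G b u \<in> P (k + 1)"
        using commutator_in_P[OF k u b] by (simp add: subgroup.m_inv_closed[OF P_subgroup])
      then have "f (commutator G b u [^] p) = \<one>\<^bsub>?Q\<^esub>"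
        using pow_in_P[of "k + 1"] by (intro one) (simp add: N_def)
      then show ?thesis
        using b uc by (simp add: f.hom_nat_pow)
    qed
    ultimately have "f b [^]\<^bsub>?Q\<^esub> p \<otimes>\<^bsub>?Q\<^esub> f u = f u \<otimes>\<^bsub>?Q\<^esub> f b [^]\<^bsub>?Q\<^esub> p"
      using b uc by simp
    then show ?thesis
      using b by (simp add: K_def f.hom_nat_pow pow_subgroup_mem[OF A_subgroup])
  qed
  have "P 2 \<subseteq> K"
  proof -
    have "comm_subgroup G A A <#> power_subgroup G A p \<subseteq> K"
      by (intro setmult_least comm_subgroup_least power_subgroup_least K comm pow)
    then show ?thesis
      using P_Suc[of 1] by (simp add: numeral_2_eq_2)
  qed
  then have "f u \<otimes>\<^bsub>?Q\<^esub> f v = f v \<otimes>\<^bsub>?Q\<^esub> f u"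
    using v by (auto simp: K_def)
  then have "f (commutator G u v) = \<one>\<^bsub>?Q\<^esub>"
    using v uc by (subst (asm) f.hom_commute_iff) auto
  then show ?thesis
    unfolding f_def using v uc by (subst (asm) N.coset_eq_one_iff) (auto simp: N_def)
qed

lemma A_pow_in_U: "h \<in> A \<Longrightarrow> h [^] (p ^ (m + 1)) \<in> U m"
  and D_pow_in_U: "h \<in> D \<Longrightarrow> h [^] (p ^ m) \<in> U m"
  and P_subset_U: "P (m + 3) \<subseteq> U m"
proof -
  let ?X = "power_subgroup G A (p ^ (m + 1))" and ?Y = "power_subgroup G D (p ^ m)"
  have X: "subgroup ?X G" and Y: "subgroup ?Y G"
    by (intro normal_imp_subgroup power_subgroup_normal A_normal D_normal)+
  have XY: "subgroup (?X <#> ?Y) G"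
    by (intro normal_imp_subgroup normal_setmult power_subgroup_normal A_normal D_normal)
  have *: "?X <#> ?Y \<subseteq> U m" "P (m + 3) \<subseteq> U m"
    unfolding U_def
    by (intro subset_setmult_left subset_setmult_right subgroup.subset[OF XY] P_subgroup XY
        subgroup.subset[OF P_subgroup])+
  moreover have "?X \<subseteq> ?X <#> ?Y" "?Y \<subseteq> ?X <#> ?Y"
    by (intro subset_setmult_left subset_setmult_right subgroup.subset[OF X] subgroup.subset[OF Y] X Y)+
  ultimately show "h \<in> A \<Longrightarrow> h [^] (p ^ (m + 1)) \<in> U m" "h \<in> D \<Longrightarrow> h [^] (p ^ m) \<in> U m"
    "P (m + 3) \<subseteq> U m"
    using pow_in_power_subgroup[of h A "p ^ (m + 1)"] pow_in_power_subgroup[of h D "p ^ m"] by blast+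
qed

lemma U_least:
  assumes "subgroup K G" "\<And>h. h \<in> A \<Longrightarrow> h [^] (p ^ (m + 1)) \<in> K" "\<And>h. h \<in> D \<Longrightarrow> h [^] (p ^ m) \<in> K"
    "P (m + 3) \<subseteq> K"
  shows "U m \<subseteq> K"
  unfolding U_def using assms by (intro setmult_least power_subgroup_least) auto

lemma U_subset_P: "U m \<subseteq> P (m + 2)"
proof (rule U_least[OF P_subgroup])
  show "h [^] (p ^ (m + 1)) \<in> P (m + 2)" if "h \<in> A" for h
    using A_pow_in_P[OF that, of "m + 1"] by simp
  show "h [^] (p ^ m) \<in> P (m + 2)" if "h \<in> D" for h
    using pow_pow_in_P[of 2 h m] D_subset_P_2 that by (auto simp: add.commute)
  show "P (m + 3) \<subseteq> P (m + 2)"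
    by (rule P_antimono) auto
qed

text \<open>Modulo \<open>P (k + 3)\<close> the commutator of two elements of \<open>P k\<close>, which lies in \<open>P (k + 2)\<close>, is central and has
  order dividing \<open>p\<close>, so the collection formula has no further terms.\<close>

lemma hom_pow_p_mult:
  assumes "group_hom G Q f" and ker: "\<And>a. a \<in> P (k + 3) \<Longrightarrow> f a = \<one>\<^bsub>Q\<^esub>"
    and k: "k \<ge> 2" and u: "u \<in> P k" and v: "v \<in> P k"
  shows "f (u \<otimes> v) [^]\<^bsub>Q\<^esub> p = f u [^]\<^bsub>Q\<^esub> p \<otimes>\<^bsub>Q\<^esub> f v [^]\<^bsub>Q\<^esub> p"
proof -
  interpret f: group_hom G Q f by fact
  define c where "c = commutator G v u"
  have c: "c \<in> P (k + 2)"
    unfolding c_def using commutator_P_P_2[of k v u] P_antimono[of 2 k] u v k by auto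
  have uv: "u \<in> A" "v \<in> A"
    using P_subset_A u v by auto
  have cz: "f c \<otimes>\<^bsub>Q\<^esub> f g = f g \<otimes>\<^bsub>Q\<^esub> f c" if "g \<in> A" for g
  proof -
    have "commutator G c g \<in> P (k + 3)"
      using commutator_in_P[OF _ c that] by (simp add: numeral_3_eq_3)
    then show ?thesis
      using that c by (subst f.hom_commute_iff) (simp_all add: ker)
  qed
  have "f (c [^] p) = \<one>\<^bsub>Q\<^esub>"
    using pow_in_P[OF _ c] by (intro ker) (simp add: numeral_3_eq_3)
  then have cp: "f c [^]\<^bsub>Q\<^esub> p = \<one>\<^bsub>Q\<^esub>"
    using c by (simp add: f.hom_nat_pow)
  have vu: "f v \<otimes>\<^bsub>Q\<^esub> f u = f u \<otimes>\<^bsub>Q\<^esub> f v \<otimes>\<^bsub>Q\<^esub> f c"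
    unfolding c_def by (rule f.hom_mult_eq_mult_commutator) (use u v in auto)
  have "(f u \<otimes>\<^bsub>Q\<^esub> f v) [^]\<^bsub>Q\<^esub> p = f u [^]\<^bsub>Q\<^esub> p \<otimes>\<^bsub>Q\<^esub> f v [^]\<^bsub>Q\<^esub> p"
    by (rule f.H.pow_prime_mult_class_3[OF p_prime p_ge_5, of _ _ "f c" "\<one>\<^bsub>Q\<^esub>" "\<one>\<^bsub>Q\<^esub>"])
      (use u v c cz[OF uv(1)] cz[OF uv(2)] cp vu in simp_all)
  then show ?thesis
    using u v by simp
qed

text \<open>By the additivity of \<open>p\<close>-th powers on \<open>P (m + 2)\<close>, it suffices to look at the generators of \<open>U m\<close>.\<close>

lemma hom_pow_p_U:
  assumes "group_hom G Q f" and ker: "\<And>a. a \<in> U (Suc m) \<Longrightarrow> f a = \<one>\<^bsub>Q\<^esub>" and z: "z \<in> U m"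
  shows "f z [^]\<^bsub>Q\<^esub> p = \<one>\<^bsub>Q\<^esub>"
proof -
  interpret f: group_hom G Q f by fact
  define K where "K = {z \<in> P (m + 2). f z [^]\<^bsub>Q\<^esub> p = \<one>\<^bsub>Q\<^esub>}"
  have kerP: "f a = \<one>\<^bsub>Q\<^esub>" if "a \<in> P (m + 4)" for a
    using that P_subset_U[of "Suc m"] by (intro ker) (auto simp: numeral_eq_Suc)
  have K: "subgroup K G"
  proof (rule subgroupI)
    show "K \<subseteq> carrier G"
      by (auto simp: K_def)
    have "\<one> \<in> K"
      by (simp add: K_def subgroup.one_closed[OF P_subgroup])
    then show "K \<noteq> {}"
      by blast
    show "inv a \<in> K" if "a \<in> K" for a
    proof -
      have a: "a \<in> P (m + 2)" "f a [^]\<^bsub>Q\<^esub> p = \<one>\<^bsub>Q\<^esub>"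
        using that by (auto simp: K_def)
      then have "f (inv a) [^]\<^bsub>Q\<^esub> p = \<one>\<^bsub>Q\<^esub>"
        using f.H.nat_pow_inv[of "f a" p] by simp
      then show ?thesis
        using a(1) by (simp add: K_def subgroup.m_inv_closed[OF P_subgroup])
    qed
    show "a \<otimes> b \<in> K" if "a \<in> K" "b \<in> K" for a b
    proof -
      have "f (a \<otimes> b) [^]\<^bsub>Q\<^esub> p = f a [^]\<^bsub>Q\<^esub> p \<otimes>\<^bsub>Q\<^esub> f b [^]\<^bsub>Q\<^esub> p"
      proof (rule hom_pow_p_mult[OF assms(1), of "m + 2"])
        show "f a = \<one>\<^bsub>Q\<^esub>" if "a \<in> P (m + 2 + 3)" for a
          using that P_antimono[of "m + 4" "m + 2 + 3"] by (intro kerP) auto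
      qed (use that in \<open>auto simp: K_def\<close>)
      then show ?thesis
        using that by (simp add: K_def subgroup.m_closed[OF P_subgroup])
    qed
  qed
  have pK: "a \<in> K" if "a \<in> P (m + 2)" "a [^] p \<in> U (Suc m)" for a
    using that ker[OF that(2)] by (simp add: K_def f.hom_nat_pow)
  have "U m \<subseteq> K"
  proof (rule U_least[OF K])
    fix h assume h: "h \<in> A"
    show "h [^] (p ^ (m + 1)) \<in> K"
      using A_pow_in_P[OF h, of "m + 1"] A_pow_in_U[OF h, of "Suc m"] h
      by (intro pK) (simp_all add: nat_pow_pow mult.commute)
  next
    fix h assume h: "h \<in> D"
    show "h [^] (p ^ m) \<in> K"
      using pow_pow_in_P[of 2 h m] D_subset_P_2 D_pow_in_U[OF h, of "Suc m"] h
      by (intro pK) (auto simp: nat_pow_pow mult.commute add.commute)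
  next
    show "P (m + 3) \<subseteq> K"
    proof
      fix h assume h: "h \<in> P (m + 3)"
      have "h [^] p \<in> P (Suc m + 3)"
        using pow_in_P[OF _ h] by simp
      then have "h [^] p \<in> U (Suc m)"
        using P_subset_U[of "Suc m"] by blast
      then show "h \<in> K"
        using h P_antimono[of "m + 2" "m + 3"] by (intro pK) auto
    qed
  qed
  then show ?thesis
    using z by (auto simp: K_def)
qed

text \<open>The only step in which the full class three formula occurs: \<open>P 4\<close> is killed, so \<open>d\<close> and \<open>e\<close> are
  central, and \<open>p\<close>-th powers of elements of \<open>D\<close> are killed.\<close>

lemma hom_pow_p_mult_U_1:
  assumes "group_hom G Q f" and ker: "\<And>a. a \<in> U 1 \<Longrightarrow> f a = \<one>\<^bsub>Q\<^esub>" and h: "h \<in> A" and k: "k \<in> A"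
  shows "f (h \<otimes> k) [^]\<^bsub>Q\<^esub> p = f h [^]\<^bsub>Q\<^esub> p \<otimes>\<^bsub>Q\<^esub> f k [^]\<^bsub>Q\<^esub> p"
proof -
  interpret f: group_hom G Q f by fact
  define c where "c = commutator G k h"
  define d where "d = commutator G c h"
  define e where "e = commutator G c k"
  have D: "c \<in> D" "d \<in> D" "e \<in> D"
    using h k commutator_in_comm_subgroup[of k A h A] normal_commutator_left[OF D_normal]
    by (auto simp: c_def d_def e_def)
  have c2: "c \<in> P 2"
    using D D_subset_P_2 by auto
  then have P3: "d \<in> P 3" "e \<in> P 3"
    unfolding d_def e_def using commutator_in_P[of 2 c] h k by (auto simp: numeral_eq_Suc)
  have kerP: "f a = \<one>\<^bsub>Q\<^esub>" if "a \<in> P 4" for a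
    using that P_subset_U[of 1] by (intro ker) (auto simp: numeral_eq_Suc)
  have kerD: "f a [^]\<^bsub>Q\<^esub> p = \<one>\<^bsub>Q\<^esub>" if "a \<in> D" for a
    using ker[OF D_pow_in_U[OF that, of 1]] that by (simp add: f.hom_nat_pow)
  have z: "f d \<otimes>\<^bsub>Q\<^esub> f g = f g \<otimes>\<^bsub>Q\<^esub> f d" "f e \<otimes>\<^bsub>Q\<^esub> f g = f g \<otimes>\<^bsub>Q\<^esub> f e" if "g \<in> A" for g
  proof -
    have "commutator G d g \<in> P 4" "commutator G e g \<in> P 4"
      using commutator_in_P[OF _ P3(1) that] commutator_in_P[OF _ P3(2) that] by (auto simp: numeral_eq_Suc)
    then show "f d \<otimes>\<^bsub>Q\<^esub> f g = f g \<otimes>\<^bsub>Q\<^esub> f d" "f e \<otimes>\<^bsub>Q\<^esub> f g = f g \<otimes>\<^bsub>Q\<^esub> f e"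
      using that P3 by (auto simp: f.hom_commute_iff kerP)
  qed
  have A: "c \<in> A" "e \<in> A"
    using c2 P3 P_subset_A by auto
  have "(f h \<otimes>\<^bsub>Q\<^esub> f k) [^]\<^bsub>Q\<^esub> p = f h [^]\<^bsub>Q\<^esub> p \<otimes>\<^bsub>Q\<^esub> f k [^]\<^bsub>Q\<^esub> p"
  proof (rule f.H.pow_prime_mult_class_3[OF p_prime p_ge_5, of _ _ "f c" "f d" "f e"])
    show "f k \<otimes>\<^bsub>Q\<^esub> f h = f h \<otimes>\<^bsub>Q\<^esub> f k \<otimes>\<^bsub>Q\<^esub> f c"
      unfolding c_def by (rule f.hom_mult_eq_mult_commutator) (use h k in auto)
    show "f c \<otimes>\<^bsub>Q\<^esub> f h = f h \<otimes>\<^bsub>Q\<^esub> f c \<otimes>\<^bsub>Q\<^esub> f d"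
      unfolding d_def by (rule f.hom_mult_eq_mult_commutator) (use h A in auto)
    show "f c \<otimes>\<^bsub>Q\<^esub> f k = f k \<otimes>\<^bsub>Q\<^esub> f c \<otimes>\<^bsub>Q\<^esub> f e"
      unfolding e_def by (rule f.hom_mult_eq_mult_commutator) (use k A in auto)
  qed (use h k D A in \<open>auto intro!: z kerD\<close>)
  then show ?thesis
    using h k by simp
qed

text \<open>Induction on \<open>m\<close>: the error term \<open>z \<in> U m\<close> at level \<open>m\<close> and the powers lie in \<open>P (m + 1)\<close>. For
  \<open>m \<ge> 1\<close> taking \<open>p\<close>-th powers is additive there, and \<open>z\<^sup>p \<in> U (m + 1)\<close>. The step from \<open>0\<close> to \<open>1\<close> is
  \<open>hom_pow_p_mult_U_1\<close>.\<close>

lemma pow_p_pow_mult: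
  assumes "h \<in> A" "k \<in> A"
  shows "U m #> ((h \<otimes> k) [^] (p ^ m)) = U m #> (h [^] (p ^ m) \<otimes> k [^] (p ^ m))"
proof (induction m)
  case 0
  then show ?case
    using assms by simp
next
  case (Suc m)
  interpret N: normal "U (Suc m)" G
    by (rule U_normal)
  define f where "f = (#>) (U (Suc m))"
  let ?Q = "G Mod U (Suc m)"
  interpret f: group_hom G ?Q f
    unfolding f_def by (rule N.quotient_hom)
  have ker: "f a = \<one>\<^bsub>?Q\<^esub>" if "a \<in> U (Suc m)" for a
    using that unfolding f_def by (subst N.coset_eq_one_iff) auto
  have pw: "g [^] (p ^ Suc m) = (g [^] (p ^ m)) [^] p" if "g \<in> A" for g
    using that by (simp add: nat_pow_pow mult.commute)
  have hk: "h \<otimes> k \<in> A"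
    using assms subgroup.m_closed[OF A_subgroup] by auto
  have "f ((h \<otimes> k) [^] (p ^ Suc m)) = f (h [^] (p ^ Suc m) \<otimes> k [^] (p ^ Suc m))"
  proof (cases "m = 0")
    case True
    then show ?thesis
      using hom_pow_p_mult_U_1[OF f.group_hom_axioms, of h k] ker assms by (simp add: f.hom_nat_pow)
  next
    case False
    obtain z where z: "z \<in> U m" "(h \<otimes> k) [^] (p ^ m) = z \<otimes> (h [^] (p ^ m) \<otimes> k [^] (p ^ m))"
      using coset_eqD[OF U_subgroup _ _ Suc.IH] assms by auto
    have kerP: "f a = \<one>\<^bsub>?Q\<^esub>" if "a \<in> P (m + 1 + 3)" for a
      using that P_subset_U[of "Suc m"] by (intro ker) auto
    have inP: "z \<in> P (m + 1)" "h [^] (p ^ m) \<in> P (m + 1)" "k [^] (p ^ m) \<in> P (m + 1)"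
      using z U_subset_P[of m] P_antimono[of "m + 1" "m + 2"] A_pow_in_P assms by auto
    note mult = hom_pow_p_mult[OF f.group_hom_axioms kerP]
    have "f ((h \<otimes> k) [^] (p ^ Suc m)) = f (z \<otimes> (h [^] (p ^ m) \<otimes> k [^] (p ^ m))) [^]\<^bsub>?Q\<^esub> p"
      unfolding pw[OF hk] z(2) using assms z(1) by (subst f.hom_nat_pow) auto
    also have "\<dots> = f z [^]\<^bsub>?Q\<^esub> p \<otimes>\<^bsub>?Q\<^esub> f (h [^] (p ^ m) \<otimes> k [^] (p ^ m)) [^]\<^bsub>?Q\<^esub> p"
      by (rule mult) (use False inP subgroup.m_closed[OF P_subgroup] in auto)
    also have "f z [^]\<^bsub>?Q\<^esub> p = \<one>\<^bsub>?Q\<^esub>"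
      using hom_pow_p_U[OF f.group_hom_axioms ker z(1)] by simp
    also have "f (h [^] (p ^ m) \<otimes> k [^] (p ^ m)) [^]\<^bsub>?Q\<^esub> p
        = f (h [^] (p ^ m)) [^]\<^bsub>?Q\<^esub> p \<otimes>\<^bsub>?Q\<^esub> f (k [^] (p ^ m)) [^]\<^bsub>?Q\<^esub> p"
      by (rule mult) (use False inP in auto)
    also have "\<one>\<^bsub>?Q\<^esub> \<otimes>\<^bsub>?Q\<^esub> \<dots> = f (h [^] (p ^ Suc m) \<otimes> k [^] (p ^ Suc m))"
      unfolding pw[OF assms(1)] pw[OF assms(2)] using assms
      by (simp add: f.hom_nat_pow f.H.nat_pow_closed)
    finally show ?thesis .
  qed
  then show ?case
    by (simp add: f_def)
qed

end

section \<open>The homomorphism given by the power \<open>p ^ m\<close>\<close>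

text \<open>The homomorphism \<open>f\<close> is arbitrary, so that the quotients of \<open>G\<close> by \<open>U m\<close>, by a term of the \<open>p\<close>-central series
  and by any other normal subgroup above \<open>U m\<close> are treated at once.\<close>

locale p_power_hom = p_central_series G p A + hom: group_hom G Q f
  for G :: "('a, 'b) monoid_scheme" (structure) and p A and Q :: "('c, 'd) monoid_scheme" and f +
  fixes m :: nat
  assumes kills_U: "a \<in> U m \<Longrightarrow> f a = \<one>\<^bsub>Q\<^esub>"
begin

definition pi :: "'a \<Rightarrow> 'c" where
  "pi h = f h [^]\<^bsub>Q\<^esub> (p ^ m)"

lemma pi_closed [simp]: "h \<in> A \<Longrightarrow> pi h \<in> carrier Q"
  by (simp add: pi_def)

lemma pi_eq: "h \<in> A \<Longrightarrow> pi h = f (h [^] (p ^ m))"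
  by (simp add: pi_def hom.hom_nat_pow)

lemma pi_mult:
  assumes "h \<in> A" "k \<in> A"
  shows "pi (h \<otimes> k) = pi h \<otimes>\<^bsub>Q\<^esub> pi k"
proof -
  obtain z where z: "z \<in> U m" "(h \<otimes> k) [^] (p ^ m) = z \<otimes> (h [^] (p ^ m) \<otimes> k [^] (p ^ m))"
    using coset_eqD[OF U_subgroup _ _ pow_p_pow_mult[OF assms]] assms by auto
  have "pi (h \<otimes> k) = f (z \<otimes> (h [^] (p ^ m) \<otimes> k [^] (p ^ m)))"
    using assms by (subst pi_eq) (simp_all add: subgroup.m_closed[OF A_subgroup] z(2))
  also have "\<dots> = pi h \<otimes>\<^bsub>Q\<^esub> pi k"
    using z(1) assms by (simp add: kills_U pi_eq)
  finally show ?thesis .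
qed

lemma pi_one [simp]: "pi \<one> = \<one>\<^bsub>Q\<^esub>"
  by (simp add: pi_def)

lemma pi_int_pow: "h \<in> A \<Longrightarrow> pi (h [^] (i::int)) = pi h [^]\<^bsub>Q\<^esub> i"
  by (simp add: pi_def hom.hom_int_pow hom.H.int_pow_pow mult.commute flip: int_pow_int)

lemma pi_order: "h \<in> A \<Longrightarrow> pi h [^]\<^bsub>Q\<^esub> p = \<one>\<^bsub>Q\<^esub>"
  using kills_U[OF A_pow_in_U[of h m]] by (simp add: pi_def hom.hom_nat_pow hom.H.nat_pow_pow mult.commute)

lemma pi_D: "h \<in> D \<Longrightarrow> pi h = \<one>\<^bsub>Q\<^esub>"
  using kills_U[OF D_pow_in_U[of h m]] by (simp add: pi_def hom.hom_nat_pow)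

lemma A_conj [simp]: "h \<in> A \<Longrightarrow> g \<in> carrier G \<Longrightarrow> inv g \<otimes> h \<otimes> g \<in> A"
  by (rule normal_conj[OF A_normal])

lemma pi_conj_A:
  assumes h: "h \<in> A" and a: "a \<in> A"
  shows "pi (inv a \<otimes> h \<otimes> a) = pi h"
proof -
  have "inv a \<otimes> h \<otimes> a = h \<otimes> commutator G h a"
    using h a by (simp add: conj_eq_mult_commutator)
  then show ?thesis
    using assms commutator_in_comm_subgroup[OF h a] normal_commutator_left[OF A_normal h, of a]
    by (simp add: pi_mult pi_D)
qed

lemma pi_conj:
  assumes h: "h \<in> A" and g: "g \<in> carrier G"
  shows "pi (inv g \<otimes> h \<otimes> g) = inv\<^bsub>Q\<^esub> f g \<otimes>\<^bsub>Q\<^esub> pi h \<otimes>\<^bsub>Q\<^esub> f g"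
proof -
  interpret c: group_hom G G "\<lambda>u. inv g \<otimes> u \<otimes> inv (inv g)"
    by (rule conj_hom) (use g in simp)
  have "(inv g \<otimes> h \<otimes> g) [^] (p ^ m) = inv g \<otimes> h [^] (p ^ m) \<otimes> g"
    using c.hom_nat_pow[of h "p ^ m"] h g by simp
  then show ?thesis
    using h g by (simp add: pi_eq del: hom.hom_nat_pow)
qed

lemma pi_commute_A:
  assumes "h \<in> A" "a \<in> A"
  shows "pi h \<otimes>\<^bsub>Q\<^esub> f a = f a \<otimes>\<^bsub>Q\<^esub> pi h"
proof -
  have "f a \<otimes>\<^bsub>Q\<^esub> (inv\<^bsub>Q\<^esub> f a \<otimes>\<^bsub>Q\<^esub> pi h \<otimes>\<^bsub>Q\<^esub> f a) = f a \<otimes>\<^bsub>Q\<^esub> pi h"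
    using pi_conj[of h a] pi_conj_A assms by simp
  then show ?thesis
    using assms by (simp add: hom.H.m_assoc hom.H.inv_mult_cancel)
qed

lemma pi_commute:
  assumes "h \<in> A" "k \<in> A"
  shows "pi h \<otimes>\<^bsub>Q\<^esub> pi k = pi k \<otimes>\<^bsub>Q\<^esub> pi h"
  using assms pi_commute_A[of h "k [^] (p ^ m)"] pow_subgroup_mem[OF A_subgroup]
  by (simp add: pi_eq[of k])

end

section \<open>Norms\<close>

text \<open>For \<open>k = q\<close> this product over the powers of \<open>x\<close> is the norm of \<open>h\<close>: it appears in \<open>(x h)\<^sup>k\<close>, by
  \<open>mult_pow_conj_prod\<close>.\<close>

fun conj_prod :: "('a, 'b) monoid_scheme \<Rightarrow> 'a \<Rightarrow> 'a \<Rightarrow> nat \<Rightarrow> 'a" where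
  "conj_prod G x h 0 = \<one>\<^bsub>G\<^esub>"
| "conj_prod G x h (Suc k) = conjugate G h (x [^]\<^bsub>G\<^esub> k) \<otimes>\<^bsub>G\<^esub> conj_prod G x h k"

lemma y_conj_prod_eq: "y_conj_prod k = conj_prod F2 x2 y2 k"
  by (induction k) auto

context group
begin

lemma conjugate_closed [simp]:
  "h \<in> carrier G \<Longrightarrow> g \<in> carrier G \<Longrightarrow> conjugate G h g \<in> carrier G"
  by (simp add: conjugate_def)

lemma conjugate_mult:
  "h \<in> carrier G \<Longrightarrow> k \<in> carrier G \<Longrightarrow> g \<in> carrier G \<Longrightarrow>
    conjugate G (h \<otimes> k) g = conjugate G h g \<otimes> conjugate G k g"
  by (simp add: conjugate_def m_assoc inv_mult_cancel)

lemma conjugate_one [simp]: "g \<in> carrier G \<Longrightarrow> conjugate G \<one> g = \<one>"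
  by (simp add: conjugate_def)

lemma conjugate_by_one [simp]: "h \<in> carrier G \<Longrightarrow> conjugate G h \<one> = h"
  by (simp add: conjugate_def)

lemma conjugate_conjugate:
  "h \<in> carrier G \<Longrightarrow> g \<in> carrier G \<Longrightarrow> k \<in> carrier G \<Longrightarrow>
    conjugate G (conjugate G h g) k = conjugate G h (g \<otimes> k)"
  by (simp add: conjugate_def m_assoc inv_mult_group)

lemma conjugate_commuting:
  "h \<in> carrier G \<Longrightarrow> g \<in> carrier G \<Longrightarrow> h \<otimes> g = g \<otimes> h \<Longrightarrow> conjugate G h g = h"
  by (simp add: conjugate_def m_assoc inv_mult_cancel)

lemma conjugate_hom: "g \<in> carrier G \<Longrightarrow> group_hom G G (\<lambda>h. conjugate G h g)"
  by (auto intro!: group_hom.intro group_hom_axioms.intro homI conjugate_mult)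

lemma conj_prod_closed [simp]:
  "x \<in> carrier G \<Longrightarrow> h \<in> carrier G \<Longrightarrow> conj_prod G x h k \<in> carrier G"
  by (induction k) auto

lemma mult_pow_conj_prod:
  assumes "x \<in> carrier G" "h \<in> carrier G"
  shows "(x \<otimes> h) [^] k = x [^] k \<otimes> conj_prod G x h k"
proof (induction k)
  case (Suc k)
  have "(x \<otimes> h) [^] Suc k = (x \<otimes> h) \<otimes> (x \<otimes> h) [^] k"
    using assms by (intro nat_pow_Suc2) simp
  also have "\<dots> = x \<otimes> x [^] k \<otimes> (conjugate G h (x [^] k) \<otimes> conj_prod G x h k)"
    unfolding Suc using assms by (simp add: conjugate_def m_assoc inv_mult_cancel)
  also have "x \<otimes> x [^] k = x [^] Suc k"
    using assms by (simp only: nat_pow_Suc2)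
  finally show ?case
    by simp
qed simp

lemma conjugate_conj_prod:
  assumes "x \<in> carrier G" "h \<in> carrier G"
  shows "conjugate G (conj_prod G x h k) x = conj_prod G x (conjugate G h x) k"
proof (induction k)
  case (Suc k)
  have "x [^] k \<otimes> x = x \<otimes> x [^] k"
    using nat_pow_Suc2[OF assms(1), of k] by simp
  then show ?case
    using assms Suc by (simp add: conjugate_mult conjugate_conjugate)
qed (use assms in simp)

text \<open>Conjugating \<open>h\<close> by \<open>x\<close> moves the window of exponents \<open>0, \<dots>, k - 1\<close> up by one.\<close>

lemma conj_prod_shift:
  assumes "x \<in> carrier G" "h \<in> carrier G"
  shows "conj_prod G x (conjugate G h x) k \<otimes> h = conj_prod G x h (Suc k)"
proof (induction k)
  case (Suc k)
  have x: "x \<otimes> x [^] k = x [^] Suc k"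
    using assms by (simp only: nat_pow_Suc2)
  have "conj_prod G x (conjugate G h x) (Suc k) \<otimes> h
    = conjugate G h (x [^] Suc k) \<otimes> (conj_prod G x (conjugate G h x) k \<otimes> h)"
    using assms by (simp add: conjugate_conjugate x m_assoc del: nat_pow_Suc)
  then show ?case
    unfolding Suc by simp
qed (use assms in simp)

lemma conj_prod_commuting:
  assumes "x \<in> carrier G" "h \<in> carrier G" "h \<otimes> x = x \<otimes> h"
  shows "conj_prod G x h k = h [^] k"
proof (induction k)
  case (Suc k)
  have "conjugate G h (x [^] k) = h"
    using assms group_commutes_pow[of x h k] by (intro conjugate_commuting) auto
  then show ?case
    using assms Suc by (simp add: nat_pow_Suc2[symmetric] del: nat_pow_Suc)
qed simp

lemma commute_if_conjugate_eq:
  assumes "h \<in> carrier G" "g \<in> carrier G" "conjugate G h g = h"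
  shows "h \<otimes> g = g \<otimes> h"
proof -
  have "g \<otimes> conjugate G h g = h \<otimes> g"
    using assms(1,2) by (simp add: conjugate_def m_assoc inv_mult_cancel)
  then show ?thesis
    using assms by simp
qed

end

context p_power_hom
begin

lemma A_conjugate [simp]: "h \<in> A \<Longrightarrow> g \<in> carrier G \<Longrightarrow> conjugate G h g \<in> A"
  by (simp add: conjugate_def)

lemma A_mult [simp]: "h \<in> A \<Longrightarrow> k \<in> A \<Longrightarrow> h \<otimes> k \<in> A"
  and A_one [simp]: "\<one> \<in> A"
  using subgroup.m_closed[OF A_subgroup] subgroup.one_closed[OF A_subgroup] by auto

lemma A_conj_prod [simp]: "x \<in> carrier G \<Longrightarrow> h \<in> A \<Longrightarrow> conj_prod G x h k \<in> A"
  by (induction k) auto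

lemma pi_conjugate_A: "h \<in> A \<Longrightarrow> a \<in> A \<Longrightarrow> pi (conjugate G h a) = pi h"
  by (simp add: conjugate_def pi_conj_A)

lemma pi_conj_prod_mult:
  assumes "x \<in> carrier G" "h \<in> A" "k \<in> A"
  shows "pi (conj_prod G x (h \<otimes> k) n) = pi (conj_prod G x h n) \<otimes>\<^bsub>Q\<^esub> pi (conj_prod G x k n)"
proof (induction n)
  case (Suc n)
  let ?c = "\<lambda>h. pi (conjugate G h (x [^] n))" and ?N = "\<lambda>h. pi (conj_prod G x h n)"
  have "pi (conj_prod G x (h \<otimes> k) (Suc n)) = ?c h \<otimes>\<^bsub>Q\<^esub> (?c k \<otimes>\<^bsub>Q\<^esub> ?N h) \<otimes>\<^bsub>Q\<^esub> ?N k"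
    using assms Suc by (simp add: conjugate_mult pi_mult hom.H.m_assoc)
  also have "?c k \<otimes>\<^bsub>Q\<^esub> ?N h = ?N h \<otimes>\<^bsub>Q\<^esub> ?c k"
    using assms by (intro pi_commute) auto
  also have "?c h \<otimes>\<^bsub>Q\<^esub> (?N h \<otimes>\<^bsub>Q\<^esub> ?c k) \<otimes>\<^bsub>Q\<^esub> ?N k
    = pi (conj_prod G x h (Suc n)) \<otimes>\<^bsub>Q\<^esub> pi (conj_prod G x k (Suc n))"
    using assms by (simp add: pi_mult hom.H.m_assoc)
  finally show ?case .
qed simp

text \<open>The norm followed by \<open>\<pi>\<close> is a homomorphism into an abelian group.\<close>

lemma pi_conj_prod_conjugate_A:
  assumes x: "x \<in> carrier G" and h: "h \<in> A" and a: "a \<in> A"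
  shows "pi (conj_prod G x (conjugate G h a) n) = pi (conj_prod G x h n)"
proof -
  have "pi (conj_prod G x (a \<otimes> conjugate G h a) n) = pi (conj_prod G x (h \<otimes> a) n)"
    using h a by (simp add: conjugate_def m_assoc inv_mult_cancel)
  then have "pi (conj_prod G x (conjugate G h a) n) \<otimes>\<^bsub>Q\<^esub> pi (conj_prod G x a n)
    = pi (conj_prod G x h n) \<otimes>\<^bsub>Q\<^esub> pi (conj_prod G x a n)"
    using assms pi_commute[of "conj_prod G x a n" "conj_prod G x (conjugate G h a) n"]
    by (simp add: pi_conj_prod_mult)
  then show ?thesis
    using assms by simp
qed

text \<open>In the shifted window the factor for the exponent \<open>n\<close> replaces the one for \<open>0\<close>. Since \<open>x\<^sup>n \<in> A\<close>, both have the
  same image under \<open>\<pi>\<close>.\<close>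

lemma pi_conj_prod_conjugate_x:
  assumes x: "x \<in> carrier G" and h: "h \<in> A" and xq: "x [^] n \<in> A"
  shows "pi (conj_prod G x (conjugate G h x) n) = pi (conj_prod G x h n)"
proof -
  have "pi (conj_prod G x (conjugate G h x) n \<otimes> h) = pi (conjugate G h (x [^] n) \<otimes> conj_prod G x h n)"
    using x h by (simp add: conj_prod_shift)
  then have "pi (conj_prod G x (conjugate G h x) n) \<otimes>\<^bsub>Q\<^esub> pi h = pi (conj_prod G x h n) \<otimes>\<^bsub>Q\<^esub> pi h"
    using assms pi_commute[of h "conj_prod G x h n"] by (simp add: pi_mult pi_conjugate_A)
  then show ?thesis
    using assms by simp
qed

text \<open>The elements by which conjugation does not change the norm form a subgroup, so the norm is
  invariant under the subgroup generated by \<open>x\<close> and \<open>A\<close>.\<close>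

lemma pi_conj_prod_conjugate:
  assumes x: "x \<in> carrier G" and xq: "x [^] n \<in> A" and gen: "generate G (insert x A) = carrier G"
    and h: "h \<in> A" and g: "g \<in> carrier G"
  shows "pi (conj_prod G x (conjugate G h g) n) = pi (conj_prod G x h n)"
proof -
  have "\<forall>h\<in>A. pi (conj_prod G x (conjugate G h g) n) = pi (conj_prod G x h n)"
    if "g \<in> generate G (insert x A)" for g
    using that
  proof (induction rule: generate.induct)
    case one
    then show ?case
      by simp
  next
    case (incl g)
    then show ?case
      using pi_conj_prod_conjugate_x[OF x _ xq] pi_conj_prod_conjugate_A[OF x] by auto
  next
    case (inv g)
    have gc: "g \<in> carrier G"
      using inv x by auto
    have *: "pi (conj_prod G x (conjugate G h g) n) = pi (conj_prod G x h n)" if "h \<in> A" for h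
      using inv that pi_conj_prod_conjugate_x[OF x _ xq] pi_conj_prod_conjugate_A[OF x] by auto
    show ?case
    proof
      fix h assume h: "h \<in> A"
      show "pi (conj_prod G x (conjugate G h (inv g)) n) = pi (conj_prod G x h n)"
        using *[of "conjugate G h (inv g)"] h gc by (simp add: conjugate_conjugate)
    qed
  next
    case (eng g k)
    then have "g \<in> carrier G" "k \<in> carrier G"
      using gen by auto
    then show ?case
      using eng by (simp add: conjugate_conjugate[symmetric])
  qed
  then show ?thesis
    using g h gen by auto
qed

end

section \<open>Integer-valued functions on the free group\<close>

text \<open>An additive function vanishes on commutators and is multiplied by \<open>p\<close> on \<open>p\<close>-th powers.\<close>

lemma (in p_central_series) additive_dvd_on_P:
  fixes \<phi> :: "'a \<Rightarrow> int"
  assumes add: "\<And>u v. u \<in> A \<Longrightarrow> v \<in> A \<Longrightarrow> \<phi> (u \<otimes> v) = \<phi> u + \<phi> v"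
  shows "u \<in> P (k + 1) \<Longrightarrow> int p ^ k dvd \<phi> u"
proof (induction k arbitrary: u)
  case (Suc k)
  have A1: "\<one> \<in> A" and Ainv: "\<And>u. u \<in> A \<Longrightarrow> inv u \<in> A"
    and Amult: "\<And>u v. u \<in> A \<Longrightarrow> v \<in> A \<Longrightarrow> u \<otimes> v \<in> A"
    using A_subgroup by (auto intro: subgroup.one_closed subgroup.m_inv_closed subgroup.m_closed)
  have one: "\<phi> \<one> = 0"
    using add[OF A1 A1] by simp
  have inv: "\<phi> (inv u) = - \<phi> u" if "u \<in> A" for u
    using add[OF Ainv[OF that] that] that one by simp
  have pow: "\<phi> (u [^] n) = int n * \<phi> u" if "u \<in> A" for u and n :: nat
    by (induction n) (use that pow_subgroup_mem[OF A_subgroup] in \<open>auto simp: one add algebra_simps\<close>)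
  have comm: "\<phi> (commutator G u v) = 0" if "u \<in> A" "v \<in> A" for u v
    using that by (simp add: commutator_def add inv Ainv Amult)
  let ?K = "{u \<in> A. int p ^ Suc k dvd \<phi> u}"
  have K: "subgroup ?K G"
  proof (rule subgroupI)
    show "?K \<noteq> {}"
      using A1 one by (metis (mono_tags, lifting) dvd_0_right empty_iff mem_Collect_eq)
  qed (auto simp: inv add Ainv Amult)
  have "P (Suc k + 1) = comm_subgroup G (P (k + 1)) A <#> power_subgroup G (P (k + 1)) p"
    using P_Suc[of "k + 1"] by simp
  also have "\<dots> \<subseteq> ?K"
  proof (intro setmult_least comm_subgroup_least power_subgroup_least K)
    show "commutator G u v \<in> ?K" if "u \<in> P (k + 1)" "v \<in> A" for u v
      using that subsetD[OF P_subset_A that(1)] comm normal_commutator_left[OF A_normal] by simp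
    show "u [^] p \<in> ?K" if "u \<in> P (k + 1)" for u
      using that subsetD[OF P_subset_A that(1)] Suc.IH[OF that] pow_subgroup_mem[OF A_subgroup]
      by (simp add: pow)
  qed
  finally show ?case
    using Suc.prems by auto
qed simp

lemma F2_group: "group F2"
  unfolding F2_def by (rule free_group_is_group)

lemma F2_mult: "u \<otimes>\<^bsub>F2\<^esub> v = foldr lmult u v"
  and F2_one: "\<one>\<^bsub>F2\<^esub> = []"
  by (simp_all add: F2_def free_group_def)

interpretation F2: group F2
  by (rule F2_group)

lemma x2_closed [simp]: "x2 \<in> carrier F2" and y2_closed [simp]: "y2 \<in> carrier F2"
  by (simp_all add: x2_def y2_def F2_def fgen_closed)

lemma F2_generated: "generate F2 {x2, y2} = carrier F2"
proof -
  have "range fgen = {x2, y2}"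
    unfolding x2_def y2_def by (auto intro: gen2.exhaust) (metis gen2.exhaust)
  then show ?thesis
    using free_group_generated[where 'g = gen2] by (simp add: F2_def)
qed

definition exponent_sum :: "'g \<Rightarrow> 'g letter list \<Rightarrow> int" where
  "exponent_sum g w = (\<Sum>l\<leftarrow>w. if fst l = g then if snd l then 1 else -1 else 0)"

lemma exponent_sum_mult: "exponent_sum g (u \<otimes>\<^bsub>F2\<^esub> v) = exponent_sum g u + exponent_sum g v"
proof -
  have "exponent_sum g (lmult l w) = exponent_sum g [l] + exponent_sum g w" for l and w :: "gen2 letter list"
    by (cases w) (auto simp: exponent_sum_def inv_letter_def)
  then have "exponent_sum g (foldr lmult u v) = exponent_sum g u + exponent_sum g v"
    by (induction u) (auto simp: exponent_sum_def)
  then show ?thesis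
    by (simp add: F2_mult)
qed

lemma exponent_sum_hom: "group_hom F2 integer_group (exponent_sum g)"
  by (auto intro!: group_hom.intro group_hom_axioms.intro homI simp: exponent_sum_mult F2_group)

lemma exponent_sum_one [simp]: "exponent_sum g \<one>\<^bsub>F2\<^esub> = 0"
  and exponent_sum_inv [simp]: "u \<in> carrier F2 \<Longrightarrow> exponent_sum g (inv\<^bsub>F2\<^esub> u) = - exponent_sum g u"
  and exponent_sum_pow [simp]: "u \<in> carrier F2 \<Longrightarrow> exponent_sum g (u [^]\<^bsub>F2\<^esub> (n::nat)) = int n * exponent_sum g u"
  and exponent_sum_int_pow [simp]: "u \<in> carrier F2 \<Longrightarrow> exponent_sum g (u [^]\<^bsub>F2\<^esub> (i::int)) = i * exponent_sum g u"
  using group_hom.hom_one[OF exponent_sum_hom] group_hom.hom_inv[OF exponent_sum_hom]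
    group_hom.hom_nat_pow[OF exponent_sum_hom] group_hom.hom_int_pow[OF exponent_sum_hom]
  by simp_all

declare exponent_sum_mult [simp]

lemma exponent_sum_generators [simp]:
  "exponent_sum GX x2 = 1" "exponent_sum GY x2 = 0" "exponent_sum GX y2 = 0" "exponent_sum GY y2 = 1"
  by (simp_all add: exponent_sum_def x2_def y2_def fgen_def)

lemma exponent_sum_conjugate [simp]:
  "u \<in> carrier F2 \<Longrightarrow> g \<in> carrier F2 \<Longrightarrow> exponent_sum k (conjugate F2 u g) = exponent_sum k u"
  by (simp add: conjugate_def)

text \<open>The signed number of letters \<open>y\<close> in a word at which the exponent of \<open>x\<close>, counted from the starting value \<open>s\<close>,
  is divisible by \<open>q\<close>. This is a coordinate of the homomorphism to the wreath product of the integers by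
  the integers modulo \<open>q\<close>. By \<open>y_count_mult\<close> it is a crossed homomorphism, hence additive where the
  exponent sum of \<open>x\<close> is divisible by \<open>q\<close>. Unlike the exponent sum in \<open>y\<close>, which is \<open>q\<close> on the norm of \<open>y\<close>,
  it takes the value \<open>1\<close> there (\<open>y_count_full_conj_prod\<close>).\<close>

fun y_count :: "nat \<Rightarrow> gen2 letter list \<Rightarrow> int \<Rightarrow> int" where
  "y_count q [] s = 0"
| "y_count q ((GX, b) # w) s = y_count q w (if b then s + 1 else s - 1)"
| "y_count q ((GY, b) # w) s = (if int q dvd s then if b then 1 else -1 else 0) + y_count q w s"

lemma y_count_Cons: "y_count q (l # w) s = y_count q [l] s + y_count q w (s + exponent_sum GX [l])"
  by (cases l; cases "fst l") (auto simp: exponent_sum_def)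

lemma y_count_mult: "y_count q (u \<otimes>\<^bsub>F2\<^esub> v) s = y_count q u s + y_count q v (s + exponent_sum GX u)"
proof -
  have cancel: "y_count q [inv_letter l] (s + exponent_sum GX [l]) = - y_count q [l] s"
    "exponent_sum GX [inv_letter l] = - exponent_sum GX [l]" for l s
    by (cases l; cases "fst l"; auto simp: inv_letter_def exponent_sum_def)+
  have lm: "y_count q (lmult l w) s = y_count q [l] s + y_count q w (s + exponent_sum GX [l])" for l w s
  proof (cases w)
    case (Cons k v)
    then show ?thesis
      using y_count_Cons[of q k v "s + exponent_sum GX [l]"] y_count_Cons[of q l w s] cancel(1)[of l s] cancel(2)[of l]
      by auto
  qed simp
  have ex: "exponent_sum GX (l # u) = exponent_sum GX [l] + exponent_sum GX u" for l :: "gen2 letter" and u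
    by (simp add: exponent_sum_def)
  have "y_count q (foldr lmult u v) s = y_count q u s + y_count q v (s + exponent_sum GX u)"
  proof (induction u arbitrary: s)
    case (Cons l u)
    then show ?case
      using y_count_Cons[of q l u s] ex[of l u] by (simp add: lm algebra_simps)
  qed (simp add: exponent_sum_def)
  then show ?thesis
    by (simp add: F2_mult)
qed

lemma y_count_one [simp]: "y_count q \<one>\<^bsub>F2\<^esub> s = 0"
  by (simp add: F2_one)

lemma y_count_periodic: "int q dvd t \<Longrightarrow> y_count q w (s + t) = y_count q w s"
proof (induction w arbitrary: s)
  case (Cons l w)
  have "int q dvd s + t \<longleftrightarrow> int q dvd s"
    using Cons.prems by (simp add: dvd_add_left_iff)
  moreover have "y_count q w (s + t + 1) = y_count q w (s + 1)" "y_count q w (s + t - 1) = y_count q w (s - 1)"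
    using Cons.IH[of "s + 1"] Cons.IH[of "s - 1"] Cons.prems by (auto simp: algebra_simps)
  ultimately show ?case
    using Cons.IH[of s] Cons.prems by (cases l; cases "fst l") auto
qed simp

lemma y_count_x_pow [simp]: "y_count q (x2 [^]\<^bsub>F2\<^esub> (n::nat)) s = 0"
proof (induction n)
  case (Suc n)
  then show ?case
    by (simp add: y_count_mult) (simp add: x2_def fgen_def)
qed simp

lemma y_count_y [simp]: "y_count q y2 s = (if int q dvd s then 1 else 0)"
  by (simp add: y2_def fgen_def)

lemma y_count_conj_prod:
  "y_count q (conj_prod F2 x2 y2 k) 0 = (\<Sum>i<k. if q dvd i then 1 else 0)"
  and exponent_sum_conj_prod: "exponent_sum GX (conj_prod F2 x2 y2 k) = 0"
proof -
  have inv: "y_count q (inv\<^bsub>F2\<^esub> (x2 [^]\<^bsub>F2\<^esub> k)) s = 0" for s and k :: nat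
    using y_count_mult[of q "inv\<^bsub>F2\<^esub> (x2 [^]\<^bsub>F2\<^esub> k)" "x2 [^]\<^bsub>F2\<^esub> k" s] by simp
  show "exponent_sum GX (conj_prod F2 x2 y2 k) = 0"
    by (induction k) auto
  show "y_count q (conj_prod F2 x2 y2 k) 0 = (\<Sum>i<k. if q dvd i then 1 else 0)"
    by (induction k) (auto simp: y_count_mult inv conjugate_def)
qed

lemma y_count_full_conj_prod:
  assumes "q > 0"
  shows "y_count q (conj_prod F2 x2 y2 q) 0 = 1"
proof -
  have "(\<Sum>i<q. if q dvd i then 1 else 0 :: int) = (\<Sum>i<q. if i = 0 then 1 else 0)"
    by (intro sum.cong) (auto dest: dvd_imp_le)
  then show ?thesis
    using assms by (simp add: y_count_conj_prod)
qed

section \<open>The subgroup \<open>H\<close>\<close>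

lemma (in group) normal_closure_normal:
  assumes "S \<subseteq> carrier G"
  shows "normal_closure G S \<lhd> G"
proof -
  have "carrier G \<in> {N. N \<lhd> G \<and> S \<subseteq> N}"
    using normal_self assms by simp
  then have "subgroup (normal_closure G S) G"
    unfolding normal_closure_def by (intro subgroups_Inter) (auto dest: normal_imp_subgroup)
  then show ?thesis
    unfolding normal_inv_iff by (auto simp: normal_closure_def dest: normal.inv_op_closed2)
qed

lemma normal_closure_least: "N \<lhd> G \<Longrightarrow> S \<subseteq> N \<Longrightarrow> normal_closure G S \<subseteq> N"
  by (auto simp: normal_closure_def)

lemma normal_closure_incl: "S \<subseteq> normal_closure G S"
  by (auto simp: normal_closure_def)

locale H_series =
  fixes p a :: nat
  assumes p_prime': "Factorial_Ring.prime p" and p_ge_5': "p \<ge> 5"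
begin

abbreviation "H \<equiv> H_sub p a"
abbreviation "q \<equiv> p ^ a"
abbreviation "X \<equiv> x2 [^]\<^bsub>F2\<^esub> q"
abbreviation "Y \<equiv> conj_prod F2 x2 y2 q"
abbreviation "ex \<equiv> exponent_sum GX"
abbreviation "ey \<equiv> exponent_sum GY"

lemma H_normal: "H \<lhd> F2"
  unfolding H_sub_def by (rule F2.normal_closure_normal) auto

end

sublocale H_series \<subseteq> p_central_series F2 p "H_sub p a"
  by (intro p_central_series.intro p_central_series_axioms.intro F2_group H_normal p_prime' p_ge_5')

context H_series
begin

lemma U_sub_eq: "U_sub p a (m + 2) = U m"
  by (simp add: U_sub_def U_def numeral_2_eq_2 numeral_3_eq_3)

lemma X_in_H [simp]: "X \<in> H" and y_in_H [simp]: "y2 \<in> H"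
  using normal_closure_incl[of "{X, y2}" F2] unfolding H_sub_def by auto

lemma H_least: "N \<lhd> F2 \<Longrightarrow> X \<in> N \<Longrightarrow> y2 \<in> N \<Longrightarrow> H \<subseteq> N"
  unfolding H_sub_def by (rule normal_closure_least) auto

lemma H_closure [simp]:
  "h \<in> H \<Longrightarrow> k \<in> H \<Longrightarrow> h \<otimes>\<^bsub>F2\<^esub> k \<in> H" "\<one>\<^bsub>F2\<^esub> \<in> H" "h \<in> H \<Longrightarrow> inv\<^bsub>F2\<^esub> h \<in> H"
  "h \<in> H \<Longrightarrow> h [^]\<^bsub>F2\<^esub> (n::nat) \<in> H" "h \<in> H \<Longrightarrow> h [^]\<^bsub>F2\<^esub> (i::int) \<in> H"
  using subgroup.m_closed[OF A_subgroup] subgroup.one_closed[OF A_subgroup] pow_subgroup_mem[OF A_subgroup]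
    subgroup.m_inv_closed[OF A_subgroup] F2.subgroup_int_pow_closed[OF A_subgroup] by auto

lemma H_conj [simp]: "h \<in> H \<Longrightarrow> g \<in> carrier F2 \<Longrightarrow> conjugate F2 h g \<in> H"
  unfolding conjugate_def by (rule normal_conj[OF A_normal])

lemma p_pos [simp]: "p > 0" and q_pos [simp]: "q > 0"
  using p_ge_5 by simp_all

lemma Y_in_H [simp]: "conj_prod F2 x2 y2 k \<in> H"
  by (induction k) auto

lemma q_dvd_ex: "h \<in> H \<Longrightarrow> int q dvd ex h"
proof -
  let ?N = "{h \<in> carrier F2. int q dvd ex h}"
  have "subgroup ?N F2"
    by (rule F2.subgroupI) (auto intro!: exI[of _ "\<one>\<^bsub>F2\<^esub>"])
  then have "H \<subseteq> ?N"
    by (intro H_least subgroup_preserving_conj) auto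
  then show "h \<in> H \<Longrightarrow> int q dvd ex h"
    by auto
qed

lemma y_count_H_mult:
  "u \<in> H \<Longrightarrow> v \<in> H \<Longrightarrow> y_count q (u \<otimes>\<^bsub>F2\<^esub> v) 0 = y_count q u 0 + y_count q v 0"
  using y_count_periodic[OF q_dvd_ex[of u], of v 0] by (simp add: y_count_mult)

lemma ex_on_P: "u \<in> P (k + 1) \<Longrightarrow> int q * int p ^ k dvd ex u"
proof -
  assume u: "u \<in> P (k + 1)"
  have "int p ^ k dvd ex u div int q"
    by (rule additive_dvd_on_P[OF _ u]) (use q_dvd_ex in \<open>auto intro: div_plus_div_distrib_dvd_left\<close>)
  moreover have "ex u = int q * (ex u div int q)"
    using q_dvd_ex[OF subsetD[OF P_subset_A u]] by simp
  ultimately show ?thesis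
    by (metis mult_dvd_mono dvd_refl)
qed

lemma y_count_on_P: "u \<in> P (k + 1) \<Longrightarrow> int p ^ k dvd y_count q u 0"
  by (rule additive_dvd_on_P) (simp_all add: y_count_H_mult)

lemma y_count_int_pow: "u \<in> H \<Longrightarrow> y_count q (u [^]\<^bsub>F2\<^esub> (i::int)) 0 = i * y_count q u 0"
proof -
  assume u: "u \<in> H"
  have nat: "y_count q (u [^]\<^bsub>F2\<^esub> (n::nat)) 0 = int n * y_count q u 0" for n
    by (induction n) (use u in \<open>auto simp: y_count_H_mult algebra_simps\<close>)
  have inv: "y_count q (inv\<^bsub>F2\<^esub> v) 0 = - y_count q v 0" if "v \<in> H" for v
    using y_count_H_mult[of "inv\<^bsub>F2\<^esub> v" v] that by simp
  show ?thesis
    using u by (cases i rule: int_cases2) (simp_all add: int_pow_int nat inv F2.int_pow_neg)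
qed

text \<open>On \<open>P (m + 2)\<close> both additive functions \<open>ex / q\<close> and \<open>y_count\<close> are divisible by \<open>p\<^sup>m\<^sup>+\<^sup>1\<close>, while on \<open>X\<close>
  and \<open>Y\<close> they take the values \<open>1, 0\<close> and \<open>0, 1\<close>.\<close>

lemma independence:
  assumes "X [^]\<^bsub>F2\<^esub> (i * int p ^ m) \<otimes>\<^bsub>F2\<^esub> Y [^]\<^bsub>F2\<^esub> (j * int p ^ m) \<in> P (m + 2)"
  shows "int p dvd i" "int p dvd j"
proof -
  let ?w = "X [^]\<^bsub>F2\<^esub> (i * int p ^ m) \<otimes>\<^bsub>F2\<^esub> Y [^]\<^bsub>F2\<^esub> (j * int p ^ m)"
  have w: "?w \<in> P (m + 1 + 1)"
    using assms by (simp add: numeral_2_eq_2)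
  have p0: "int p ^ m \<noteq> 0" "int q \<noteq> 0"
    using p_ge_5 by auto
  have ex_w: "ex ?w = int q * (int p ^ m * i)"
    by (simp add: exponent_sum_conj_prod)
  have "int q * (int p ^ m * int p) dvd int q * (int p ^ m * i)"
    using ex_on_P[OF w] unfolding ex_w by (simp add: mult.commute)
  then show "int p dvd i"
    using p0 p_ge_5 by auto
  have y_w: "y_count q ?w 0 = int p ^ m * j"
    by (subst y_count_H_mult) (auto simp: y_count_int_pow y_count_full_conj_prod[OF q_pos])
  have "int p ^ m * int p dvd int p ^ m * j"
    using y_count_on_P[OF w] unfolding y_w by (simp add: mult.commute)
  then show "int p dvd j"
    using p0 p_ge_5 by auto
qed

text \<open>The quotient of \<open>F2\<close> by \<open>H\<close> is cyclic, generated by \<open>x\<close>.\<close>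

lemma x_part_in_H:
  assumes "g \<in> carrier F2"
  shows "x2 [^]\<^bsub>F2\<^esub> (- ex g) \<otimes>\<^bsub>F2\<^esub> g \<in> H"
proof -
  have mult: "x2 [^]\<^bsub>F2\<^esub> (- ex (g \<otimes>\<^bsub>F2\<^esub> k)) \<otimes>\<^bsub>F2\<^esub> (g \<otimes>\<^bsub>F2\<^esub> k) \<in> H"
    if g: "g \<in> carrier F2" "x2 [^]\<^bsub>F2\<^esub> (- ex g) \<otimes>\<^bsub>F2\<^esub> g \<in> H"
      and k: "k \<in> carrier F2" "x2 [^]\<^bsub>F2\<^esub> (- ex k) \<otimes>\<^bsub>F2\<^esub> k \<in> H" for g k
  proof -
    have "x2 [^]\<^bsub>F2\<^esub> (- ex (g \<otimes>\<^bsub>F2\<^esub> k)) \<otimes>\<^bsub>F2\<^esub> (g \<otimes>\<^bsub>F2\<^esub> k)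
      = conjugate F2 (x2 [^]\<^bsub>F2\<^esub> (- ex g) \<otimes>\<^bsub>F2\<^esub> g) (x2 [^]\<^bsub>F2\<^esub> ex k) \<otimes>\<^bsub>F2\<^esub> (x2 [^]\<^bsub>F2\<^esub> (- ex k) \<otimes>\<^bsub>F2\<^esub> k)"
    proof -
      have "x2 [^]\<^bsub>F2\<^esub> (- ex (g \<otimes>\<^bsub>F2\<^esub> k)) = inv\<^bsub>F2\<^esub> (x2 [^]\<^bsub>F2\<^esub> ex k) \<otimes>\<^bsub>F2\<^esub> x2 [^]\<^bsub>F2\<^esub> (- ex g)"
        by (simp add: F2.int_pow_neg[symmetric] F2.int_pow_mult[symmetric] algebra_simps)
      then show ?thesis
        using g(1) k(1) by (simp add: conjugate_def F2.m_assoc F2.inv_mult_cancel F2.int_pow_neg)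
    qed
    then show ?thesis
      using g k by simp
  qed
  have inv_gen: "x2 [^]\<^bsub>F2\<^esub> (- ex (inv\<^bsub>F2\<^esub> g)) \<otimes>\<^bsub>F2\<^esub> inv\<^bsub>F2\<^esub> g \<in> H"
    if g: "g \<in> carrier F2" "x2 [^]\<^bsub>F2\<^esub> (- ex g) \<otimes>\<^bsub>F2\<^esub> g \<in> H" for g
  proof -
    have "x2 [^]\<^bsub>F2\<^esub> (- ex (inv\<^bsub>F2\<^esub> g)) \<otimes>\<^bsub>F2\<^esub> inv\<^bsub>F2\<^esub> g
      = conjugate F2 (inv\<^bsub>F2\<^esub> (x2 [^]\<^bsub>F2\<^esub> (- ex g) \<otimes>\<^bsub>F2\<^esub> g)) (inv\<^bsub>F2\<^esub> (x2 [^]\<^bsub>F2\<^esub> ex g))"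
      using g(1) by (simp add: conjugate_def F2.m_assoc F2.inv_mult_cancel F2.int_pow_neg F2.inv_mult_group)
    then show ?thesis
      using g by simp
  qed
  have x: "x2 [^]\<^bsub>F2\<^esub> (- ex x2) \<otimes>\<^bsub>F2\<^esub> x2 \<in> H" and y: "x2 [^]\<^bsub>F2\<^esub> (- ex y2) \<otimes>\<^bsub>F2\<^esub> y2 \<in> H"
    by (simp_all add: F2.int_pow_neg)
  have "g \<in> generate F2 {x2, y2} \<Longrightarrow> x2 [^]\<^bsub>F2\<^esub> (- ex g) \<otimes>\<^bsub>F2\<^esub> g \<in> H"
  proof (induction rule: generate.induct)
    case (incl h)
    then show ?case
      using x y by auto
  next
    case (inv h)
    then show ?case
      using inv_gen x y by auto
  next
    case (eng h k)
    then show ?case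
      using mult F2_generated by auto
  qed simp
  then show ?thesis
    using assms F2_generated by simp
qed

lemma in_H_if_q_dvd_ex:
  assumes "g \<in> carrier F2" "int q dvd ex g"
  shows "g \<in> H"
proof -
  obtain t where t: "ex g = int q * t"
    using assms(2) by auto
  have "x2 [^]\<^bsub>F2\<^esub> ex g = X [^]\<^bsub>F2\<^esub> t"
    by (simp only: t int_pow_int[symmetric] F2.int_pow_pow x2_closed)
  then have xg: "x2 [^]\<^bsub>F2\<^esub> ex g \<in> H"
    by simp
  have "x2 [^]\<^bsub>F2\<^esub> ex g \<otimes>\<^bsub>F2\<^esub> (x2 [^]\<^bsub>F2\<^esub> (- ex g) \<otimes>\<^bsub>F2\<^esub> g) = g"
    using assms by (simp add: F2.int_pow_neg F2.inv_mult_cancel)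
  then show ?thesis
    using H_closure(1)[OF xg x_part_in_H[OF assms(1)]] by simp
qed

end

section \<open>Powers of elements outside \<open>H\<close>\<close>

lemma (in group) int_pow_eq_of_coprime:
  fixes p :: nat and j :: int
  assumes z: "z \<in> carrier G" "z [^] p = \<one>" and w: "w \<in> carrier G" "w [^] p = \<one>"
    and eq: "z [^] j = w [^] j" and cop: "coprime j (int p)"
  shows "z = w"
proof -
  obtain s t where st: "s * j + t * int p = 1"
    using bezout_int[of j "int p"] cop by auto
  have "u = (u [^] j) [^] s" if "u \<in> carrier G" "u [^] p = \<one>" for u
  proof -
    have "u [^] (1::int) = u [^] (j * s + int p * t)"
      using st by (simp add: mult.commute)
    also have "\<dots> = (u [^] j) [^] s \<otimes> (u [^] int p) [^] t"
      using that(1) by (simp only: int_pow_mult int_pow_pow)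
    finally show ?thesis
      using that by (simp add: int_pow_int)
  qed
  then show ?thesis
    using z w eq by metis
qed

locale H_power_hom = H_series p a + p_power_hom F2 p "H_sub p a" Q f m
  for p a and Q :: "('c, 'd) monoid_scheme" and f m
begin

lemma generate_x_H: "generate F2 (insert x2 H) = carrier F2"
proof
  show "generate F2 (insert x2 H) \<subseteq> carrier F2"
    by (rule F2.generate_incl) auto
  show "carrier F2 \<subseteq> generate F2 (insert x2 H)"
    unfolding F2_generated[symmetric] by (rule F2.mono_generate) auto
qed

lemma commute_all:
  assumes z: "z \<in> carrier Q" and x: "z \<otimes>\<^bsub>Q\<^esub> f x2 = f x2 \<otimes>\<^bsub>Q\<^esub> z"
    and h: "\<And>h. h \<in> H \<Longrightarrow> z \<otimes>\<^bsub>Q\<^esub> f h = f h \<otimes>\<^bsub>Q\<^esub> z" and g: "g \<in> carrier F2"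
  shows "z \<otimes>\<^bsub>Q\<^esub> f g = f g \<otimes>\<^bsub>Q\<^esub> z"
proof -
  have "g \<in> generate F2 (insert x2 H) \<Longrightarrow> f g \<otimes>\<^bsub>Q\<^esub> z = z \<otimes>\<^bsub>Q\<^esub> f g"
  proof (induction rule: generate.induct)
    case (incl k)
    then show ?case
      using x h by auto
  next
    case (inv k)
    then have k: "k \<in> carrier F2" "f k \<otimes>\<^bsub>Q\<^esub> z = z \<otimes>\<^bsub>Q\<^esub> f k"
      using x h by auto
    then show ?case
      using hom.H.inv_commute[of "f k" z] z by simp
  next
    case (eng k l)
    then have "k \<in> carrier F2" "l \<in> carrier F2"
      using generate_x_H by auto
    then show ?case
      using hom.H.mult_commute[of "f k" "f l" z] eng z by simp
  qed (use z in simp)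
  then show ?thesis
    using g generate_x_H by simp
qed

lemma pi_conjugate:
  "h \<in> H \<Longrightarrow> g \<in> carrier F2 \<Longrightarrow> pi (conjugate F2 h g) = conjugate Q (pi h) (f g)"
  by (simp add: conjugate_def pi_conj)

lemma pi_central:
  assumes h: "h \<in> H" and inv: "pi (conjugate F2 h x2) = pi h" and g: "g \<in> carrier F2"
  shows "pi h \<otimes>\<^bsub>Q\<^esub> f g = f g \<otimes>\<^bsub>Q\<^esub> pi h"
proof (rule commute_all[OF _ _ _ g])
  show "pi h \<otimes>\<^bsub>Q\<^esub> f x2 = f x2 \<otimes>\<^bsub>Q\<^esub> pi h"
    using inv h by (intro hom.H.commute_if_conjugate_eq) (simp_all add: pi_conjugate)
qed (use h pi_commute_A in auto)

lemma pi_X_central: "g \<in> carrier F2 \<Longrightarrow> pi X \<otimes>\<^bsub>Q\<^esub> f g = f g \<otimes>\<^bsub>Q\<^esub> pi X"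
proof (rule pi_central)
  have "conjugate F2 X x2 = X"
    using F2.nat_pow_Suc2[of x2 q] by (intro F2.conjugate_commuting) simp_all
  then show "pi (conjugate F2 X x2) = pi X"
    by simp
qed auto

lemma pi_Y_central: "g \<in> carrier F2 \<Longrightarrow> pi Y \<otimes>\<^bsub>Q\<^esub> f g = f g \<otimes>\<^bsub>Q\<^esub> pi Y"
  by (rule pi_central) (auto simp: F2.conjugate_conj_prod intro: pi_conj_prod_conjugate_x)

text \<open>The plane spanned by the central elements \<open>\<pi>(X)\<close> and \<open>\<pi>(Y)\<close>, of exponent \<open>p\<close>.\<close>

definition XY :: "int \<Rightarrow> int \<Rightarrow> 'c" where
  "XY i j = pi X [^]\<^bsub>Q\<^esub> i \<otimes>\<^bsub>Q\<^esub> pi Y [^]\<^bsub>Q\<^esub> j"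

lemma XY_closed [simp]: "XY i j \<in> carrier Q"
  by (simp add: XY_def)

lemma XY_eq: "XY i j = f (X [^]\<^bsub>F2\<^esub> (i * int p ^ m) \<otimes>\<^bsub>F2\<^esub> Y [^]\<^bsub>F2\<^esub> (j * int p ^ m))"
proof -
  have *: "f (h [^]\<^bsub>F2\<^esub> (i * int p ^ m)) = pi h [^]\<^bsub>Q\<^esub> i" if "h \<in> H" for h i
  proof -
    have "h [^]\<^bsub>F2\<^esub> (i * int p ^ m) = (h [^]\<^bsub>F2\<^esub> (p ^ m)) [^]\<^bsub>F2\<^esub> i"
      using that by (simp add: F2.int_pow_pow int_pow_int[symmetric] mult.commute)
    then show ?thesis
      using that by (simp add: hom.hom_int_pow pi_eq)
  qed
  show ?thesis
    by (simp add: XY_def *)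
qed

lemma XY_central:
  assumes "g \<in> carrier F2"
  shows "XY i j \<otimes>\<^bsub>Q\<^esub> f g = f g \<otimes>\<^bsub>Q\<^esub> XY i j"
proof -
  have int_pow: "z [^]\<^bsub>Q\<^esub> (i::int) \<otimes>\<^bsub>Q\<^esub> w = w \<otimes>\<^bsub>Q\<^esub> z [^]\<^bsub>Q\<^esub> i"
    if "z \<in> carrier Q" "w \<in> carrier Q" "z \<otimes>\<^bsub>Q\<^esub> w = w \<otimes>\<^bsub>Q\<^esub> z" for z w i
  proof (cases i rule: int_cases2)
    case (nonneg n)
    then show ?thesis
      using hom.H.group_commutes_pow[OF that(3,1,2)] by (simp add: int_pow_int)
  next
    case (nonpos n)
    then show ?thesis
      using hom.H.inv_commute[OF _ that(2) hom.H.group_commutes_pow[OF that(3,1,2)]] that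
      by (simp add: hom.H.int_pow_neg int_pow_int)
  qed
  show ?thesis
    unfolding XY_def using assms pi_X_central pi_Y_central
    by (intro hom.H.mult_commute int_pow) auto
qed

lemma XY_mult: "XY i j \<otimes>\<^bsub>Q\<^esub> XY k l = XY (i + k) (j + l)"
proof -
  have c: "XY 0 j \<otimes>\<^bsub>Q\<^esub> XY k 0 = XY k 0 \<otimes>\<^bsub>Q\<^esub> XY 0 j"
    unfolding XY_eq[of k 0] by (rule XY_central) simp
  have s: "XY i j = XY i 0 \<otimes>\<^bsub>Q\<^esub> XY 0 j" for i j
    by (simp add: XY_def)
  have "XY i j \<otimes>\<^bsub>Q\<^esub> XY k l = XY i 0 \<otimes>\<^bsub>Q\<^esub> (XY 0 j \<otimes>\<^bsub>Q\<^esub> XY k 0) \<otimes>\<^bsub>Q\<^esub> XY 0 l"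
    unfolding s[of i j] s[of k l] by (simp add: hom.H.m_assoc)
  also have "\<dots> = (XY i 0 \<otimes>\<^bsub>Q\<^esub> XY k 0) \<otimes>\<^bsub>Q\<^esub> (XY 0 j \<otimes>\<^bsub>Q\<^esub> XY 0 l)"
    unfolding c by (simp add: hom.H.m_assoc)
  also have "XY i 0 \<otimes>\<^bsub>Q\<^esub> XY k 0 = XY (i + k) 0"
    by (simp add: XY_def hom.H.int_pow_mult)
  also have "XY 0 j \<otimes>\<^bsub>Q\<^esub> XY 0 l = XY 0 (j + l)"
    by (simp add: XY_def hom.H.int_pow_mult)
  finally show ?thesis
    by (simp flip: s)
qed

lemma XY_one [simp]: "XY 0 0 = \<one>\<^bsub>Q\<^esub>"
  by (simp add: XY_def)

lemma XY_nat_pow: "XY i j [^]\<^bsub>Q\<^esub> (n::nat) = XY (i * int n) (j * int n)"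
  by (induction n) (simp_all add: XY_mult algebra_simps)

lemma XY_inv: "inv\<^bsub>Q\<^esub> XY i j = XY (- i) (- j)"
  by (rule hom.H.inv_equality) (simp_all add: XY_mult)

lemma XY_int_pow: "XY i j [^]\<^bsub>Q\<^esub> (n::int) = XY (i * n) (j * n)"
  by (cases n rule: int_cases2) (simp_all add: int_pow_int hom.H.int_pow_neg XY_nat_pow XY_inv)

lemma XY_p_dvd: "int p dvd i \<Longrightarrow> int p dvd j \<Longrightarrow> XY i j = \<one>\<^bsub>Q\<^esub>"
proof -
  have "h [^]\<^bsub>Q\<^esub> (int p * t) = \<one>\<^bsub>Q\<^esub>" if "h \<in> carrier Q" "h [^]\<^bsub>Q\<^esub> p = \<one>\<^bsub>Q\<^esub>" for h t
    using that by (simp add: hom.H.int_pow_pow[symmetric] int_pow_int)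
  then show "int p dvd i \<Longrightarrow> int p dvd j \<Longrightarrow> XY i j = \<one>\<^bsub>Q\<^esub>"
    by (auto simp: XY_def pi_order elim!: dvdE)
qed

text \<open>Both sides are homomorphisms on \<open>H\<close> that are invariant under conjugation in \<open>F2\<close>, and they agree on
  \<open>X\<close> (with norm \<open>X\<^sup>q\<close>) and on \<open>y\<close> (with norm \<open>Y\<close>).\<close>

lemma pi_norm:
  assumes "h \<in> H"
  shows "pi (conj_prod F2 x2 h q) = XY (ex h) (ey h)"
proof -
  let ?K = "{h \<in> H. pi (conj_prod F2 x2 h q) = XY (ex h) (ey h)}"
  have one: "conj_prod F2 x2 \<one>\<^bsub>F2\<^esub> k = \<one>\<^bsub>F2\<^esub>" for k
    by (induction k) auto
  have sub: "subgroup ?K F2"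
  proof (rule F2.subgroupI)
    show "?K \<noteq> {}"
      by (auto intro!: exI[of _ "\<one>\<^bsub>F2\<^esub>"] simp: one)
  next
    fix h assume "h \<in> ?K"
    then have h: "h \<in> H" "pi (conj_prod F2 x2 h q) = XY (ex h) (ey h)"
      by auto
    have "pi (conj_prod F2 x2 (inv\<^bsub>F2\<^esub> h) q) \<otimes>\<^bsub>Q\<^esub> pi (conj_prod F2 x2 h q) = \<one>\<^bsub>Q\<^esub>"
      using pi_conj_prod_mult[of x2 "inv\<^bsub>F2\<^esub> h" h q] h(1) by (simp add: one)
    then have "pi (conj_prod F2 x2 (inv\<^bsub>F2\<^esub> h) q) = inv\<^bsub>Q\<^esub> pi (conj_prod F2 x2 h q)"
      using h by (intro hom.H.inv_equality[symmetric]) auto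
    then show "inv\<^bsub>F2\<^esub> h \<in> ?K"
      using h by (simp add: XY_inv)
  qed (auto simp: pi_conj_prod_mult XY_mult)
  have "?K \<lhd> F2"
  proof (rule subgroup_preserving_conj[OF sub])
    fix h g assume "h \<in> ?K" "g \<in> carrier F2"
    then show "conjugate F2 h g \<in> ?K"
      using pi_conj_prod_conjugate[OF x2_closed X_in_H generate_x_H, of h g] by simp
  qed
  moreover have "X \<in> ?K"
  proof -
    have "conj_prod F2 x2 X q = X [^]\<^bsub>F2\<^esub> q"
      using F2.nat_pow_Suc2[of x2 q] by (intro F2.conj_prod_commuting) simp_all
    then have "pi (conj_prod F2 x2 X q) = XY (int q) 0"
      using pi_int_pow[OF X_in_H, of "int q"] by (simp add: int_pow_int XY_def del: of_nat_power)
    then show ?thesis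
      by simp
  qed
  moreover have "y2 \<in> ?K"
    by (simp add: XY_def)
  ultimately have "H \<subseteq> ?K"
    by (rule H_least)
  then show ?thesis
    using assms by auto
qed

text \<open>If \<open>j\<close> is inverse to the exponent sum in \<open>x\<close> modulo \<open>q\<close>, then \<open>g\<^sup>j = x h\<close> with \<open>h \<in> H\<close>, and
  \<open>(x h)\<^sup>q\<close> is \<open>X\<close> times the norm of \<open>h\<close>. As \<open>j\<close> is prime to \<open>p\<close>, the resulting formula for the \<open>j\<close>-th power
  determines \<open>\<pi>(g\<^sup>q)\<close>.\<close>

lemma pi_pow_q:
  assumes g: "g \<in> carrier F2" and cop: "coprime (ex g) (int q)"
  shows "g [^]\<^bsub>F2\<^esub> q \<in> H" "pi (g [^]\<^bsub>F2\<^esub> q) = XY (ex g) (ey g)"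
proof -
  show gq: "g [^]\<^bsub>F2\<^esub> q \<in> H"
    using g by (intro in_H_if_q_dvd_ex) auto
  \<comment> \<open>For \<open>a = 0\<close> the congruence modulo \<open>q = 1\<close> is void, and \<open>j\<close> must be chosen prime to \<open>p\<close>.\<close>
  obtain j t where j: "j * ex g = 1 + int q * t" and jp: "coprime j (int p)"
  proof (cases "a = 0")
    case True
    then show ?thesis
      using that[of 1 "ex g - 1"] by simp
  next
    case False
    obtain s t where st: "s * ex g + t * int q = 1"
      using bezout_int[of "ex g" "int q"] cop by auto
    have "coprime s (int q)"
      using st by (metis coprimeI dvd_add dvd_mult dvd_mult2)
    then have "coprime s (int p)"
      using False by simp
    then show ?thesis
      using st by (intro that[of s "- t"]) (auto simp: algebra_simps)
  qed
  define k where "k = g [^]\<^bsub>F2\<^esub> j"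
  define h where "h = inv\<^bsub>F2\<^esub> x2 \<otimes>\<^bsub>F2\<^esub> k"
  have k: "k \<in> carrier F2" "ex k = 1 + int q * t" "ey k = j * ey g"
    using g j by (simp_all add: k_def del: of_nat_power)
  have h: "h \<in> H"
    unfolding h_def by (rule in_H_if_q_dvd_ex) (simp_all add: k del: of_nat_power)
  have kh: "k = x2 \<otimes>\<^bsub>F2\<^esub> h"
    using k(1) by (simp add: h_def F2.inv_mult_cancel)
  have "k [^]\<^bsub>F2\<^esub> q = X \<otimes>\<^bsub>F2\<^esub> conj_prod F2 x2 h q"
    unfolding kh using h by (intro F2.mult_pow_conj_prod) auto
  moreover have "k [^]\<^bsub>F2\<^esub> q = (g [^]\<^bsub>F2\<^esub> q) [^]\<^bsub>F2\<^esub> j"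
    using g by (simp add: k_def F2.int_pow_pow int_pow_int[symmetric] mult.commute)
  ultimately have "pi (g [^]\<^bsub>F2\<^esub> q) [^]\<^bsub>Q\<^esub> j = pi X \<otimes>\<^bsub>Q\<^esub> XY (ex h) (ey h)"
    using h gq pi_int_pow[OF gq, of j] by (simp add: pi_mult pi_norm)
  also have "pi X = XY 1 0"
    by (simp add: XY_def)
  also have "XY 1 0 \<otimes>\<^bsub>Q\<^esub> XY (ex h) (ey h) = XY (ex g) (ey g) [^]\<^bsub>Q\<^esub> j"
    using k by (simp add: XY_mult XY_int_pow h_def mult.commute[of _ j] j del: of_nat_power)
  finally have eq: "pi (g [^]\<^bsub>F2\<^esub> q) [^]\<^bsub>Q\<^esub> j = XY (ex g) (ey g) [^]\<^bsub>Q\<^esub> j" .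
  have "XY (ex g) (ey g) [^]\<^bsub>Q\<^esub> p = \<one>\<^bsub>Q\<^esub>"
    unfolding XY_nat_pow by (rule XY_p_dvd) simp_all
  then show "pi (g [^]\<^bsub>F2\<^esub> q) = XY (ex g) (ey g)"
    by (rule hom.H.int_pow_eq_of_coprime[OF pi_closed[OF gq] pi_order[OF gq] XY_closed _ eq jp])
qed

lemma hom_pow_eq_XY:
  assumes "g \<in> carrier F2" "coprime (ex g) (int q)"
  shows "f (g [^]\<^bsub>F2\<^esub> (q * p ^ m)) = XY (ex g) (ey g)"
  using pi_pow_q[OF assms] assms by (simp add: pi_eq F2.nat_pow_pow)

end

section \<open>Finiteness of quotients\<close>

lemma (in comm_group) finite_generate:
  fixes p :: nat
  assumes "finite S" "S \<subseteq> carrier G" and p: "p > 0" and ord: "\<And>z. z \<in> carrier G \<Longrightarrow> z [^] p = \<one>"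
  shows "finite (generate G S)"
  using assms(1,2)
proof (induction S)
  case empty
  then show ?case
    by (simp add: generate_empty)
next
  case (insert s S)
  have "generate G {s} \<subseteq> (\<lambda>i. s [^] i) ` {0..<int p}"
  proof
    fix z assume "z \<in> generate G {s}"
    then obtain k :: int where k: "z = s [^] k"
      using generate_pow[of s] insert by auto
    have "s [^] k = s [^] (int p * (k div int p) + k mod int p)"
      by simp
    also have "\<dots> = (s [^] int p) [^] (k div int p) \<otimes> s [^] (k mod int p)"
      using insert by (simp only: int_pow_mult int_pow_pow insert_subset)
    also have "\<dots> = s [^] (k mod int p)"
      using insert ord by (simp add: int_pow_int)
    finally show "z \<in> (\<lambda>i. s [^] i) ` {0..<int p}"
      using k p by auto
  qed
  then have "finite (generate G {s})"
    by (rule finite_subset) simp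
  moreover have "generate G (insert s S) \<subseteq> generate G {s} <#> generate G S"
  proof (rule generate_subgroup_incl)
    have sub: "subgroup (generate G {s}) G" "subgroup (generate G S) G"
      using insert by (auto intro!: generate_is_subgroup)
    then show "subgroup (generate G {s} <#> generate G S) G"
      by (rule mult_subgroups)
    have "s \<in> generate G {s} <#> generate G S"
      using set_multI[of s "generate G {s}" \<one> "generate G S" G] insert
      by (auto intro: generate.incl generate.one)
    moreover have "t \<in> generate G {s} <#> generate G S" if "t \<in> S" for t
      using set_multI[of \<one> "generate G {s}" t "generate G S" G] that insert
        generate.incl[of t S G] generate.one[of G "{s}"] by (auto simp: subsetD)
    ultimately show "insert s S \<subseteq> generate G {s} <#> generate G S"
      by blast
  qed
  moreover have "finite (M <#> N)" if "finite M" "finite N" for M N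
    using that by (auto simp: set_mult_def)
  ultimately show ?case
    using insert by (meson finite_subset insert_subset)
qed

lemma (in group) coset_eq_mono:
  assumes "subgroup N G" "subgroup M G" "N \<subseteq> M" "a \<in> carrier G" "b \<in> carrier G" "N #> a = N #> b"
  shows "M #> a = M #> b"
proof -
  obtain z where z: "z \<in> N" "a = z \<otimes> b"
    using coset_eqD[OF assms(1,4-6)] by auto
  then have "z \<in> M" "z \<in> carrier G"
    using assms subgroup.mem_carrier by auto
  then show ?thesis
    using assms z coset_mult_assoc[of M z b] coset_join2[of z M] subgroup.subset[of M G] by simp
qed

lemma (in group) finite_factor_mono:
  assumes "subgroup N G" "subgroup M G" "N \<subseteq> M" "finite (carrier (G Mod N))"
  shows "finite (carrier (G Mod M))"
proof -
  have fin: "finite ((#>) N ` carrier G)"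
    using assms(4) by (simp add: carrier_FactGroup)
  obtain C where C: "finite C" "C \<subseteq> carrier G" "(#>) N ` C = (#>) N ` carrier G"
    using finite_subset_image[OF fin subset_refl] by metis
  have "(#>) M ` carrier G \<subseteq> (#>) M ` C"
  proof
    fix z assume "z \<in> (#>) M ` carrier G"
    then obtain g where g: "g \<in> carrier G" "z = M #> g"
      by auto
    then obtain c where c: "c \<in> C" "N #> g = N #> c"
      using C(3) by (metis imageE imageI)
    then have "M #> g = M #> c"
      using coset_eq_mono[OF assms(1-3) g(1) _ c(2)] C(2) c(1) by auto
    then show "z \<in> (#>) M ` C"
      unfolding g(2) using c(1) by (rule image_eqI)
  qed
  then show ?thesis
    unfolding carrier_FactGroup using C(1) by (rule finite_subset[OF _ finite_imageI])
qed

text \<open>Schreier's argument: for a finite transversal \<open>T\<close> of \<open>K\<close> containing \<open>1\<close>, the finitely many \<open>K\<close>-parts of the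
  products \<open>t s\<close>, with \<open>s\<close> a generator or its inverse, generate a subgroup \<open>B \<le> K\<close> with \<open>B T = G\<close>. The image of \<open>B\<close>
  modulo \<open>N\<close> is a finitely generated abelian group of exponent \<open>p\<close>, hence finite.\<close>

lemma (in group) finite_factor_step:
  fixes p :: nat
  assumes N: "N \<lhd> G" and K: "K \<lhd> G" and comm: "\<And>u v. u \<in> K \<Longrightarrow> v \<in> K \<Longrightarrow> commutator G u v \<in> N"
    and pow: "\<And>u. u \<in> K \<Longrightarrow> u [^] p \<in> N" and p: "p > 0" and fin: "finite (carrier (G Mod K))"
    and S: "finite S" "S \<subseteq> carrier G" "generate G S = carrier G"
  shows "finite (carrier (G Mod N))"
proof -
  interpret N: normal N G by fact
  interpret K: normal K G by fact
  let ?Q = "G Mod N"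
  define f where "f = (#>) N"
  interpret f: group_hom G ?Q f
    unfolding f_def by (rule N.quotient_hom)
  have one: "f a = \<one>\<^bsub>?Q\<^esub>" if "a \<in> N" for a
    using that unfolding f_def by (subst N.coset_eq_one_iff) auto
  have "finite ((#>) K ` carrier G)"
    using fin by (simp add: carrier_FactGroup)
  then obtain T0 where T0: "finite T0" "T0 \<subseteq> carrier G" "(#>) K ` T0 = (#>) K ` carrier G"
    using finite_subset_image[OF _ subset_refl] by metis
  define T where "T = insert \<one> T0"
  have T: "finite T" "T \<subseteq> carrier G" "\<one> \<in> T"
    using T0 by (auto simp: T_def)
  have ex: "\<exists>b t. b \<in> K \<and> t \<in> T \<and> g = b \<otimes> t" if g: "g \<in> carrier G" for g
  proof -
    obtain t where t: "t \<in> T0" "K #> g = K #> t"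
      using T0(3) g by (metis imageE imageI)
    then obtain z where "z \<in> K" "g = z \<otimes> t"
      using coset_eqD[OF K.subgroup_axioms g] T0(2) by blast
    then show ?thesis
      using t by (auto simp: T_def)
  qed
  then obtain b t where bt: "\<And>g. g \<in> carrier G \<Longrightarrow> b g \<in> K \<and> t g \<in> T \<and> g = b g \<otimes> t g"
    by metis
  define S' where "S' = S \<union> m_inv G ` S"
  have S': "finite S'" "S' \<subseteq> carrier G"
    using S by (auto simp: S'_def)
  define D where "D = (\<lambda>(t, s). b (t \<otimes> s)) ` (T \<times> S')"
  have bK: "b (v \<otimes> s) \<in> K" if "v \<in> T" "s \<in> S'" for v s
    using bt[OF m_closed[OF subsetD[OF T(2) that(1)] subsetD[OF S'(2) that(2)]]] by simp
  have D: "finite D" "D \<subseteq> K"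
    using T(1) S'(1) bK by (auto simp: D_def)
  define B where "B = generate G D"
  have BK: "B \<subseteq> K"
    unfolding B_def by (rule generate_subgroup_incl[OF D(2) K.subgroup_axioms])
  have B: "subgroup B G"
    unfolding B_def using D K.subset by (intro generate_is_subgroup) auto
  note Bc = subgroup.mem_carrier[OF B]
  have step: "z \<otimes> s \<in> B <#> T" if z: "z \<in> B <#> T" and s: "s \<in> S'" for z s
  proof -
    obtain u v where uv: "z = u \<otimes> v" "u \<in> B" "v \<in> T"
      using z by (rule set_multE)
    have sc: "s \<in> carrier G" "v \<in> carrier G"
      using s S' uv T by auto
    have "b (v \<otimes> s) \<in> B"
      unfolding B_def using uv s by (intro generate.incl) (auto simp: D_def)
    moreover have "z \<otimes> s = (u \<otimes> b (v \<otimes> s)) \<otimes> t (v \<otimes> s)"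
    proof -
      have vs: "b (v \<otimes> s) \<in> K" "t (v \<otimes> s) \<in> T" "v \<otimes> s = b (v \<otimes> s) \<otimes> t (v \<otimes> s)"
        using bt[of "v \<otimes> s"] sc by auto
      have "z \<otimes> s = u \<otimes> (v \<otimes> s)"
        using uv(1) Bc[OF uv(2)] sc by (simp add: m_assoc)
      also have "\<dots> = u \<otimes> (b (v \<otimes> s) \<otimes> t (v \<otimes> s))"
        using vs(3) by simp
      also have "\<dots> = (u \<otimes> b (v \<otimes> s)) \<otimes> t (v \<otimes> s)"
        using Bc[OF uv(2)] K.mem_carrier[OF vs(1)] subsetD[OF T(2) vs(2)] by (simp add: m_assoc)
      finally show ?thesis .
    qed
    ultimately show ?thesis
      using uv sc bt[of "v \<otimes> s"] by (simp add: set_multI subgroup.m_closed[OF B])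
  qed
  have BT: "B <#> T \<subseteq> carrier G"
    using Bc T by (auto elim!: set_multE)
  have all: "g \<in> generate G S \<Longrightarrow> \<forall>z\<in>B <#> T. z \<otimes> g \<in> B <#> T" for g
  proof (induction rule: generate.induct)
    case one
    then show ?case
      using BT by auto
  next
    case (incl h)
    then show ?case
      using step by (auto simp: S'_def)
  next
    case (inv h)
    then show ?case
      using step by (auto simp: S'_def)
  next
    case (eng h1 h2)
    then have "h1 \<in> carrier G" "h2 \<in> carrier G"
      using S by auto
    then show ?case
      using eng BT by (auto simp flip: m_assoc)
  qed
  have one_BT: "\<one> \<in> B <#> T"
    using set_multI[of \<one> B \<one> T G] T subgroup.one_closed[OF B] by simp
  have "carrier G \<subseteq> B <#> T"
  proof
    fix g assume g: "g \<in> carrier G"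
    then show "g \<in> B <#> T"
      using all[of g] one_BT S(3) l_one[OF g] by metis
  qed
  then have "f ` carrier G \<subseteq> f ` (B <#> T)"
    by (rule image_mono)
  also have "\<dots> \<subseteq> (\<lambda>(u, v). u \<otimes>\<^bsub>?Q\<^esub> v) ` (f ` B \<times> f ` T)"
  proof
    fix z assume "z \<in> f ` (B <#> T)"
    then obtain u v where uv: "u \<in> B" "v \<in> T" "z = f (u \<otimes> v)"
      by (auto elim!: set_multE)
    then have "z = f u \<otimes>\<^bsub>?Q\<^esub> f v"
      using Bc subsetD[OF T(2)] by simp
    then show "z \<in> (\<lambda>(u, v). u \<otimes>\<^bsub>?Q\<^esub> v) ` (f ` B \<times> f ` T)"
      using uv by auto
  qed
  finally have sub: "carrier ?Q \<subseteq> (\<lambda>(u, v). u \<otimes>\<^bsub>?Q\<^esub> v) ` (f ` B \<times> f ` T)"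
    by (simp add: carrier_FactGroup f_def)
  have fK: "subgroup (f ` K) ?Q"
    by (rule f.subgroup_img_is_subgroup[OF K.subgroup_axioms])
  let ?C = "?Q\<lparr>carrier := f ` K\<rparr>"
  interpret C: comm_group ?C
  proof (rule group.group_comm_groupI)
    show "group ?C"
      using subgroup.subgroup_is_group[OF fK f.H.is_group] .
    show "x \<otimes>\<^bsub>?C\<^esub> y = y \<otimes>\<^bsub>?C\<^esub> x" if "x \<in> carrier ?C" "y \<in> carrier ?C" for x y
    proof -
      obtain u v where uv: "u \<in> K" "v \<in> K" "x = f u" "y = f v"
        using \<open>x \<in> carrier ?C\<close> \<open>y \<in> carrier ?C\<close> by auto
      then have "f u \<otimes>\<^bsub>?Q\<^esub> f v = f v \<otimes>\<^bsub>?Q\<^esub> f u"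
        using comm[of u v] by (subst f.hom_commute_iff) (simp_all add: one)
      then show ?thesis
        using uv by simp
    qed
  qed
  have "finite (generate ?C (f ` D))"
  proof (rule C.finite_generate[OF _ _ p])
    fix z assume "z \<in> carrier ?C"
    then obtain u where "u \<in> K" "z = f u"
      by auto
    then show "z [^]\<^bsub>?C\<^esub> p = \<one>\<^bsub>?C\<^esub>"
      using one[OF pow[of u]] f.hom_nat_pow[of u p] by (simp flip: f.H.nat_pow_consistent)
  qed (use D in auto)
  moreover have "generate ?C (f ` D) = f ` B"
    unfolding B_def
    by (simp add: f.H.generate_consistent[OF image_mono[OF D(2)] fK] f.generate_img[OF subset_trans[OF D(2) K.subset]])
  ultimately have "finite (f ` B)"
    by simp
  then show ?thesis
    by (rule finite_subset[OF sub finite_imageI[OF finite_cartesian_product[OF _ finite_imageI[OF T(1)]]]])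
qed

context H_series
begin

lemma finite_factor_H: "finite (carrier (F2 Mod H))"
proof -
  interpret N: normal H F2
    by (rule H_normal)
  define f where "f = (#>\<^bsub>F2\<^esub>) H"
  interpret f: group_hom F2 "F2 Mod H" f
    unfolding f_def by (rule N.quotient_hom)
  have one: "f h = \<one>\<^bsub>F2 Mod H\<^esub>" if "h \<in> H" for h
    using that unfolding f_def by (subst N.coset_eq_one_iff) auto
  have "f ` carrier F2 \<subseteq> (\<lambda>i. f x2 [^]\<^bsub>F2 Mod H\<^esub> i) ` {0..<int q}"
  proof
    fix z assume "z \<in> f ` carrier F2"
    then obtain g where g: "g \<in> carrier F2" "z = f g"
      by auto
    have "z = f (x2 [^]\<^bsub>F2\<^esub> ex g \<otimes>\<^bsub>F2\<^esub> (x2 [^]\<^bsub>F2\<^esub> (- ex g) \<otimes>\<^bsub>F2\<^esub> g))"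
      using g by (simp add: F2.int_pow_neg F2.inv_mult_cancel)
    also have "\<dots> = f (x2 [^]\<^bsub>F2\<^esub> ex g)"
      using g one[OF x_part_in_H[OF g(1)]] by (simp only: f.hom_mult F2.int_pow_closed F2.m_closed x2_closed) simp
    also have "x2 [^]\<^bsub>F2\<^esub> ex g = x2 [^]\<^bsub>F2\<^esub> (int q * (ex g div int q) + ex g mod int q)"
      by simp
    also have "\<dots> = X [^]\<^bsub>F2\<^esub> (ex g div int q) \<otimes>\<^bsub>F2\<^esub> x2 [^]\<^bsub>F2\<^esub> (ex g mod int q)"
      by (simp only: F2.int_pow_mult F2.int_pow_pow x2_closed int_pow_int[symmetric])
    also have "f \<dots> = f x2 [^]\<^bsub>F2 Mod H\<^esub> (ex g mod int q)"
      by (simp add: one f.hom_int_pow del: of_nat_power)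
    finally show "z \<in> (\<lambda>i. f x2 [^]\<^bsub>F2 Mod H\<^esub> i) ` {0..<int q}"
      by (rule image_eqI) (simp del: of_nat_power)
  qed
  then have "finite (f ` carrier F2)"
    by (rule finite_subset) simp
  then show ?thesis
    by (simp add: carrier_FactGroup f_def)
qed

lemma finite_factor_P: "finite (carrier (F2 Mod P (Suc k)))"
proof (induction k)
  case 0
  then show ?case
    using finite_factor_H by simp
next
  case (Suc k)
  show ?case
  proof (rule F2.finite_factor_step[OF P_normal P_normal _ _ p_pos Suc _ _ F2_generated])
    show "commutator F2 u v \<in> P (Suc (Suc k))" if "u \<in> P (Suc k)" "v \<in> P (Suc k)" for u v
      using that P_subset_A commutator_in_P[of "Suc k" u v] by auto
    show "u [^]\<^bsub>F2\<^esub> p \<in> P (Suc (Suc k))" if "u \<in> P (Suc k)" for u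
      using that pow_in_P[of "Suc k" u] by auto
  qed auto
qed

lemma finite_factor: "W \<lhd> F2 \<Longrightarrow> U m \<subseteq> W \<Longrightarrow> finite (carrier (F2 Mod W))"
  using F2.finite_factor_mono[OF P_subgroup normal_imp_subgroup _ finite_factor_P, of W "m + 2"] P_subset_U[of m]
  by (auto simp: numeral_3_eq_3)

end

section \<open>Trivial intersections of cyclic subgroups\<close>

text \<open>If a conjugate of \<open>t1\<^sup>i\<close> equals \<open>t2\<^sup>j\<close>, then raising this equation to suitable powers of \<open>p\<close> shows one after the
  other that \<open>p, p\<^sup>2, \<dots>, p\<^sup>k\<^sup>+\<^sup>1\<close> divide \<open>i\<close> and \<open>j\<close>.\<close>

lemma (in group) trivial_intersection:
  fixes p k :: nat
  assumes c: "t1 \<in> carrier G" "t2 \<in> carrier G" "g \<in> carrier G"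
    and ord: "t1 [^] (p ^ Suc k) = \<one>"
    and indep: "\<And>c1 c2. conjugate G (t1 [^] (int (p ^ k) * c1)) g = t2 [^] (int (p ^ k) * c2) \<Longrightarrow>
      int p dvd c1 \<and> int p dvd c2"
  shows "(\<lambda>z. conjugate G z g) ` generate G {t1} \<inter> generate G {t2} = {\<one>}"
proof -
  interpret cj: group_hom G G "\<lambda>z. conjugate G z g"
    by (rule conjugate_hom[OF c(3)])
  have triv: "conjugate G (t1 [^] i) g = \<one>" if eq: "conjugate G (t1 [^] i) g = t2 [^] j" for i j :: int
  proof -
    have "int (p ^ l) dvd i \<and> int (p ^ l) dvd j" if "l \<le> Suc k" for l
      using that
    proof (induction l)
      case (Suc l)
      then obtain c1 c2 where c12: "i = int (p ^ l) * c1" "j = int (p ^ l) * c2"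
        by (auto elim!: dvdE)
      have k: "int (p ^ k) = int (p ^ l) * int (p ^ (k - l))"
        using Suc.prems by (simp flip: power_add of_nat_power of_nat_mult)
      have "conjugate G (t1 [^] (int (p ^ k) * c1)) g = conjugate G (t1 [^] i) g [^] int (p ^ (k - l))"
        using c cj.hom_int_pow[of "t1 [^] i" "int (p ^ (k - l))"]
        by (simp add: int_pow_pow c12 k mult_ac del: of_nat_power)
      also have "\<dots> = t2 [^] (int (p ^ k) * c2)"
        unfolding eq using c by (simp add: int_pow_pow c12 k mult_ac del: of_nat_power)
      finally show ?case
        using indep[of c1 c2] by (auto simp: c12 mult.commute)
    qed simp
    then obtain d where "i = int (p ^ Suc k) * d"
      by (meson dvdE order_refl)
    then have "t1 [^] i = (t1 [^] (p ^ Suc k)) [^] d"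
      using c by (simp only: int_pow_pow int_pow_int[symmetric])
    then show ?thesis
      using ord c by simp
  qed
  have gen: "generate G {t} = range (\<lambda>i::int. t [^] i)" if "t \<in> carrier G" for t
    using generate_pow[OF that] by auto
  have "conjugate G \<one> g \<in> (\<lambda>z. conjugate G z g) ` generate G {t1}"
    by (intro imageI generate.one)
  then have "\<one> \<in> (\<lambda>z. conjugate G z g) ` generate G {t1} \<inter> generate G {t2}"
    using c(3) generate.one[of G "{t2}"] by simp
  moreover have "z = \<one>" if "z \<in> (\<lambda>z. conjugate G z g) ` generate G {t1} \<inter> generate G {t2}" for z
    using that triv unfolding gen[OF c(1)] gen[OF c(2)] by auto
  ultimately show ?thesis
    by blast
qed

context H_series
begin

lemma V_sub_eq: "V_sub p a (m + 1) = generate F2 {X [^]\<^bsub>F2\<^esub> (p ^ m), Y [^]\<^bsub>F2\<^esub> (p ^ m)} <#>\<^bsub>F2\<^esub> U m"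
  using U_sub_eq[of m]
  by (simp add: V_sub_def y_conj_prod_eq F2.nat_pow_pow power_add numeral_2_eq_2)

lemma factor_H_power_hom:
  assumes "N \<lhd> F2" "U m \<subseteq> N"
  shows "H_power_hom p a (F2 Mod N) ((#>\<^bsub>F2\<^esub>) N) m"
proof -
  interpret N: normal N F2
    by (rule assms)
  have "p_power_hom F2 p H (F2 Mod N) ((#>\<^bsub>F2\<^esub>) N) m"
  proof (intro p_power_hom.intro p_power_hom_axioms.intro N.quotient_hom p_central_series_axioms)
    show "N #>\<^bsub>F2\<^esub> u = \<one>\<^bsub>F2 Mod N\<^esub>" if "u \<in> U m" for u
      using that assms(2) by (subst N.coset_eq_one_iff) auto
  qed
  then show ?thesis
    by (intro H_power_hom.intro H_series_axioms)
qed

text \<open>The powers of \<open>g1\<close> and \<open>g2\<close> to the exponent \<open>q p\<^sup>k\<close> are compared modulo \<open>M\<close>, where they are central with known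
  coordinates. The choice is \<open>M = W\<close> when \<open>W\<close> meets \<open>V m\<close> only in \<open>U m\<close>, and a term of the \<open>p\<close>-central series one level lower
  when \<open>W\<close> contains \<open>V m\<close>, because then the plane is already zero modulo \<open>W\<close>.\<close>

lemma independent_pair_trivial_intersection:
  assumes W: "W \<lhd> F2" and M: "M \<lhd> F2" "U k \<subseteq> M" and WM: "W \<subseteq> M"
    and indep: "\<And>i j. X [^]\<^bsub>F2\<^esub> (i * int p ^ k) \<otimes>\<^bsub>F2\<^esub> Y [^]\<^bsub>F2\<^esub> (j * int p ^ k) \<in> M \<Longrightarrow> int p dvd i \<and> int p dvd j"
    and g: "g1 \<in> carrier F2" "g2 \<in> carrier F2" "g \<in> carrier F2"
    and cop: "coprime (ex g1) (int q)" "coprime (ex g2) (int q)"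
    and pow: "g1 [^]\<^bsub>F2\<^esub> (q * p ^ Suc k) \<in> W"
    and det: "\<not> int p dvd ex g1 * ey g2 - ey g1 * ex g2"
  shows "(\<lambda>z. conjugate (F2 Mod W) z (W #>\<^bsub>F2\<^esub> g)) ` generate (F2 Mod W) {W #>\<^bsub>F2\<^esub> g1}
    \<inter> generate (F2 Mod W) {W #>\<^bsub>F2\<^esub> g2} = {\<one>\<^bsub>F2 Mod W\<^esub>}"
proof -
  interpret W: normal W F2
    by (rule W)
  interpret M: normal M F2
    by (rule M)
  define Q where "Q = F2 Mod W"
  define f where "f = (#>\<^bsub>F2\<^esub>) W"
  interpret f: group_hom F2 Q f
    unfolding f_def Q_def by (rule W.quotient_hom)
  define R where "R = F2 Mod M"
  define h where "h = (#>\<^bsub>F2\<^esub>) M"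
  interpret h: H_power_hom p a R h k
    unfolding h_def R_def by (rule factor_H_power_hom[OF M])
  have eqD: "h u = h v" if "f u = f v" "u \<in> carrier F2" "v \<in> carrier F2" for u v
    using F2.coset_eq_mono[OF W.subgroup_axioms M.subgroup_axioms WM that(2,3)] that(1)
    by (simp add: h_def f_def)
  have hpow: "h (u [^]\<^bsub>F2\<^esub> (int (p ^ (a + k)) * c)) = h.XY (ex u * c) (ey u * c)"
    if "u \<in> carrier F2" "coprime (ex u) (int q)" for u c
  proof -
    have "u [^]\<^bsub>F2\<^esub> (int (p ^ (a + k)) * c) = (u [^]\<^bsub>F2\<^esub> (q * p ^ k)) [^]\<^bsub>F2\<^esub> c"
      using that by (simp only: F2.int_pow_pow power_add int_pow_int[symmetric])
    then show ?thesis
      using that h.hom_pow_eq_XY[OF that] by (simp add: h.hom.hom_int_pow h.XY_int_pow)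
  qed
  have "(\<lambda>z. conjugate Q z (f g)) ` generate Q {f g1} \<inter> generate Q {f g2} = {\<one>\<^bsub>Q\<^esub>}"
  proof (rule f.H.trivial_intersection[where p = p and k = "a + k"])
    have "f (g1 [^]\<^bsub>F2\<^esub> (q * p ^ Suc k)) = \<one>\<^bsub>Q\<^esub>"
      using pow g unfolding f_def Q_def by (subst W.coset_eq_one_iff) auto
    then show "f g1 [^]\<^bsub>Q\<^esub> (p ^ Suc (a + k)) = \<one>\<^bsub>Q\<^esub>"
      using g by (simp add: f.hom_nat_pow power_add mult_ac)
  next
    fix c1 c2
    define u1 where "u1 = g1 [^]\<^bsub>F2\<^esub> (int (p ^ (a + k)) * c1)"
    define u2 where "u2 = g2 [^]\<^bsub>F2\<^esub> (int (p ^ (a + k)) * c2)"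
    assume "conjugate Q (f g1 [^]\<^bsub>Q\<^esub> (int (p ^ (a + k)) * c1)) (f g) = f g2 [^]\<^bsub>Q\<^esub> (int (p ^ (a + k)) * c2)"
    then have "f (conjugate F2 u1 g) = f u2"
      using g by (simp add: u1_def u2_def conjugate_def f.hom_int_pow)
    then have "h (conjugate F2 u1 g) = h u2"
      by (rule eqD) (use g in \<open>auto simp: u1_def u2_def\<close>)
    then have "conjugate R (h u1) (h g) = h u2"
      using g by (simp add: u1_def conjugate_def)
    moreover have "conjugate R (h u1) (h g) = h u1"
      using g h.XY_central[of g] by (intro h.hom.H.conjugate_commuting) (simp_all add: u1_def hpow cop del: of_nat_power)
    ultimately have "h.XY (ex g1 * c1) (ey g1 * c1) = h.XY (ex g2 * c2) (ey g2 * c2)"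
      using hpow[OF g(1) cop(1), of c1] hpow[OF g(2) cop(2), of c2] by (simp add: u1_def u2_def)
    then have "h.XY (ex g1 * c1) (ey g1 * c1) \<otimes>\<^bsub>R\<^esub> h.XY (- (ex g2 * c2)) (- (ey g2 * c2)) = \<one>\<^bsub>R\<^esub>"
      by (simp add: h.XY_mult)
    then have "h.XY (ex g1 * c1 - ex g2 * c2) (ey g1 * c1 - ey g2 * c2) = \<one>\<^bsub>R\<^esub>"
      by (simp add: h.XY_mult)
    then have "X [^]\<^bsub>F2\<^esub> ((ex g1 * c1 - ex g2 * c2) * int p ^ k)
      \<otimes>\<^bsub>F2\<^esub> Y [^]\<^bsub>F2\<^esub> ((ey g1 * c1 - ey g2 * c2) * int p ^ k) \<in> M"
      unfolding h.XY_eq unfolding h_def R_def by (subst (asm) M.coset_eq_one_iff) auto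
    then have d: "int p dvd ex g1 * c1 - ex g2 * c2" "int p dvd ey g1 * c1 - ey g2 * c2"
      using indep by auto
    have "int p dvd ey g2 * (ex g1 * c1 - ex g2 * c2) - ex g2 * (ey g1 * c1 - ey g2 * c2)"
      "int p dvd ey g1 * (ex g1 * c1 - ex g2 * c2) - ex g1 * (ey g1 * c1 - ey g2 * c2)"
      by (rule dvd_diff[OF dvd_mult[OF d(1)] dvd_mult[OF d(2)]])+
    then have "int p dvd (ex g1 * ey g2 - ey g1 * ex g2) * c1" "int p dvd (ex g1 * ey g2 - ey g1 * ex g2) * c2"
      by (simp_all add: algebra_simps)
    moreover have "Factorial_Ring.prime (int p)"
      using p_prime by simp
    ultimately show "int p dvd c1 \<and> int p dvd c2"
      using det by (simp add: prime_dvd_mult_iff)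
  qed (use g in auto)
  then show ?thesis
    by (simp add: f_def Q_def)
qed

text \<open>The formula for powers does not apply to \<open>y\<close>. Suppose a conjugate of \<open>y\<^sup>i\<close> equals \<open>t\<^sup>j\<close> modulo \<open>W\<close>. Exponent sums in
  \<open>x\<close> show that \<open>q p\<^sup>m\<close> divides \<open>j\<close>. If this power of \<open>t\<close> is not trivial, exponent sums in \<open>y\<close> show that \<open>p\<^sup>m\<close>
  divides \<open>i\<close>, so a conjugate of \<open>\<pi>(y)\<^sup>d\<close> is a central element of the plane. Its norm is on the one hand \<open>\<pi>(Y)\<^sup>d\<close>,
  on the other hand a \<open>q\<close>-th power and so trivial, since \<open>p\<close> divides \<open>q\<close>. Hence \<open>p\<close> divides \<open>d\<close>.\<close>

lemma y_trivial_intersection: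
  assumes W: "W \<lhd> F2" and UW: "U m \<subseteq> W" and WP: "W \<subseteq> P (m + 1)" and a: "a \<ge> 1"
    and cases: "t [^]\<^bsub>F2\<^esub> (q * p ^ m) \<in> W \<or>
      (\<forall>i j. X [^]\<^bsub>F2\<^esub> (i * int p ^ m) \<otimes>\<^bsub>F2\<^esub> Y [^]\<^bsub>F2\<^esub> (j * int p ^ m) \<in> W \<longrightarrow> int p dvd j)"
    and t: "t \<in> carrier F2" and g: "g \<in> carrier F2"
    and cop: "coprime (ex t) (int q)"
  shows "(\<lambda>z. conjugate (F2 Mod W) z (W #>\<^bsub>F2\<^esub> g)) ` generate (F2 Mod W) {W #>\<^bsub>F2\<^esub> y2}
    \<inter> generate (F2 Mod W) {W #>\<^bsub>F2\<^esub> t} = {\<one>\<^bsub>F2 Mod W\<^esub>}"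
proof -
  interpret W: normal W F2
    by (rule W)
  define Q where "Q = F2 Mod W"
  define f where "f = (#>\<^bsub>F2\<^esub>) W"
  interpret f: H_power_hom p a Q f m
    unfolding f_def Q_def by (rule factor_H_power_hom[OF W UW])
  have f_eq_one: "f u = \<one>\<^bsub>Q\<^esub> \<longleftrightarrow> u \<in> W" if "u \<in> carrier F2" for u
    using that unfolding f_def Q_def by (rule W.coset_eq_one_iff)
  have tpow: "f (t [^]\<^bsub>F2\<^esub> (int (q * p ^ m) * c)) = f.XY (ex t * c) (ey t * c)" for c
  proof -
    have "t [^]\<^bsub>F2\<^esub> (int (q * p ^ m) * c) = (t [^]\<^bsub>F2\<^esub> (q * p ^ m)) [^]\<^bsub>F2\<^esub> c"
      using t by (simp only: F2.int_pow_pow int_pow_int[symmetric])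
    then show ?thesis
      using t f.hom_pow_eq_XY[OF t cop] by (simp add: f.hom.hom_int_pow f.XY_int_pow)
  qed
  define h where "h = conjugate F2 y2 g"
  have h: "h \<in> H" "ex h = 0" "ey h = 1"
    using g by (auto simp: h_def)
  have triv: "f t [^]\<^bsub>Q\<^esub> j = \<one>\<^bsub>Q\<^esub>" if eq: "f h [^]\<^bsub>Q\<^esub> i = f t [^]\<^bsub>Q\<^esub> j" for i j :: int
  proof -
    have "W #>\<^bsub>F2\<^esub> (h [^]\<^bsub>F2\<^esub> i) = W #>\<^bsub>F2\<^esub> (t [^]\<^bsub>F2\<^esub> j)"
      using eq h t by (simp add: f_def f.hom.hom_int_pow flip: f_def)
    then obtain w where w: "w \<in> W" "h [^]\<^bsub>F2\<^esub> i = w \<otimes>\<^bsub>F2\<^esub> t [^]\<^bsub>F2\<^esub> j"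
      using F2.coset_eqD[OF W.subgroup_axioms, of "h [^]\<^bsub>F2\<^esub> i" "t [^]\<^bsub>F2\<^esub> j"] h t by auto
    then have wP: "w \<in> P (m + 1)"
      using WP by auto
    then have wc: "w \<in> H"
      using P_subset_A by auto
    have "ex (h [^]\<^bsub>F2\<^esub> i) = ex w + j * ex t"
      unfolding w(2) using t by simp
    then have "ex w = - (j * ex t)"
      using h by simp
    then have "int q * int p ^ m dvd j * ex t"
      using ex_on_P[OF wP] by simp
    moreover have "coprime (int q * int p ^ m) (ex t)"
      using cop a by (simp add: coprime_commute)
    ultimately have "int (q * p ^ m) dvd j"
      by (simp add: coprime_dvd_mult_left_iff)
    then obtain c where c: "j = int (q * p ^ m) * c"
      by (elim dvdE)
    have tj: "f t [^]\<^bsub>Q\<^esub> j = f.XY (ex t * c) (ey t * c)"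
      using tpow[of c] t by (simp add: c f.hom.hom_int_pow)
    show ?thesis
      using cases
    proof
      assume "t [^]\<^bsub>F2\<^esub> (q * p ^ m) \<in> W"
      then have "f.XY (ex t) (ey t) = \<one>\<^bsub>Q\<^esub>"
        unfolding f.hom_pow_eq_XY[OF t cop, symmetric] by (subst f_eq_one) (use t in simp_all)
      then have "f.XY (ex t) (ey t) [^]\<^bsub>Q\<^esub> c = \<one>\<^bsub>Q\<^esub>"
        by simp
      then show ?thesis
        unfolding tj f.XY_int_pow .
    next
      assume ind: "\<forall>i j. X [^]\<^bsub>F2\<^esub> (i * int p ^ m) \<otimes>\<^bsub>F2\<^esub> Y [^]\<^bsub>F2\<^esub> (j * int p ^ m) \<in> W \<longrightarrow> int p dvd j"
      have ey_P: "int p ^ m dvd ey u" if "u \<in> P (m + 1)" for u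
        using that by (rule additive_dvd_on_P[rotated]) simp
      have "ey (h [^]\<^bsub>F2\<^esub> i) = ey w + j * ey t"
        unfolding w(2) using t wc by simp
      then have "i = ey w + int p ^ m * (int q * c * ey t)"
        using h by (simp add: c mult_ac)
      then have "int p ^ m dvd i"
        using ey_P[OF wP] by simp
      then obtain d where d: "i = int (p ^ m) * d"
        by auto
      have "f h [^]\<^bsub>Q\<^esub> i = f.pi (h [^]\<^bsub>F2\<^esub> d)"
        using h by (simp add: d f.pi_def f.hom.hom_int_pow f.hom.H.int_pow_pow int_pow_int[symmetric]
            mult.commute del: of_nat_power)
      then have pih: "f.pi (h [^]\<^bsub>F2\<^esub> d) = f.XY (ex t * c) (ey t * c)"
        using eq tj by simp
      define z where "z = h [^]\<^bsub>F2\<^esub> d"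
      have z: "z \<in> H" "ex z = 0" "ey z = d"
        using h by (simp_all add: z_def)
      have "f.pi (conj_prod F2 x2 z l) = f.pi z [^]\<^bsub>Q\<^esub> l" for l :: nat
      proof (induction l)
        case (Suc l)
        have "f.pi (conjugate F2 z (x2 [^]\<^bsub>F2\<^esub> l)) = f.pi z"
          using z f.XY_central[of "x2 [^]\<^bsub>F2\<^esub> l" "ex t * c" "ey t * c"] pih
          by (simp add: f.pi_conjugate f.hom.H.conjugate_commuting flip: z_def)
        then show ?case
          using z Suc by (simp add: f.pi_mult f.hom.H.nat_pow_Suc2[symmetric])
      qed simp
      then have "f.XY 0 d = f.pi z [^]\<^bsub>Q\<^esub> q"
        using f.pi_norm[OF z(1)] z by simp
      also have "\<dots> = f.XY (ex t * c * int q) (ey t * c * int q)"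
        unfolding z_def pih f.XY_nat_pow ..
      also have "\<dots> = \<one>\<^bsub>Q\<^esub>"
        using a by (intro f.XY_p_dvd) (auto intro!: dvd_mult simp: dvd_power)
      finally have "X [^]\<^bsub>F2\<^esub> (0 * int p ^ m) \<otimes>\<^bsub>F2\<^esub> Y [^]\<^bsub>F2\<^esub> (d * int p ^ m) \<in> W"
        unfolding f.XY_eq by (subst (asm) f_eq_one) auto
      then have "int p dvd d"
        using ind by blast
      then obtain e where "d = int p * e"
        by (elim dvdE)
      then have "f.pi (h [^]\<^bsub>F2\<^esub> d) = (f.pi h [^]\<^bsub>Q\<^esub> p) [^]\<^bsub>Q\<^esub> e"
        using h by (simp add: f.pi_int_pow f.hom.H.int_pow_pow int_pow_int[symmetric])
      also have "\<dots> = \<one>\<^bsub>Q\<^esub>"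
        using f.pi_order[OF h(1)] by simp
      finally show ?thesis
        using pih tj by simp
    qed
  qed
  interpret cj: group_hom Q Q "\<lambda>z. conjugate Q z (f g)"
    by (rule f.hom.H.conjugate_hom) (use g in simp)
  have gen: "generate Q {z} = range (\<lambda>i::int. z [^]\<^bsub>Q\<^esub> i)" if "z \<in> carrier Q" for z
    using f.hom.H.generate_pow[OF that] by auto
  have conj: "conjugate Q (f y2 [^]\<^bsub>Q\<^esub> i) (f g) = f h [^]\<^bsub>Q\<^esub> i" for i :: int
  proof -
    have "conjugate Q (f y2 [^]\<^bsub>Q\<^esub> i) (f g) = conjugate Q (f y2) (f g) [^]\<^bsub>Q\<^esub> i"
      by (rule cj.hom_int_pow) simp
    also have "conjugate Q (f y2) (f g) = f h"
      using g by (simp add: h_def conjugate_def)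
    finally show ?thesis .
  qed
  have "conjugate Q \<one>\<^bsub>Q\<^esub> (f g) \<in> (\<lambda>z. conjugate Q z (f g)) ` generate Q {f y2}"
    by (intro imageI generate.one)
  then have "\<one>\<^bsub>Q\<^esub> \<in> (\<lambda>z. conjugate Q z (f g)) ` generate Q {f y2} \<inter> generate Q {f t}"
    using generate.one[of Q "{f t}"] g by simp
  moreover have "z = \<one>\<^bsub>Q\<^esub>" if zz: "z \<in> (\<lambda>z. conjugate Q z (f g)) ` generate Q {f y2} \<inter> generate Q {f t}" for z
  proof -
    obtain i :: int where "z = conjugate Q (f y2 [^]\<^bsub>Q\<^esub> i) (f g)"
      using zz gen[of "f y2"] by auto
    moreover obtain j :: int where "z = f t [^]\<^bsub>Q\<^esub> j"
      using zz t gen[of "f t"] by auto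
    ultimately show ?thesis
      using triv[of i j] conj[of i] by simp
  qed
  ultimately have "(\<lambda>z. conjugate Q z (f g)) ` generate Q {f y2} \<inter> generate Q {f t} = {\<one>\<^bsub>Q\<^esub>}"
    by blast
  then show ?thesis
    by (simp add: f_def Q_def)
qed

end

section \<open>Constructing a Beauville structure\<close>

context H_series
begin

abbreviation "V m \<equiv> V_sub p a (m + 1)"

lemma V_generators:
  "X [^]\<^bsub>F2\<^esub> (p ^ m) \<in> V m" "Y [^]\<^bsub>F2\<^esub> (p ^ m) \<in> V m" "U m \<subseteq> V m"
proof -
  let ?S = "{X [^]\<^bsub>F2\<^esub> (p ^ m), Y [^]\<^bsub>F2\<^esub> (p ^ m)}"
  have S: "subgroup (generate F2 ?S) F2"
    by (rule F2.generate_is_subgroup) auto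
  have "generate F2 ?S \<subseteq> V m" "U m \<subseteq> V m"
    unfolding V_sub_eq
    by (intro F2.subset_setmult_left F2.subset_setmult_right subgroup.subset[OF S] U_subgroup S
        subgroup.subset[OF U_subgroup])+
  then show "X [^]\<^bsub>F2\<^esub> (p ^ m) \<in> V m" "Y [^]\<^bsub>F2\<^esub> (p ^ m) \<in> V m" "U m \<subseteq> V m"
    using generate.incl[of _ ?S F2] by blast+
qed

lemma V_least:
  assumes "subgroup K F2" "X [^]\<^bsub>F2\<^esub> (p ^ m) \<in> K" "Y [^]\<^bsub>F2\<^esub> (p ^ m) \<in> K" "U m \<subseteq> K"
  shows "V m \<subseteq> K"
  unfolding V_sub_eq using assms by (intro F2.setmult_least F2.generate_subgroup_incl) auto

lemma int_pow_split:
  "h \<in> carrier F2 \<Longrightarrow> h [^]\<^bsub>F2\<^esub> (i * int p ^ m) = (h [^]\<^bsub>F2\<^esub> (p ^ m)) [^]\<^bsub>F2\<^esub> i"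
  by (simp add: F2.int_pow_pow int_pow_int[symmetric] mult.commute)

lemma XY_power_in:
  assumes K: "subgroup K F2" and "X [^]\<^bsub>F2\<^esub> (p ^ m) \<in> K" "Y [^]\<^bsub>F2\<^esub> (p ^ m) \<in> K"
  shows "X [^]\<^bsub>F2\<^esub> (i * int p ^ m) \<otimes>\<^bsub>F2\<^esub> Y [^]\<^bsub>F2\<^esub> (j * int p ^ m) \<in> K"
  using assms by (simp add: int_pow_split subgroup.m_closed F2.subgroup_int_pow_closed)

lemma V_subgroup: "subgroup (V m) F2"
proof -
  have S: "subgroup (generate F2 {X [^]\<^bsub>F2\<^esub> (p ^ m), Y [^]\<^bsub>F2\<^esub> (p ^ m)}) F2"
    by (rule F2.generate_is_subgroup) auto
  have "V m = U m <#>\<^bsub>F2\<^esub> generate F2 {X [^]\<^bsub>F2\<^esub> (p ^ m), Y [^]\<^bsub>F2\<^esub> (p ^ m)}"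
    unfolding V_sub_eq by (rule F2.commut_normal[OF S U_normal])
  then show ?thesis
    using group.mult_norm_subgroup[OF F2_group U_normal S] by simp
qed

lemma small_not_dvd: "\<not> int p dvd 1" "\<not> int p dvd 2" "\<not> int p dvd 3" "\<not> int p dvd 4" "\<not> int p dvd 6"
proof -
  have small: "\<not> int p dvd k" if "0 < k" "k < 5" for k
    using zdvd_imp_le[of "int p" k] that p_ge_5 by auto
  show *: "\<not> int p dvd 1" "\<not> int p dvd 2" "\<not> int p dvd 3" "\<not> int p dvd 4"
    by (rule small; simp)+
  have "Factorial_Ring.prime (int p)"
    using p_prime by simp
  then show "\<not> int p dvd 6"
    using * prime_dvd_mult_iff[of "int p" 2 3] by simp
qed

lemma coprime_q: "\<not> int p dvd i \<Longrightarrow> coprime i (int q)"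
  using prime_imp_coprime[of "int p" i] p_prime by (simp add: coprime_commute)

text \<open>The triples are \<open>(x, y, (x y)\<^sup>-\<^sup>1)\<close> and \<open>(r, s, (r s)\<^sup>-\<^sup>1)\<close> with \<open>r = x y\<^sup>2\<close> and \<open>s = x y\<^sup>4\<close>. Their vectors of exponent
  sums have slopes \<open>0, \<infinity>, 1\<close> and \<open>2, 4, 3\<close>; the determinants of pairs
  with one vector from each triple are up to sign \<open>1, 2, 3, 4, 6\<close>.\<close>

lemma sufficiency:
  assumes W: "W \<lhd> F2" and UW: "U m \<subseteq> W" and WP: "W \<subseteq> P (m + 1)" and m: "m \<ge> 1"
    and V: "V m \<subseteq> W \<or> W \<inter> V m = U m"
  shows "beauville_group (F2 Mod W)"
proof -
  interpret W: normal W F2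
    by (rule W)
  define Q where "Q = F2 Mod W"
  define f where "f = (#>\<^bsub>F2\<^esub>) W"
  interpret f: H_power_hom p a Q f m
    unfolding f_def Q_def by (rule factor_H_power_hom[OF W UW])
  have f_eq_one: "f u = \<one>\<^bsub>Q\<^esub> \<longleftrightarrow> u \<in> W" if "u \<in> carrier F2" for u
    using that unfolding f_def Q_def by (rule W.coset_eq_one_iff)
  have carrier_Q: "carrier Q = f ` carrier F2"
    by (simp add: Q_def f_def carrier_FactGroup)
  define trivial where "trivial u v \<longleftrightarrow> (\<forall>g\<in>carrier F2. (\<lambda>z. conjugate Q z (f g)) ` generate Q {f u}
    \<inter> generate Q {f v} = {\<one>\<^bsub>Q\<^esub>})" for u v
  have V_case: "\<forall>g\<in>carrier F2. coprime (ex g) (int q) \<longrightarrow> g [^]\<^bsub>F2\<^esub> (q * p ^ m) \<in> W" if VW: "V m \<subseteq> W"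
  proof (intro ballI impI)
    fix g assume g: "g \<in> carrier F2" "coprime (ex g) (int q)"
    have "f.XY (ex g) (ey g) = \<one>\<^bsub>Q\<^esub>"
      unfolding f.XY_eq using VW V_generators[of m]
      by (subst f_eq_one) (auto intro!: XY_power_in W.subgroup_axioms)
    then have "f (g [^]\<^bsub>F2\<^esub> (q * p ^ m)) = \<one>\<^bsub>Q\<^esub>"
      unfolding f.hom_pow_eq_XY[OF g] .
    then show "g [^]\<^bsub>F2\<^esub> (q * p ^ m) \<in> W"
      by (subst (asm) f_eq_one) (use g in simp_all)
  qed
  have U_case: "int p dvd i \<and> int p dvd j"
    if WV: "W \<inter> V m = U m" and XY: "X [^]\<^bsub>F2\<^esub> (i * int p ^ m) \<otimes>\<^bsub>F2\<^esub> Y [^]\<^bsub>F2\<^esub> (j * int p ^ m) \<in> W" for i j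
  proof -
    have "X [^]\<^bsub>F2\<^esub> (i * int p ^ m) \<otimes>\<^bsub>F2\<^esub> Y [^]\<^bsub>F2\<^esub> (j * int p ^ m) \<in> V m"
      by (intro XY_power_in V_subgroup V_generators)
    then have "X [^]\<^bsub>F2\<^esub> (i * int p ^ m) \<otimes>\<^bsub>F2\<^esub> Y [^]\<^bsub>F2\<^esub> (j * int p ^ m) \<in> P (m + 2)"
      using XY WV U_subset_P[of m] by blast
    then show ?thesis
      using independence by blast
  qed
  have good: "trivial u v"
    if uv: "u \<in> carrier F2" "v \<in> carrier F2" "coprime (ex u) (int q)" "coprime (ex v) (int q)"
      and det: "\<not> int p dvd ex u * ey v - ey u * ex v" for u v
    using V
  proof
    assume VW: "V m \<subseteq> W"
    define k where "k = m - 1"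
    have k: "m = Suc k"
      using m by (simp add: k_def)
    show ?thesis
      unfolding trivial_def f_def Q_def
    proof
      fix g assume g: "g \<in> carrier F2"
      show "(\<lambda>z. conjugate (F2 Mod W) z (W #>\<^bsub>F2\<^esub> g)) ` generate (F2 Mod W) {W #>\<^bsub>F2\<^esub> u}
        \<inter> generate (F2 Mod W) {W #>\<^bsub>F2\<^esub> v} = {\<one>\<^bsub>F2 Mod W\<^esub>}"
      proof (rule independent_pair_trivial_intersection[where k = k and M = "P (m + 1)"])
        show "U k \<subseteq> P (m + 1)"
          using U_subset_P[of k] by (simp add: k)
        show "int p dvd i \<and> int p dvd j"
          if "X [^]\<^bsub>F2\<^esub> (i * int p ^ k) \<otimes>\<^bsub>F2\<^esub> Y [^]\<^bsub>F2\<^esub> (j * int p ^ k) \<in> P (m + 1)" for i j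
          using independence[of i k j] that by (simp add: k)
        show "u [^]\<^bsub>F2\<^esub> (q * p ^ Suc k) \<in> W"
          using V_case[OF VW] uv k by blast
      qed (use uv det g W WP P_normal in auto)
    qed
  next
    assume WV: "W \<inter> V m = U m"
    show ?thesis
      unfolding trivial_def f_def Q_def
    proof
      fix g assume g: "g \<in> carrier F2"
      show "(\<lambda>z. conjugate (F2 Mod W) z (W #>\<^bsub>F2\<^esub> g)) ` generate (F2 Mod W) {W #>\<^bsub>F2\<^esub> u}
        \<inter> generate (F2 Mod W) {W #>\<^bsub>F2\<^esub> v} = {\<one>\<^bsub>F2 Mod W\<^esub>}"
      proof (rule independent_pair_trivial_intersection[where k = m and M = W])
        have "f (u [^]\<^bsub>F2\<^esub> (q * p ^ m)) [^]\<^bsub>Q\<^esub> p = \<one>\<^bsub>Q\<^esub>"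
          unfolding f.hom_pow_eq_XY[OF uv(1,3)] f.XY_nat_pow by (rule f.XY_p_dvd) simp_all
        then have "f (u [^]\<^bsub>F2\<^esub> (q * p ^ Suc m)) = \<one>\<^bsub>Q\<^esub>"
          using uv by (simp add: f.hom.hom_nat_pow f.hom.H.nat_pow_pow mult_ac)
        then show "u [^]\<^bsub>F2\<^esub> (q * p ^ Suc m) \<in> W"
          by (subst (asm) f_eq_one) (use uv in simp_all)
      qed (use uv det g W WP UW U_case[OF WV] in auto)
    qed
  qed
  have y_triv: "trivial y2 v" if v: "v \<in> carrier F2" "coprime (ex v) (int q)" and a: "a \<ge> 1" for v
    unfolding trivial_def f_def Q_def
    using v a V V_case U_case by (intro ballI y_trivial_intersection[OF W UW WP]) blast+
  define r where "r = x2 \<otimes>\<^bsub>F2\<^esub> y2 [^]\<^bsub>F2\<^esub> (2::nat)"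
  define s where "s = x2 \<otimes>\<^bsub>F2\<^esub> y2 [^]\<^bsub>F2\<^esub> (4::nat)"
  let ?inv = "\<lambda>u v. inv\<^bsub>F2\<^esub> (u \<otimes>\<^bsub>F2\<^esub> v)"
  have rs: "r \<in> carrier F2" "s \<in> carrier F2" "ex r = 1" "ey r = 2" "ex s = 1" "ey s = 4"
    by (simp_all add: r_def s_def)
  have all_trivial: "trivial u v" if u: "u \<in> {x2, y2, ?inv x2 y2}" and v: "v \<in> {r, s, ?inv r s}" for u v
  proof -
    have cl: "u \<in> carrier F2" "v \<in> carrier F2"
      using u v rs by auto
    have cv: "coprime (ex v) (int q)"
      using v rs small_not_dvd by (intro coprime_q) auto
    show ?thesis
    proof (cases "u = y2 \<and> a \<ge> 1")
      case True
      then show ?thesis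
        using y_triv cl cv by blast
    next
      case False
      have "coprime (ex u) (int q)"
      proof (cases "a = 0")
        case a0: False
        then show ?thesis
          using False u by auto
      qed simp
      moreover have "\<not> int p dvd ex u * ey v - ey u * ex v"
        using u v rs small_not_dvd by auto
      ultimately show ?thesis
        using good cl cv by blast
    qed
  qed
  have triple: "spherical_triple Q (f u, f v, f (?inv u v))"
    if "u \<in> carrier F2" "v \<in> carrier F2" "f x2 \<in> generate Q {f u, f v, f (?inv u v)}"
      "f y2 \<in> generate Q {f u, f v, f (?inv u v)}" for u v
  proof -
    have "subgroup (generate Q {f u, f v, f (?inv u v)}) Q"
      using that by (intro f.hom.H.generate_is_subgroup) auto
    then have "generate Q {f x2, f y2} \<subseteq> generate Q {f u, f v, f (?inv u v)}"
      using that by (intro f.hom.H.generate_subgroup_incl) auto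
    moreover have "generate Q {f x2, f y2} = carrier Q"
      using f.hom.generate_img[of "{x2, y2}"] F2_generated carrier_Q by simp
    moreover have "generate Q {f u, f v, f (?inv u v)} \<subseteq> carrier Q"
      using that by (intro f.hom.H.generate_incl) auto
    ultimately show ?thesis
      using that by (auto simp: spherical_triple_def simp flip: f.hom.hom_mult)
  qed
  have T1: "spherical_triple Q (f x2, f y2, f (?inv x2 y2))"
    by (rule triple) (auto intro: generate.incl)
  have T2: "spherical_triple Q (f r, f s, f (?inv r s))"
  proof -
    let ?K = "generate Q {f r, f s, f (?inv r s)}"
    have K: "subgroup ?K Q"
      using rs by (intro f.hom.H.generate_is_subgroup) auto
    have frs: "f r \<in> ?K" "f s \<in> ?K"
      by (auto intro: generate.incl)
    have "inv\<^bsub>F2\<^esub> r \<otimes>\<^bsub>F2\<^esub> s = y2 [^]\<^bsub>F2\<^esub> (2::nat)"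
    proof -
      have "s = r \<otimes>\<^bsub>F2\<^esub> y2 [^]\<^bsub>F2\<^esub> (2::nat)"
        by (simp add: r_def s_def F2.m_assoc F2.nat_pow_mult)
      then show ?thesis
        using rs(1) by (simp add: F2.inv_mult_cancel)
    qed
    then have "f (y2 [^]\<^bsub>F2\<^esub> (2::nat)) = inv\<^bsub>Q\<^esub> f r \<otimes>\<^bsub>Q\<^esub> f s"
      using rs by (metis F2.inv_closed f.hom.hom_inv f.hom.hom_mult)
    then have y2: "f (y2 [^]\<^bsub>F2\<^esub> (2::nat)) \<in> ?K"
      using frs K by (simp add: subgroup.m_closed subgroup.m_inv_closed)
    have "y2 [^]\<^bsub>F2\<^esub> (p ^ (m + 1)) \<in> W"
      using A_pow_in_U[of y2 m] UW by auto
    then have one: "f (y2 [^]\<^bsub>F2\<^esub> (p ^ (m + 1))) = \<one>\<^bsub>Q\<^esub>"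
      by (subst f_eq_one) simp_all
    \<comment> \<open>The subgroup of \<open>F2\<close> generated by \<open>r\<close> and \<open>s\<close> contains \<open>y\<^sup>2\<close> but not \<open>y\<close>; however, \<open>y\<close> has odd order modulo \<open>W\<close>.\<close>
    have "odd (p ^ (m + 1))"
      using p_prime p_ge_5 prime_odd_nat[of p] by simp
    then obtain l where l: "p ^ (m + 1) = 2 * l + 1"
      by (elim oddE)
    have "f y2 = inv\<^bsub>Q\<^esub> (f (y2 [^]\<^bsub>F2\<^esub> (2::nat)) [^]\<^bsub>Q\<^esub> l)"
    proof (rule f.hom.H.inv_equality[symmetric])
      have "f y2 \<otimes>\<^bsub>Q\<^esub> f (y2 [^]\<^bsub>F2\<^esub> (2::nat)) [^]\<^bsub>Q\<^esub> l = f (y2 \<otimes>\<^bsub>F2\<^esub> (y2 [^]\<^bsub>F2\<^esub> (2 * l)))"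
        by (simp add: f.hom.hom_nat_pow F2.nat_pow_pow[symmetric] del: F2.nat_pow_pow)
      also have "y2 \<otimes>\<^bsub>F2\<^esub> y2 [^]\<^bsub>F2\<^esub> (2 * l) = y2 [^]\<^bsub>F2\<^esub> (p ^ (m + 1))"
        using F2.nat_pow_Suc2[of y2 "2 * l"] unfolding l by simp
      finally show "f y2 \<otimes>\<^bsub>Q\<^esub> f (y2 [^]\<^bsub>F2\<^esub> (2::nat)) [^]\<^bsub>Q\<^esub> l = \<one>\<^bsub>Q\<^esub>"
        unfolding one .
    qed (auto intro!: f.hom.H.nat_pow_closed)
    then have fy: "f y2 \<in> ?K"
      using f.hom.H.subgroup_int_pow_closed[OF K y2, of "int l"] K
      by (simp add: int_pow_int subgroup.m_inv_closed)
    have "x2 = r \<otimes>\<^bsub>F2\<^esub> inv\<^bsub>F2\<^esub> (y2 [^]\<^bsub>F2\<^esub> (2::nat))"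
      by (simp add: r_def F2.m_assoc)
    then have "f x2 = f r \<otimes>\<^bsub>Q\<^esub> inv\<^bsub>Q\<^esub> f (y2 [^]\<^bsub>F2\<^esub> (2::nat))"
      using rs by (metis F2.inv_closed F2.nat_pow_closed f.hom.hom_inv f.hom.hom_mult y2_closed)
    then have "f x2 \<in> ?K"
      using frs y2 K by (simp add: subgroup.m_closed subgroup.m_inv_closed)
    then show ?thesis
      using fy rs by (intro triple) auto
  qed
  have "\<forall>t1\<in>components (f x2, f y2, f (?inv x2 y2)). \<forall>t2\<in>components (f r, f s, f (?inv r s)).
    \<forall>g\<in>carrier Q. (\<lambda>z. conjugate Q z g) ` generate Q {t1} \<inter> generate Q {t2} = {\<one>\<^bsub>Q\<^esub>}"
  proof (intro ballI)
    fix t1 t2 g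
    assume t1: "t1 \<in> components (f x2, f y2, f (?inv x2 y2))" and t2: "t2 \<in> components (f r, f s, f (?inv r s))"
      and g: "g \<in> carrier Q"
    have comp: "components (f u, f v, f w) = f ` {u, v, w}" for u v w
      by simp
    obtain u where u: "t1 = f u" "u \<in> {x2, y2, ?inv x2 y2}"
      using t1 unfolding comp by blast
    obtain v where v: "t2 = f v" "v \<in> {r, s, ?inv r s}"
      using t2 unfolding comp by blast
    obtain g' where "g = f g'" "g' \<in> carrier F2"
      using g carrier_Q by auto
    then show "(\<lambda>z. conjugate Q z g) ` generate Q {t1} \<inter> generate Q {t2} = {\<one>\<^bsub>Q\<^esub>}"
      using all_trivial[OF u(2) v(2)] u(1) v(1) unfolding trivial_def by blast
  qed
  moreover have "group Q" "finite (carrier Q)"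
    using f.hom.H.is_group finite_factor[OF W UW] by (simp_all add: Q_def)
  ultimately have "beauville_group Q"
    using T1 T2 unfolding beauville_group_def by blast
  then show ?thesis
    by (simp add: Q_def)
qed

end

section \<open>Obstructing a Beauville structure\<close>

text \<open>A subgroup of the integer plane strictly between \<open>p\<close> times the plane and the plane is a line modulo \<open>p\<close>: by Cramer's rule, an
  element of \<open>L\<close> independent of \<open>(i0, j0)\<close> would put \<open>(u, v)\<close> into \<open>L\<close>.\<close>

lemma line_mod_prime:
  fixes p :: int and L :: "int \<Rightarrow> int \<Rightarrow> bool"
  assumes p: "Factorial_Ring.prime p" and pL: "\<And>i j. p dvd i \<Longrightarrow> p dvd j \<Longrightarrow> L i j"
    and add: "\<And>i j k l. L i j \<Longrightarrow> L k l \<Longrightarrow> L (i + k) (j + l)"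
    and scale: "\<And>i j c. L i j \<Longrightarrow> L (c * i) (c * j)"
    and non0: "L i0 j0" "\<not> (p dvd i0 \<and> p dvd j0)" and nall: "\<not> L u v"
  shows "\<exists>\<alpha> \<beta>. \<not> (p dvd \<alpha> \<and> p dvd \<beta>) \<and> (\<forall>i j. L i j \<longleftrightarrow> p dvd \<alpha> * i + \<beta> * j)"
proof (intro exI conjI allI)
  have cancel: "L i j" if "L (d * i) (d * j)" "\<not> p dvd d" for d i j
  proof -
    have "coprime d p"
      using Factorial_Ring.prime_imp_coprime[OF p that(2)] by (simp add: coprime_commute)
    then obtain s t where st: "s * d + t * p = 1"
      using bezout_int[of d p] by auto
    have "L (s * (d * i) + p * (t * i)) (s * (d * j) + p * (t * j))"
      by (rule add[OF scale[OF that(1)] pL]) simp_all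
    moreover have "s * (d * k) + p * (t * k) = k" for k
    proof -
      have "s * (d * k) + p * (t * k) = (s * d + t * p) * k"
        by (simp add: algebra_simps)
      then show ?thesis
        using st by simp
    qed
    ultimately show ?thesis
      by simp
  qed
  show "\<not> (p dvd j0 \<and> p dvd - i0)"
    using non0 by auto
  fix i j
  show "L i j \<longleftrightarrow> p dvd j0 * i + (- i0) * j"
  proof
    assume L: "L i j"
    show "p dvd j0 * i + (- i0) * j"
    proof (rule ccontr)
      assume "\<not> p dvd j0 * i + (- i0) * j"
      moreover have "L ((j0 * i + (- i0) * j) * u) ((j0 * i + (- i0) * j) * v)"
      proof -
        have "L ((i * v - j * u) * i0 + (j0 * u - i0 * v) * i) ((i * v - j * u) * j0 + (j0 * u - i0 * v) * j)"
          by (rule add[OF scale[OF non0(1)] scale[OF L]])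
        then show ?thesis
          by (simp add: algebra_simps)
      qed
      ultimately show False
        using cancel nall by blast
    qed
  next
    assume d: "p dvd j0 * i + (- i0) * j"
    show "L i j"
    proof (cases "p dvd i0")
      case False
      have "L (i * i0 + 0) (i * j0 + (- (j0 * i + (- i0) * j)))"
        by (rule add[OF scale[OF non0(1)] pL]) (use d in \<open>simp_all only: dvd_minus_iff dvd_0_right\<close>)
      then show ?thesis
        using cancel[OF _ False, of i j] by (simp add: algebra_simps)
    next
      case True
      then have "\<not> p dvd j0"
        using non0 by simp
      moreover have "L (j * i0 + (j0 * i + (- i0) * j)) (j * j0 + 0)"
        by (rule add[OF scale[OF non0(1)] pL]) (use d True in auto)
      ultimately show ?thesis
        using cancel[of j0 i j] by (simp add: algebra_simps)
    qed
  qed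
qed

context H_series
begin

text \<open>If each of the three components were killed modulo \<open>p\<close> by one of the functionals \<open>ex\<close> and \<open>\<alpha> ex + \<beta> ey\<close>, one of
  these functionals would kill two of them. It would then kill the third, as the components multiply to \<open>1\<close>, and so
  all of \<open>F2\<close>, as they generate it modulo \<open>W\<close>.\<close>

lemma component_off_line:
  assumes W: "W \<lhd> F2" and WP: "W \<subseteq> P 2" and nz: "\<not> (int p dvd \<alpha> \<and> int p dvd \<beta>)"
    and T: "spherical_triple (F2 Mod W) T"
  obtains u where "u \<in> carrier F2" "W #>\<^bsub>F2\<^esub> u \<in> components T" "\<not> int p dvd ex u"
    "\<not> int p dvd \<alpha> * ex u + \<beta> * ey u"
proof -
  interpret W: normal W F2
    by (rule W)
  define Q where "Q = F2 Mod W"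
  define f where "f = (#>\<^bsub>F2\<^esub>) W"
  interpret f: group_hom F2 Q f
    unfolding f_def Q_def by (rule W.quotient_hom)
  have carrier_Q: "carrier Q = f ` carrier F2"
    by (simp add: Q_def f_def carrier_FactGroup)
  obtain r' s' t' where rst': "T = (r', s', t')"
    by (cases T)
  with T have T': "r' \<in> carrier Q" "s' \<in> carrier Q" "t' \<in> carrier Q" "generate Q {r', s', t'} = carrier Q"
    "r' \<otimes>\<^bsub>Q\<^esub> s' \<otimes>\<^bsub>Q\<^esub> t' = \<one>\<^bsub>Q\<^esub>"
    by (simp_all add: spherical_triple_def Q_def)
  obtain r s t where rst: "r \<in> carrier F2" "s \<in> carrier F2" "t \<in> carrier F2" "r' = f r" "s' = f s" "t' = f t"
    using T'(1-3) unfolding carrier_Q by blast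
  have "f (r \<otimes>\<^bsub>F2\<^esub> s \<otimes>\<^bsub>F2\<^esub> t) = \<one>\<^bsub>Q\<^esub>"
    using T'(5) rst by simp
  then have rstW: "r \<otimes>\<^bsub>F2\<^esub> s \<otimes>\<^bsub>F2\<^esub> t \<in> W"
    unfolding f_def Q_def using rst by (subst (asm) W.coset_eq_one_iff) auto
  have W_dvd: "int p dvd ex w" "int p dvd ey w" if "w \<in> W" for w
  proof -
    have w: "w \<in> P (1 + 1)"
      using that WP by (auto simp: numeral_2_eq_2)
    show "int p dvd ex w"
      using ex_on_P[OF w] by (simp add: dvd_mult_right)
    have "int p ^ 1 dvd ey w"
      using w by (rule additive_dvd_on_P[rotated]) simp
    then show "int p dvd ey w"
      by simp
  qed
  have functional: "int p dvd \<gamma> \<and> int p dvd \<delta>"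
    if two: "int p dvd \<gamma> * ex r + \<delta> * ey r \<and> int p dvd \<gamma> * ex s + \<delta> * ey s
      \<or> int p dvd \<gamma> * ex r + \<delta> * ey r \<and> int p dvd \<gamma> * ex t + \<delta> * ey t
      \<or> int p dvd \<gamma> * ex s + \<delta> * ey s \<and> int p dvd \<gamma> * ex t + \<delta> * ey t" for \<gamma> \<delta>
  proof -
    define \<mu> where "\<mu> u = \<gamma> * ex u + \<delta> * ey u" for u
    have mult: "\<mu> (u \<otimes>\<^bsub>F2\<^esub> v) = \<mu> u + \<mu> v" for u v
      by (simp add: \<mu>_def algebra_simps)
    have inv_\<mu>: "\<mu> (inv\<^bsub>F2\<^esub> u) = - \<mu> u" if "u \<in> carrier F2" for u
      using that by (simp add: \<mu>_def)
    have W\<mu>: "int p dvd \<mu> w" if "w \<in> W" for w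
      unfolding \<mu>_def using W_dvd[OF that] by simp
    have sum: "int p dvd \<mu> r + \<mu> s + \<mu> t"
      using W\<mu>[OF rstW] by (simp add: mult)
    have three: "int p dvd \<mu> r \<and> int p dvd \<mu> s \<and> int p dvd \<mu> t"
      using two[folded \<mu>_def] sum by (metis dvd_add_right_iff dvd_add_left_iff add.assoc)
    have gen: "int p dvd \<mu> g" if "g \<in> generate F2 {r, s, t}" for g
      using that
    proof (induction rule: generate.induct)
      case one
      then show ?case
        by (simp add: \<mu>_def)
    next
      case (incl h)
      then show ?case
        using three by auto
    next
      case (inv h)
      then show ?case
        using three rst by (auto simp: inv_\<mu>)
    next
      case (eng h1 h2)
      then show ?case
        by (simp add: mult)
    qed
    have "generate Q (f ` {r, s, t}) = f ` generate F2 {r, s, t}"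
      using rst by (intro f.generate_img) auto
    then have img: "f ` carrier F2 = f ` generate F2 {r, s, t}"
      using T'(4) rst by (simp add: carrier_Q)
    have all: "int p dvd \<mu> g" if g: "g \<in> carrier F2" for g
    proof -
      obtain k where k: "k \<in> generate F2 {r, s, t}" "f g = f k"
        using img g by blast
      then have "k \<in> carrier F2"
        using F2.generate_in_carrier[of "{r, s, t}"] rst by auto
      then obtain w where "w \<in> W" "g = w \<otimes>\<^bsub>F2\<^esub> k"
        using F2.coset_eqD[OF W.subgroup_axioms g] k(2) unfolding f_def by blast
      then show ?thesis
        using W\<mu> gen[OF k(1)] by (simp add: mult)
    qed
    show ?thesis
      using all[of x2] all[of y2] by (simp add: \<mu>_def)
  qed
  have "\<not> (int p dvd ex r \<and> int p dvd ex s \<or> int p dvd ex r \<and> int p dvd ex t \<or> int p dvd ex s \<and> int p dvd ex t)"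
    using functional[of 1 0] small_not_dvd(1) by (simp only: mult_1 mult_zero_left add_0_right) blast
  moreover note functional[of \<alpha> \<beta>] nz
  ultimately have "\<exists>u\<in>{r, s, t}. \<not> int p dvd ex u \<and> \<not> int p dvd \<alpha> * ex u + \<beta> * ey u"
    by blast
  then obtain u where "u \<in> {r, s, t}" "\<not> int p dvd ex u" "\<not> int p dvd \<alpha> * ex u + \<beta> * ey u"
    by blast
  then show thesis
    using that[of u] rst rst' by (auto simp: f_def)
qed

text \<open>Here \<open>L\<close> is the set of \<open>(i, j)\<close> for which \<open>\<pi>(X)\<^sup>i \<pi>(Y)\<^sup>j\<close> is trivial modulo \<open>W\<close>. For components \<open>t1\<close> and \<open>t2\<close> off this line,
  suitable multiples of their coordinates agree modulo \<open>L\<close>, which gives a common nontrivial power.\<close>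

lemma necessity:
  assumes W: "W \<lhd> F2" and UW: "U m \<subseteq> W" and WP: "W \<subseteq> P (m + 1)" and m: "m \<ge> 1"
    and VW: "\<not> V m \<subseteq> W" and WV: "W \<inter> V m \<noteq> U m"
  shows "\<not> beauville_group (F2 Mod W)"
proof
  assume beauville: "beauville_group (F2 Mod W)"
  interpret W: normal W F2
    by (rule W)
  define Q where "Q = F2 Mod W"
  define f where "f = (#>\<^bsub>F2\<^esub>) W"
  interpret f: H_power_hom p a Q f m
    unfolding f_def Q_def by (rule factor_H_power_hom[OF W UW])
  have f_eq_one: "f u = \<one>\<^bsub>Q\<^esub> \<longleftrightarrow> u \<in> W" if "u \<in> carrier F2" for u
    using that unfolding f_def Q_def by (rule W.coset_eq_one_iff)
  interpret N: normal "U m" F2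
    by (rule U_normal)
  define R where "R = F2 Mod U m"
  define h where "h = (#>\<^bsub>F2\<^esub>) (U m)"
  interpret h: H_power_hom p a R h m
    unfolding h_def R_def by (rule factor_H_power_hom[OF U_normal subset_refl])
  have h_eq_one: "h u = \<one>\<^bsub>R\<^esub> \<longleftrightarrow> u \<in> U m" if "u \<in> carrier F2" for u
    using that unfolding h_def R_def by (rule N.coset_eq_one_iff)
  define L where "L i j \<longleftrightarrow> f.XY i j = \<one>\<^bsub>Q\<^esub>" for i j
  have gens: "h (X [^]\<^bsub>F2\<^esub> (p ^ m)) = h.XY 1 0" "h (Y [^]\<^bsub>F2\<^esub> (p ^ m)) = h.XY 0 1"
    "f (X [^]\<^bsub>F2\<^esub> (p ^ m)) = f.XY 1 0" "f (Y [^]\<^bsub>F2\<^esub> (p ^ m)) = f.XY 0 1"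
    unfolding h.XY_eq f.XY_eq by (simp_all add: int_pow_int flip: of_nat_power)
  have V_XY: "\<exists>i j. h v = h.XY i j" if v: "v \<in> V m" for v
  proof -
    let ?K = "{v \<in> carrier F2. \<exists>i j. h v = h.XY i j}"
    have "subgroup ?K F2"
    proof (rule F2.subgroupI)
      have "\<one>\<^bsub>F2\<^esub> \<in> ?K"
        by (auto intro!: exI[of _ 0])
      then show "?K \<noteq> {}"
        by blast
      show "inv\<^bsub>F2\<^esub> u \<in> ?K" if "u \<in> ?K" for u
        using that by (auto simp: h.XY_inv) blast
      show "u \<otimes>\<^bsub>F2\<^esub> v \<in> ?K" if "u \<in> ?K" "v \<in> ?K" for u v
        using that by (auto simp: h.XY_mult) blast
    qed auto
    moreover have "U m \<subseteq> ?K"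
    proof
      fix u assume u: "u \<in> U m"
      then have "h u = h.XY 0 0"
        by (subst h.XY_one, subst h_eq_one) auto
      then show "u \<in> ?K"
        using U_closed[OF u] by blast
    qed
    ultimately have "V m \<subseteq> ?K"
      using gens by (intro V_least) auto
    then show ?thesis
      using v by auto
  qed
  obtain v where v: "v \<in> W" "v \<in> V m" "v \<notin> U m"
    using WV UW V_generators(3)[of m] by blast
  obtain i0 j0 where ij0: "h v = h.XY i0 j0"
    using V_XY[OF v(2)] by blast
  have "h.XY i0 j0 \<noteq> \<one>\<^bsub>R\<^esub>"
    using v h_eq_one[of v] by (simp flip: ij0)
  then have ij0_nz: "\<not> (int p dvd i0 \<and> int p dvd j0)"
    using h.XY_p_dvd by blast
  have "f v = f (X [^]\<^bsub>F2\<^esub> (i0 * int p ^ m) \<otimes>\<^bsub>F2\<^esub> Y [^]\<^bsub>F2\<^esub> (j0 * int p ^ m))"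
    using ij0 v unfolding h.XY_eq unfolding h_def f_def
    by (intro F2.coset_eq_mono[OF U_subgroup W.subgroup_axioms UW]) auto
  then have L0: "L i0 j0"
    using f_eq_one[of v] v by (simp add: L_def f.XY_eq)
  have "\<not> L 1 0 \<or> \<not> L 0 1"
  proof (rule ccontr)
    assume "\<not> ?thesis"
    then have "V m \<subseteq> W"
      using gens(3,4) UW f_eq_one by (intro V_least W.subgroup_axioms) (auto simp: L_def)
    then show False
      using VW by simp
  qed
  then obtain u1 v1 where uv: "\<not> L u1 v1"
    by blast
  have "\<exists>\<alpha> \<beta>. \<not> (int p dvd \<alpha> \<and> int p dvd \<beta>) \<and> (\<forall>i j. L i j \<longleftrightarrow> int p dvd \<alpha> * i + \<beta> * j)"
  proof (rule line_mod_prime[OF _ _ _ _ L0 ij0_nz uv])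
    show "L (i + k) (j + l)" if "L i j" "L k l" for i j k l
      using that f.XY_mult[of i j k l] by (simp add: L_def)
    show "L (c * i) (c * j)" if "L i j" for c i j
      using that f.XY_int_pow[of i j c] by (simp add: L_def mult.commute)
  qed (use p_prime f.XY_p_dvd in \<open>auto simp: L_def\<close>)
  then obtain \<alpha> \<beta> where \<alpha>\<beta>: "\<not> (int p dvd \<alpha> \<and> int p dvd \<beta>)" "\<And>i j. L i j \<longleftrightarrow> int p dvd \<alpha> * i + \<beta> * j"
    by blast
  obtain T1 T2 where T: "spherical_triple Q T1" "spherical_triple Q T2"
    "\<forall>t1\<in>components T1. \<forall>t2\<in>components T2. \<forall>g\<in>carrier Q.
      (\<lambda>z. conjugate Q z g) ` generate Q {t1} \<inter> generate Q {t2} = {\<one>\<^bsub>Q\<^esub>}"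
    using beauville unfolding beauville_group_def Q_def[symmetric] by blast
  have WP2: "W \<subseteq> P 2"
    using WP P_antimono[of 2 "m + 1"] m by auto
  obtain t1 where t1: "t1 \<in> carrier F2" "f t1 \<in> components T1" "\<not> int p dvd ex t1" "\<not> int p dvd \<alpha> * ex t1 + \<beta> * ey t1"
    using component_off_line[OF W WP2 \<alpha>\<beta>(1) T(1)[unfolded Q_def]] unfolding f_def by blast
  obtain t2 where t2: "t2 \<in> carrier F2" "f t2 \<in> components T2" "\<not> int p dvd ex t2" "\<not> int p dvd \<alpha> * ex t2 + \<beta> * ey t2"
    using component_off_line[OF W WP2 \<alpha>\<beta>(1) T(2)[unfolded Q_def]] unfolding f_def by blast
  define d1 where "d1 = \<alpha> * ex t1 + \<beta> * ey t1"
  define d2 where "d2 = \<alpha> * ex t2 + \<beta> * ey t2"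
  have pow: "f t [^]\<^bsub>Q\<^esub> (int (q * p ^ m) * c) = f.XY (ex t * c) (ey t * c)"
    if "t \<in> carrier F2" "\<not> int p dvd ex t" for t c
  proof -
    have "f t [^]\<^bsub>Q\<^esub> (int (q * p ^ m) * c) = f (t [^]\<^bsub>F2\<^esub> (q * p ^ m)) [^]\<^bsub>Q\<^esub> c"
      using that by (simp add: f.hom.hom_int_pow f.hom.H.int_pow_pow int_pow_int[symmetric] del: of_nat_mult)
    then show ?thesis
      unfolding f.hom_pow_eq_XY[OF that(1) coprime_q[OF that(2)]] f.XY_int_pow .
  qed
  define z where "z = f.XY (ex t1 * d2) (ey t1 * d2)"
  have z1: "z \<in> generate Q {f t1}"
    using t1 by (simp add: f.hom.H.generate_pow z_def pow[symmetric]) blast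
  have "L (ex t1 * d2 - ex t2 * d1) (ey t1 * d2 - ey t2 * d1)"
  proof -
    have "\<alpha> * (ex t1 * d2 - ex t2 * d1) + \<beta> * (ey t1 * d2 - ey t2 * d1) = 0"
      by (simp add: d1_def d2_def algebra_simps)
    then show ?thesis
      unfolding \<alpha>\<beta>(2) by simp
  qed
  then have "f.XY (ex t1 * d2 - ex t2 * d1) (ey t1 * d2 - ey t2 * d1) \<otimes>\<^bsub>Q\<^esub> f.XY (ex t2 * d1) (ey t2 * d1)
    = f.XY (ex t2 * d1) (ey t2 * d1)"
    by (simp add: L_def)
  then have "z = f.XY (ex t2 * d1) (ey t2 * d1)"
    by (simp add: f.XY_mult z_def)
  then have z2: "z \<in> generate Q {f t2}"
    using t2 by (simp add: f.hom.H.generate_pow pow[symmetric]) blast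
  have "z \<noteq> \<one>\<^bsub>Q\<^esub>"
  proof -
    have "\<alpha> * (ex t1 * d2) + \<beta> * (ey t1 * d2) = d1 * d2"
      by (simp add: d1_def algebra_simps)
    moreover have "\<not> int p dvd d1 * d2"
      using t1 t2 p_prime prime_dvd_mult_iff[of "int p" d1 d2] by (simp add: d1_def d2_def)
    ultimately show ?thesis
      using \<alpha>\<beta>(2) by (simp add: z_def flip: L_def)
  qed
  moreover have "conjugate Q z \<one>\<^bsub>Q\<^esub> = z"
    by (simp add: z_def)
  then have "z \<in> (\<lambda>z. conjugate Q z \<one>\<^bsub>Q\<^esub>) ` generate Q {f t1} \<inter> generate Q {f t2}"
    using z1 z2 by (intro IntI) (metis imageI)
  ultimately show False
    using T(3) t1(2) t2(2) f.hom.H.one_closed by blast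
qed

end

theorem theorem3p10:
  fixes p a n :: nat and W :: "gen2 letter list set"
  assumes "Factorial_Ring.prime p" and "p \<ge> 5" and "n \<ge> 2"
    and "W \<lhd> F2"
    and "U_sub p a (n + 1) \<subseteq> W"
    and "W \<subseteq> lower_p_central F2 p (H_sub p a) n"
  shows "beauville_group (F2 Mod W) \<longleftrightarrow>
           W \<inter> V_sub p a n = V_sub p a n \<or> W \<inter> V_sub p a n = U_sub p a (n + 1)"
proof -
  interpret H_series p a
    using assms(1,2) by (rule H_series.intro)
  define m where "m = n - 1"
  have n: "n = m + 1" "m \<ge> 1"
    using assms(3) by (auto simp: m_def)
  have U: "U_sub p a (n + 1) = U m"
    using U_sub_eq[of m] n by simp
  have "U m \<subseteq> W"
    using assms(5) unfolding U .
  moreover have "W \<subseteq> P (m + 1)"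
    using assms(6) n(1) by simp
  ultimately have "beauville_group (F2 Mod W) \<longleftrightarrow> V m \<subseteq> W \<or> W \<inter> V m = U m"
    using sufficiency[OF assms(4)] necessity[OF assms(4)] n(2) by metis
  then show ?thesis
    unfolding U unfolding n(1) by (simp add: inf.absorb_iff2)
qed

end
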